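(* Let $\Omega\subset\mathbb{R}^N$ ($N\in\mathbb{N}$, $N\ge1$) be any bounded domain with smooth boundary $\Gamma$, $\omega$ any nonempty open subset of $\Omega$ with characteristic function $\chi_\omega$, $T>0$ arbitrary, $Q=\Omega\times(0,T)$ and $\Sigma=\Gamma\times(0,T)$. Let $M_2$ be the set of all $y(T)$, where $y$ solves $$\begin{cases} y_t-\Delta y=\chi_\omega u & \text{in } Q,\\ y=0 & \text{on }\Sigma,\\ y(0)=0 & \text{in }\Omega,\end{cases}$$ for some $u\in L^2(Q)$ with $|u|_{L^2(Q)}\le1$. Then $M_2$ is not finite codimensional in $L^2(\Omega)$.
   Context: Solutions of the heat equation are the usual weak (mild) solutions, with $y\in C([0,T];L^2(\Omega))$. Definition (finite codimensional set): a subset $M$ of a Hilbert space $Y$ is finite codimensional in $Y$ if there exists $x_0\in\overline{\mathrm{co}}\,M$ (the closed convex hull of $M$) such that $\mathrm{span}(M-\{x_0\})$, the closed subspace spanned by $M-\{x_0\}$, is a finite codimensional subspace of $Y$, and $\overline{\mathrm{co}}(M-\{x_0\})$ has at least one interior point in this subspace (with respect to its relative topology). *)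

theory Defs
  imports "HOL-Analysis.Analysis"
begin

section \<open>The Hilbert space of square-integrable functions\<close>

definition square_integrable :: "('a::euclidean_space \<Rightarrow> real) \<Rightarrow> bool" where
  "square_integrable f \<longleftrightarrow>
     f \<in> borel_measurable lborel \<and> integrable lborel (\<lambda>x. (f x)\<^sup>2)"

lemma square_integrable_mult:
  assumes "square_integrable f" "square_integrable g"
  shows "integrable lborel (\<lambda>x. f x * g x)"
proof -
  have [measurable]: "f \<in> borel_measurable lborel" "g \<in> borel_measurable lborel"
    using assms by (auto simp: square_integrable_def)
  have "integrable lborel (\<lambda>x. (f x)\<^sup>2 + (g x)\<^sup>2)"
    using assms by (auto simp: square_integrable_def)
  then show ?thesis
  proof (rule Bochner_Integration.integrable_bound)
    show "AE x in lborel. norm (f x * g x) \<le> norm ((f x)\<^sup>2 + (g x)\<^sup>2)"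
    proof (intro always_eventually allI)
      fix x
      have "\<bar>f x * g x\<bar> \<le> (f x)\<^sup>2 + (g x)\<^sup>2"
        using sum_squares_bound[of "\<bar>f x\<bar>" "\<bar>g x\<bar>"]
          mult_nonneg_nonneg[of "\<bar>f x\<bar>" "\<bar>g x\<bar>"] unfolding abs_mult power2_abs
        by linarith
      then show "norm (f x * g x) \<le> norm ((f x)\<^sup>2 + (g x)\<^sup>2)" by simp
    qed
  qed measurable
qed

lemma square_integrable_zero: "square_integrable (\<lambda>x. 0)"
  by (simp add: square_integrable_def)

lemma square_integrable_add:
  assumes "square_integrable f" "square_integrable g"
  shows "square_integrable (\<lambda>x. f x + g x)"
  using assms integrable_mult_right[OF square_integrable_mult[OF assms], of 2]
  by (auto simp: square_integrable_def power2_sum mult.assoc)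

lemma square_integrable_scale:
  assumes "square_integrable f"
  shows "square_integrable (\<lambda>x. c * f x)"
  using assms by (auto simp: square_integrable_def power_mult_distrib)

lemma square_integrable_uminus:
  assumes "square_integrable f"
  shows "square_integrable (\<lambda>x. - f x)"
  using square_integrable_scale[OF assms, of "-1"] by simp

lemma square_integrable_diff:
  assumes "square_integrable f" "square_integrable g"
  shows "square_integrable (\<lambda>x. f x - g x)"
  using square_integrable_add[OF assms(1) square_integrable_uminus[OF assms(2)]] by simp

text \<open>Lebesgue measure classes, represented by Borel functions: \<open>fun_of\<close> selects a representative
  and \<open>L2_of\<close> is the class of a square-integrable function (unspecified for other arguments).\<close>

definition L2_rel :: "('a::euclidean_space \<Rightarrow> real) \<Rightarrow> ('a \<Rightarrow> real) \<Rightarrow> bool" where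
  "L2_rel f g \<longleftrightarrow> square_integrable f \<and> square_integrable g \<and> (AE x in lborel. f x = g x)"

quotient_type (overloaded) 'a L2 = "'a::euclidean_space \<Rightarrow> real" / partial: L2_rel
  morphisms fun_of L2_of
proof (rule part_equivpI)
  show "\<exists>x. L2_rel x x"
    using square_integrable_zero by (auto simp: L2_rel_def)
  show "symp L2_rel"
    by (auto simp: symp_def L2_rel_def)
  show "transp L2_rel"
    by (auto simp: transp_def L2_rel_def)
qed

lemma L2_rel_Quotient: "Quotient3 L2_rel L2_of fun_of"
  by (rule Quotient3_L2)

lemma square_integrable_fun_of: "square_integrable (fun_of f)"
  using Quotient3_rep_reflp[OF L2_rel_Quotient, of f] by (simp add: L2_rel_def)

lemma fun_of_measurable [measurable]: "fun_of f \<in> borel_measurable lborel"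
  using square_integrable_fun_of[of f] by (simp add: square_integrable_def)

lemma L2_of_fun_of [simp]: "L2_of (fun_of f) = f"
  using Quotient3_abs_rep[OF L2_rel_Quotient] .

lemma fun_of_L2_of:
  assumes "square_integrable f"
  shows "AE x in lborel. fun_of (L2_of f) x = f x"
  using Quotient3_rep_abs[OF L2_rel_Quotient, of f] assms by (auto simp: L2_rel_def)

lemma L2_eq_iff: "f = g \<longleftrightarrow> (AE x in lborel. fun_of f x = fun_of g x)"
  using Quotient3_rel_rep[OF L2_rel_Quotient, of f g] square_integrable_fun_of
  by (auto simp: L2_rel_def)

instantiation L2 :: (euclidean_space) real_vector
begin

definition zero_L2 :: "'a L2" where
  "0 = L2_of (\<lambda>x. 0)"
definition plus_L2 :: "'a L2 \<Rightarrow> 'a L2 \<Rightarrow> 'a L2" where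
  "f + g = L2_of (\<lambda>x. fun_of f x + fun_of g x)"
definition minus_L2 :: "'a L2 \<Rightarrow> 'a L2 \<Rightarrow> 'a L2" where
  "f - g = L2_of (\<lambda>x. fun_of f x - fun_of g x)"
definition uminus_L2 :: "'a L2 \<Rightarrow> 'a L2" where
  "- f = L2_of (\<lambda>x. - fun_of f x)"
definition scaleR_L2 :: "real \<Rightarrow> 'a L2 \<Rightarrow> 'a L2" where
  "c *\<^sub>R f = L2_of (\<lambda>x. c * fun_of f x)"

lemma fun_of_zero: "AE x in lborel. fun_of (0::'a L2) x = 0"
  unfolding zero_L2_def by (rule fun_of_L2_of[OF square_integrable_zero])

lemma fun_of_add: "AE x in lborel. fun_of (f + g) x = fun_of f x + fun_of g x" for f g :: "'a L2"
  unfolding plus_L2_def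
  by (intro fun_of_L2_of square_integrable_add square_integrable_fun_of)

lemma fun_of_diff: "AE x in lborel. fun_of (f - g) x = fun_of f x - fun_of g x" for f g :: "'a L2"
  unfolding minus_L2_def
  by (intro fun_of_L2_of square_integrable_diff square_integrable_fun_of)

lemma fun_of_uminus: "AE x in lborel. fun_of (- f) x = - fun_of f x" for f :: "'a L2"
  unfolding uminus_L2_def
  by (intro fun_of_L2_of square_integrable_uminus square_integrable_fun_of)

lemma fun_of_scaleR: "AE x in lborel. fun_of (c *\<^sub>R f) x = c * fun_of f x" for f :: "'a L2"
  unfolding scaleR_L2_def
  by (intro fun_of_L2_of square_integrable_scale square_integrable_fun_of)

instance
proof
  fix f g h :: "'a L2" and a b :: real
  show "f + g + h = f + (g + h)"
    unfolding L2_eq_iff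
    using fun_of_add[of "f + g" h] fun_of_add[of f g] fun_of_add[of f "g + h"] fun_of_add[of g h]
    by eventually_elim simp
  show "f + g = g + f"
    unfolding L2_eq_iff using fun_of_add[of f g] fun_of_add[of g f]
    by eventually_elim simp
  show "0 + f = f"
    unfolding L2_eq_iff using fun_of_add[of 0 f] fun_of_zero
    by eventually_elim simp
  show "- f + f = 0"
    unfolding L2_eq_iff using fun_of_add[of "- f" f] fun_of_zero fun_of_uminus[of f]
    by eventually_elim simp
  show "f - g = f + - g"
    unfolding L2_eq_iff using fun_of_diff[of f g] fun_of_add[of f "- g"] fun_of_uminus[of g]
    by eventually_elim simp
  show "a *\<^sub>R (f + g) = a *\<^sub>R f + a *\<^sub>R g"
    unfolding L2_eq_iff
    using fun_of_scaleR[of a "f + g"] fun_of_add[of f g] fun_of_add[of "a *\<^sub>R f" "a *\<^sub>R g"]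
      fun_of_scaleR[of a f] fun_of_scaleR[of a g]
    by eventually_elim (simp add: algebra_simps)
  show "(a + b) *\<^sub>R f = a *\<^sub>R f + b *\<^sub>R f"
    unfolding L2_eq_iff
    using fun_of_scaleR[of "a + b" f] fun_of_add[of "a *\<^sub>R f" "b *\<^sub>R f"]
      fun_of_scaleR[of a f] fun_of_scaleR[of b f]
    by eventually_elim (simp add: algebra_simps)
  show "a *\<^sub>R b *\<^sub>R f = (a * b) *\<^sub>R f"
    unfolding L2_eq_iff
    using fun_of_scaleR[of a "b *\<^sub>R f"] fun_of_scaleR[of b f] fun_of_scaleR[of "a * b" f]
    by eventually_elim (simp add: algebra_simps)
  show "1 *\<^sub>R f = f"
    unfolding L2_eq_iff using fun_of_scaleR[of 1 f]
    by eventually_elim simp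
qed

end

instantiation L2 :: (euclidean_space) real_inner
begin

definition inner_L2 :: "'a L2 \<Rightarrow> 'a L2 \<Rightarrow> real" where
  "inner_L2 f g = (LINT x|lborel. fun_of f x * fun_of g x)"
definition norm_L2 :: "'a L2 \<Rightarrow> real" where
  "norm_L2 f = sqrt (inner f f)"
definition dist_L2 :: "'a L2 \<Rightarrow> 'a L2 \<Rightarrow> real" where
  "dist_L2 f g = norm (f - g)"
definition sgn_L2 :: "'a L2 \<Rightarrow> 'a L2" where
  "sgn_L2 f = inverse (norm f) *\<^sub>R f"
definition uniformity_L2 :: "('a L2 \<times> 'a L2) filter" where
  [code del]: "(uniformity :: ('a L2 \<times> 'a L2) filter) = (INF e\<in>{0<..}. principal {(x, y). dist x y < e})"
definition open_L2 :: "'a L2 set \<Rightarrow> bool" where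
  [code del]: "open (U :: 'a L2 set) = (\<forall>x\<in>U. \<forall>\<^sub>F (x', y) in uniformity. x' = x \<longrightarrow> y \<in> U)"

instance
proof
  fix f g h :: "'a L2" and a :: real and U :: "'a L2 set"
  show "dist f g = norm (f - g)"
    by (rule dist_L2_def)
  show "sgn f = f /\<^sub>R norm f"
    by (rule sgn_L2_def)
  show "(uniformity :: ('a L2 \<times> 'a L2) filter) = (INF e\<in>{0<..}. principal {(x, y). dist x y < e})"
    by (rule uniformity_L2_def)
  show "open U = (\<forall>x\<in>U. \<forall>\<^sub>F (x', y) in uniformity. x' = x \<longrightarrow> y \<in> U)"
    by (rule open_L2_def)
  show "norm f = sqrt (inner f f)"
    by (rule norm_L2_def)
  show "inner f g = inner g f"
    by (simp add: inner_L2_def mult.commute)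
  show "inner (f + g) h = inner f h + inner g h"
  proof -
    have "inner (f + g) h
        = (LINT x|lborel. fun_of f x * fun_of h x + fun_of g x * fun_of h x)"
      unfolding inner_L2_def
    proof (rule integral_cong_AE)
      show "AE x in lborel. fun_of (f + g) x * fun_of h x
          = fun_of f x * fun_of h x + fun_of g x * fun_of h x"
        using fun_of_add[of f g] by eventually_elim (simp add: algebra_simps)
    qed measurable
    then show ?thesis
      by (simp add: inner_L2_def square_integrable_mult square_integrable_fun_of)
  qed
  show "inner (a *\<^sub>R f) g = a * inner f g"
  proof -
    have "inner (a *\<^sub>R f) g = (LINT x|lborel. a * (fun_of f x * fun_of g x))"
      unfolding inner_L2_def
    proof (rule integral_cong_AE)
      show "AE x in lborel. fun_of (a *\<^sub>R f) x * fun_of g x = a * (fun_of f x * fun_of g x)"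
        using fun_of_scaleR[of a f] by eventually_elim simp
    qed measurable
    then show ?thesis
      by (simp add: inner_L2_def)
  qed
  show "0 \<le> inner f f"
    by (simp add: inner_L2_def)
  show "inner f f = 0 \<longleftrightarrow> f = 0"
  proof -
    have "inner f f = 0 \<longleftrightarrow> (AE x in lborel. fun_of f x * fun_of f x = 0)"
      unfolding inner_L2_def
      by (intro integral_nonneg_eq_0_iff_AE square_integrable_mult square_integrable_fun_of) simp
    also have "\<dots> \<longleftrightarrow> (AE x in lborel. fun_of f x = fun_of (0::'a L2) x)"
    proof
      assume "AE x in lborel. fun_of f x * fun_of f x = 0"
      then show "AE x in lborel. fun_of f x = fun_of (0::'a L2) x"
        using fun_of_zero by eventually_elim simp
    next
      assume "AE x in lborel. fun_of f x = fun_of (0::'a L2) x"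
      then show "AE x in lborel. fun_of f x * fun_of f x = 0"
        using fun_of_zero by eventually_elim simp
    qed
    finally show ?thesis
      by (simp add: L2_eq_iff)
  qed
qed

end

lemma inner_L2_L2_of:
  assumes "square_integrable f"
  shows "inner (L2_of f) g = (LINT x|lborel. f x * fun_of g x)"
  unfolding inner_L2_def
proof (rule integral_cong_AE)
  have [measurable]: "f \<in> borel_measurable lborel"
    using assms by (simp add: square_integrable_def)
  show "(\<lambda>x. f x * fun_of g x) \<in> borel_measurable lborel"
    by measurable
  show "AE x in lborel. fun_of (L2_of f) x * fun_of g x = f x * fun_of g x"
    using fun_of_L2_of[OF assms] by eventually_elim simp
qed measurable

lemma norm_L2_square: "ennreal ((norm f)\<^sup>2) = (\<integral>\<^sup>+x. ennreal ((fun_of f x)\<^sup>2) \<partial>lborel)"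
proof -
  have "(norm f)\<^sup>2 = (LINT x|lborel. (fun_of f x)\<^sup>2)"
    unfolding power2_norm_eq_inner by (simp add: inner_L2_def power2_eq_square)
  moreover have "integrable lborel (\<lambda>x. (fun_of f x)\<^sup>2)"
    using square_integrable_fun_of[of f] by (simp add: square_integrable_def)
  ultimately show ?thesis
    by (simp add: nn_integral_eq_integral)
qed

text \<open>The Riesz--Fischer theorem.\<close>

instance L2 :: (euclidean_space) complete_space
proof
  fix X :: "nat \<Rightarrow> 'a L2"
  assume X: "Cauchy X"
  have "\<exists>N. \<forall>m\<ge>N. \<forall>n\<ge>N. dist (X m) (X n) < (1/4)^k" for k :: nat
    using X unfolding Cauchy_def by (meson zero_less_divide_1_iff zero_less_numeral zero_less_power)
  then obtain N where N: "\<And>k m n. m \<ge> N k \<Longrightarrow> n \<ge> N k \<Longrightarrow> dist (X m) (X n) < (1/4::real)^k"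
    by metis
  define r where "r k = (\<Sum>j\<le>k. N j)" for k
  have rN: "N k \<le> r k" for k
    unfolding r_def by (rule member_le_sum) auto
  have rmono: "r k \<le> r (Suc k)" for k
    by (simp add: r_def)
  define F where "F k = fun_of (X (r k))" for k
  have [measurable]: "F k \<in> borel_measurable lborel" for k
    unfolding F_def by measurable
  have d_int: "(\<integral>\<^sup>+x. ennreal ((F (Suc k) x - F k x)\<^sup>2) \<partial>lborel) \<le> ennreal ((1/16)^k)" for k
  proof -
    have "(\<integral>\<^sup>+x. ennreal ((F (Suc k) x - F k x)\<^sup>2) \<partial>lborel)
        = (\<integral>\<^sup>+x. ennreal ((fun_of (X (r (Suc k)) - X (r k)) x)\<^sup>2) \<partial>lborel)"
      by (rule nn_integral_cong_AE)
         (use fun_of_diff[of "X (r (Suc k))" "X (r k)"] in eventually_elim, simp add: F_def)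
    also have "\<dots> = ennreal ((dist (X (r (Suc k))) (X (r k)))\<^sup>2)"
      by (simp add: norm_L2_square dist_norm)
    also have "\<dots> \<le> ennreal (((1/4)^k)\<^sup>2)"
      using N[of k "r (Suc k)" "r k"] rN[of k] rmono[of k]
      by (intro ennreal_leI power_mono) auto
    also have "((1/4)^k)\<^sup>2 = (1/16::real)^k"
      by (simp add: power2_eq_square flip: power_mult_distrib)
    finally show ?thesis .
  qed
  have AEconv: "AE x in lborel. convergent (\<lambda>k. F k x)"
  proof -
    have "(\<integral>\<^sup>+x. (\<Sum>k. ennreal (2^k * (F (Suc k) x - F k x)\<^sup>2)) \<partial>lborel)
        = (\<Sum>k. \<integral>\<^sup>+x. ennreal (2^k * (F (Suc k) x - F k x)\<^sup>2) \<partial>lborel)"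
      by (rule nn_integral_suminf) measurable
    also have "\<dots> \<le> (\<Sum>k. ennreal ((1/8)^k))"
    proof (intro suminf_le allI)
      fix k
      have "(\<integral>\<^sup>+x. ennreal (2^k * (F (Suc k) x - F k x)\<^sup>2) \<partial>lborel)
          = ennreal (2^k) * (\<integral>\<^sup>+x. ennreal ((F (Suc k) x - F k x)\<^sup>2) \<partial>lborel)"
        by (subst nn_integral_cmult[symmetric]) (auto simp: ennreal_mult)
      also have "\<dots> \<le> ennreal (2^k) * ennreal ((1/16)^k)"
        by (rule mult_left_mono[OF d_int]) simp
      also have "\<dots> = ennreal ((1/8)^k)"
        by (simp add: ennreal_mult[symmetric] power_mult_distrib[symmetric])
      finally show "(\<integral>\<^sup>+x. ennreal (2^k * (F (Suc k) x - F k x)\<^sup>2) \<partial>lborel) \<le> ennreal ((1/8)^k)" .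
    qed auto
    also have "\<dots> < \<infinity>"
      by (subst suminf_ennreal2) (auto intro: summable_geometric)
    finally have "AE x in lborel. (\<Sum>k. ennreal (2^k * (F (Suc k) x - F k x)\<^sup>2)) \<noteq> \<infinity>"
      by (intro nn_integral_PInf_AE) auto
    then show ?thesis
    proof eventually_elim
      fix x
      assume "(\<Sum>k. ennreal (2^k * (F (Suc k) x - F k x)\<^sup>2)) \<noteq> \<infinity>"
      then have "summable (\<lambda>k. 2^k * (F (Suc k) x - F k x)\<^sup>2)"
        by (intro summable_suminf_not_top) auto
      moreover have "summable (\<lambda>k. (1/2::real)^k)"
        by (rule summable_geometric) simp
      ultimately have "summable (\<lambda>k. (1/2)^k + 2^k * (F (Suc k) x - F k x)\<^sup>2)"
        by (rule summable_add[rotated])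
      then have "summable (\<lambda>k. F (Suc k) x - F k x)"
      proof (rule summable_comparison_test'[where N = 0])
        fix k :: nat
        define a b where "a = sqrt ((1/2)^k)" and "b = sqrt (2^k) * \<bar>F (Suc k) x - F k x\<bar>"
        have ab: "a * b = \<bar>F (Suc k) x - F k x\<bar>" "a\<^sup>2 = (1/2)^k"
            "b\<^sup>2 = 2^k * (F (Suc k) x - F k x)\<^sup>2" "0 \<le> a * b"
          by (simp_all add: a_def b_def power_mult_distrib power_one_over real_sqrt_divide)
        have "2 * a * b \<le> a\<^sup>2 + b\<^sup>2"
          by (rule sum_squares_bound)
        then show "norm (F (Suc k) x - F k x) \<le> (1/2)^k + 2^k * (F (Suc k) x - F k x)\<^sup>2"
          using ab by simp
      qed
      then have "convergent (\<lambda>n. \<Sum>k<n. F (Suc k) x - F k x)"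
        by (simp add: summable_iff_convergent)
      then have "convergent (\<lambda>n. F n x - F 0 x)"
        by (simp only: sum_lessThan_telescope[of "\<lambda>k. F k x"])
      then have "convergent (\<lambda>n. (F n x - F 0 x) + F 0 x)"
        by (rule convergent_add[OF _ convergent_const])
      then show "convergent (\<lambda>k. F k x)"
        by simp
    qed
  qed
  define f where "f x = lim (\<lambda>k. F k x)" for x
  have [measurable]: "f \<in> borel_measurable lborel"
    unfolding f_def by measurable
  have fatou: "(\<integral>\<^sup>+x. ennreal ((f x - fun_of (X m) x)\<^sup>2) \<partial>lborel) \<le> ennreal (((1/4)^k)\<^sup>2)"
    if "m \<ge> N k" for m k
  proof -
    have "(\<integral>\<^sup>+x. ennreal ((f x - fun_of (X m) x)\<^sup>2) \<partial>lborel)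
        = (\<integral>\<^sup>+x. liminf (\<lambda>j. ennreal ((F j x - fun_of (X m) x)\<^sup>2)) \<partial>lborel)"
    proof (rule nn_integral_cong_AE)
      show "AE x in lborel. ennreal ((f x - fun_of (X m) x)\<^sup>2)
          = liminf (\<lambda>j. ennreal ((F j x - fun_of (X m) x)\<^sup>2))"
        using AEconv
      proof eventually_elim
        fix x
        assume "convergent (\<lambda>k. F k x)"
        then have "(\<lambda>k. F k x) \<longlonglongrightarrow> f x"
          by (simp add: f_def convergent_LIMSEQ_iff)
        then have "(\<lambda>j. ennreal ((F j x - fun_of (X m) x)\<^sup>2)) \<longlonglongrightarrow> ennreal ((f x - fun_of (X m) x)\<^sup>2)"
          by (intro tendsto_intros)
        then show "ennreal ((f x - fun_of (X m) x)\<^sup>2)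
            = liminf (\<lambda>j. ennreal ((F j x - fun_of (X m) x)\<^sup>2))"
          by (intro lim_imp_Liminf[symmetric]) auto
      qed
    qed
    also have "\<dots> \<le> liminf (\<lambda>j. \<integral>\<^sup>+x. ennreal ((F j x - fun_of (X m) x)\<^sup>2) \<partial>lborel)"
      by (rule nn_integral_liminf) measurable
    also have "\<dots> \<le> ennreal (((1/4)^k)\<^sup>2)"
    proof (rule Liminf_le)
      show "\<forall>\<^sub>F j in sequentially.
          (\<integral>\<^sup>+x. ennreal ((F j x - fun_of (X m) x)\<^sup>2) \<partial>lborel) \<le> ennreal (((1/4)^k)\<^sup>2)"
        using eventually_ge_at_top[of k]
      proof eventually_elim
        fix j
        assume "k \<le> j"
        then have "N k \<le> r j"
          unfolding r_def by (intro member_le_sum) auto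
        have "(\<integral>\<^sup>+x. ennreal ((F j x - fun_of (X m) x)\<^sup>2) \<partial>lborel)
            = (\<integral>\<^sup>+x. ennreal ((fun_of (X (r j) - X m) x)\<^sup>2) \<partial>lborel)"
          by (rule nn_integral_cong_AE)
             (use fun_of_diff[of "X (r j)" "X m"] in eventually_elim, simp add: F_def)
        also have "\<dots> = ennreal ((dist (X (r j)) (X m))\<^sup>2)"
          by (simp add: norm_L2_square dist_norm)
        also have "\<dots> \<le> ennreal (((1/4)^k)\<^sup>2)"
          using N[OF \<open>N k \<le> r j\<close> that] by (intro ennreal_leI power_mono) auto
        finally show "(\<integral>\<^sup>+x. ennreal ((F j x - fun_of (X m) x)\<^sup>2) \<partial>lborel) \<le> ennreal (((1/4)^k)\<^sup>2)" .
      qed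
    qed simp
    finally show ?thesis .
  qed
  have sq_diff: "square_integrable (\<lambda>x. f x - fun_of (X m) x)" if "m \<ge> N k" for m k
    unfolding square_integrable_def
  proof
    show "integrable lborel (\<lambda>x. (f x - fun_of (X m) x)\<^sup>2)"
    proof (rule integrableI_nonneg)
      show "(\<integral>\<^sup>+x. ennreal ((f x - fun_of (X m) x)\<^sup>2) \<partial>lborel) < \<infinity>"
        using fatou[OF that] by (rule le_less_trans) simp
    qed auto
  qed measurable
  have "square_integrable (\<lambda>x. (f x - fun_of (X (N 0)) x) + fun_of (X (N 0)) x)"
    by (intro square_integrable_add sq_diff[of 0] square_integrable_fun_of) simp
  then have sq: "square_integrable f"
    by simp
  have bound: "dist (X m) (L2_of f) \<le> (1/4)^k" if "m \<ge> N k" for m k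
  proof -
    have "ennreal ((dist (X m) (L2_of f))\<^sup>2)
        = (\<integral>\<^sup>+x. ennreal ((fun_of (L2_of f - X m) x)\<^sup>2) \<partial>lborel)"
      by (simp add: norm_L2_square dist_norm norm_minus_commute flip: norm_L2_square)
    also have "\<dots> = (\<integral>\<^sup>+x. ennreal ((f x - fun_of (X m) x)\<^sup>2) \<partial>lborel)"
      by (rule nn_integral_cong_AE)
         (use fun_of_diff[of "L2_of f" "X m"] fun_of_L2_of[OF sq] in eventually_elim, simp)
    also have "\<dots> \<le> ennreal (((1/4)^k)\<^sup>2)"
      by (rule fatou[OF that])
    finally have "(dist (X m) (L2_of f))\<^sup>2 \<le> ((1/4)^k)\<^sup>2"
      by (simp add: ennreal_le_iff)
    then show ?thesis
      by (rule power2_le_imp_le) simp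
  qed
  have "X \<longlonglongrightarrow> L2_of f"
  proof (rule metric_LIMSEQ_I)
    fix e :: real
    assume "0 < e"
    then obtain k where "(1/4::real)^k < e"
      using real_arch_pow_inv[of e "1/4"] by auto
    then have "\<forall>m\<ge>N k. dist (X m) (L2_of f) < e"
      using bound le_less_trans by blast
    then show "\<exists>no. \<forall>n\<ge>no. dist (X n) (L2_of f) < e"
      by blast
  qed
  then show "convergent X"
    by (auto simp: convergent_def)
qed

text \<open>
  \<open>L\<^sup>2(A)\<close> is the closed subspace of the functions vanishing almost everywhere outside \<open>A\<close>
  (extension by zero).
\<close>

definition L2_on :: "'a::euclidean_space set \<Rightarrow> 'a L2 set" where
  "L2_on A = {f. AE x in lborel. x \<notin> A \<longrightarrow> fun_of f x = 0}"

lemma subspace_L2_on: "subspace (L2_on A)"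
proof (rule subspaceI)
  show "0 \<in> L2_on A"
    unfolding L2_on_def mem_Collect_eq using fun_of_zero by eventually_elim simp
next
  fix f g
  assume "f \<in> L2_on A" "g \<in> L2_on A"
  then have "AE x in lborel. x \<notin> A \<longrightarrow> fun_of f x = 0" "AE x in lborel. x \<notin> A \<longrightarrow> fun_of g x = 0"
    by (auto simp: L2_on_def)
  then show "f + g \<in> L2_on A"
    unfolding L2_on_def mem_Collect_eq using fun_of_add[of f g] by eventually_elim auto
next
  fix c f
  assume "f \<in> L2_on A"
  then have "AE x in lborel. x \<notin> A \<longrightarrow> fun_of f x = 0"
    by (auto simp: L2_on_def)
  then show "c *\<^sub>R f \<in> L2_on A"
    unfolding L2_on_def mem_Collect_eq using fun_of_scaleR[of c f] by eventually_elim auto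
qed

lemma closed_L2_on:
  assumes [measurable]: "A \<in> sets borel"
  shows "closed (L2_on A)"
proof -
  define R where "R h = (\<lambda>x. indicator (- A) x * fun_of h x)" for h :: "'a L2"
  have sqR: "square_integrable (R h)" for h
    unfolding square_integrable_def
  proof
    show [measurable]: "R h \<in> borel_measurable lborel"
      unfolding R_def by measurable
    have "integrable lborel (\<lambda>x. (fun_of h x)\<^sup>2)"
      using square_integrable_fun_of[of h] by (simp add: square_integrable_def)
    then show "integrable lborel (\<lambda>x. (R h x)\<^sup>2)"
      by (rule Bochner_Integration.integrable_bound) (auto simp: R_def indicator_def)
  qed
  have iff: "f \<in> L2_on A \<longleftrightarrow> (\<forall>h. inner (L2_of (R h)) f = 0)" for f
  proof
    assume "f \<in> L2_on A"
    then have "AE x in lborel. x \<notin> A \<longrightarrow> fun_of f x = 0"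
      by (simp add: L2_on_def)
    then have "AE x in lborel. R h x * fun_of f x = 0" for h
      by eventually_elim (auto simp: R_def indicator_def)
    then show "\<forall>h. inner (L2_of (R h)) f = 0"
      by (simp add: inner_L2_L2_of sqR integral_eq_zero_AE)
  next
    assume "\<forall>h. inner (L2_of (R h)) f = 0"
    then have "(LINT x|lborel. R f x * fun_of f x) = 0"
      by (simp add: inner_L2_L2_of sqR)
    then have "AE x in lborel. R f x * fun_of f x = 0"
      by (subst (asm) integral_nonneg_eq_0_iff_AE)
         (use square_integrable_mult[OF sqR square_integrable_fun_of]
           in \<open>simp_all add: R_def indicator_def\<close>)
    then show "f \<in> L2_on A"
      unfolding L2_on_def mem_Collect_eq by eventually_elim (auto simp: R_def indicator_def)
  qed
  have "L2_on A = (\<Inter>h. {f. inner (L2_of (R h)) f = 0})"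
    using iff by auto
  also have "closed \<dots>"
    by (intro closed_INT ballI closed_Collect_eq continuous_intros)
  finally show ?thesis .
qed


section \<open>Finite codimensional sets\<close>

text \<open>
  \<open>Y\<close> is a closed subspace, regarded as a Hilbert space in its own right, and \<open>M \<subseteq> Y\<close>.  A closed
  subspace \<open>S\<close> has finite codimension in \<open>Y\<close> iff finitely many vectors of \<open>Y\<close> span \<open>Y\<close> together
  with \<open>S\<close>.
\<close>

definition finite_codimensional_in :: "'a::{real_inner, complete_space} set \<Rightarrow> 'a set \<Rightarrow> bool" where
  "finite_codimensional_in M Y \<longleftrightarrow>
     (\<exists>x0 \<in> closure (convex hull M).
        let D = (\<lambda>x. x - x0) ` M; S = closure (span D) in
          (\<exists>B. finite B \<and> B \<subseteq> Y \<and> span (S \<union> B) = Y) \<and>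
          (top_of_set S) interior_of (closure (convex hull D)) \<noteq> {})"


section \<open>Smooth functions and domains\<close>

text \<open>The sets are meant to be open.\<close>

primrec C_k_on :: "nat \<Rightarrow> ('a::euclidean_space \<Rightarrow> real) \<Rightarrow> 'a set \<Rightarrow> bool" where
  "C_k_on 0 f U \<longleftrightarrow> continuous_on U f"
| "C_k_on (Suc k) f U \<longleftrightarrow>
     f differentiable_on U \<and> (\<forall>b\<in>Basis. C_k_on k (\<lambda>x. frechet_derivative f (at x) b) U)"

definition smooth_on :: "('a::euclidean_space \<Rightarrow> real) \<Rightarrow> 'a set \<Rightarrow> bool" where
  "smooth_on f U \<longleftrightarrow> (\<forall>k. C_k_on k f U)"

text \<open>
  Near each boundary point, \<open>\<Omega>\<close> is a sublevel set of a smooth function with nonvanishing gradient;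
  in particular \<open>\<Omega>\<close> lies locally on one side of its boundary.
\<close>

definition smooth_boundary :: "'a::euclidean_space set \<Rightarrow> bool" where
  "smooth_boundary \<Omega> \<longleftrightarrow>
     (\<forall>p \<in> frontier \<Omega>. \<exists>U \<phi>. open U \<and> p \<in> U \<and> smooth_on \<phi> U \<and>
        frechet_derivative \<phi> (at p) \<noteq> (\<lambda>_. 0) \<and> \<Omega> \<inter> U = {x \<in> U. \<phi> x < 0})"


section \<open>The heat equation\<close>

definition test_function :: "'a::euclidean_space set \<Rightarrow> ('a \<Rightarrow> real) \<Rightarrow> bool" where
  "test_function \<Omega> \<phi> \<longleftrightarrow>
     smooth_on \<phi> UNIV \<and> compact (closure {x. \<phi> x \<noteq> 0}) \<and> closure {x. \<phi> x \<noteq> 0} \<subseteq> \<Omega>"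

text \<open>
  The pairs \<open>(v, \<nabla>v)\<close> with \<open>v\<close> in the Sobolev space \<open>H\<^sup>1\<^sub>0(\<Omega>)\<close>, the closure of the test functions in the
  \<open>H\<^sup>1\<close> norm, and \<open>\<nabla>v\<close> its weak gradient: the norm of the product type is the \<open>H\<^sup>1\<close> norm of \<open>v\<close>.
\<close>

definition H10_graph :: "(real^'n) set \<Rightarrow> ((real^'n) L2 \<times> ((real^'n) L2 ^ 'n)) set" where
  "H10_graph \<Omega> =
     closure {(L2_of \<phi>, \<chi> i. L2_of (\<lambda>x. frechet_derivative \<phi> (at x) (axis i 1))) |\<phi>.
       test_function \<Omega> \<phi>}"

text \<open>
  The weak solution \<open>y \<in> C([0,T]; L\<^sup>2(\<Omega>)) \<inter> L\<^sup>2(0,T; H\<^sup>1\<^sub>0(\<Omega>))\<close> of \<open>y\<^sub>t - \<Delta>y = f\<close> in \<open>\<Omega> \<times> (0,T)\<close>, \<open>y = 0\<close> on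
  the lateral boundary, \<open>y(0) = y\<^sub>0\<close>, for \<open>f \<in> L\<^sup>2(\<Omega> \<times> (0,T))\<close>.  The last conjunct is the variational
  equation \<open>\<langle>y\<^sub>t, v\<rangle> + (\<nabla>y, \<nabla>v) = (f, v)\<close> for all \<open>v \<in> H\<^sup>1\<^sub>0(\<Omega>)\<close>, integrated over \<open>(0,t)\<close>.
\<close>

definition heat_solution ::
  "(real^'n) set \<Rightarrow> real \<Rightarrow> ((real^'n) \<times> real) L2 \<Rightarrow> (real^'n) L2 \<Rightarrow> (real \<Rightarrow> (real^'n) L2) \<Rightarrow> bool" where
  "heat_solution \<Omega> T f y0 y \<longleftrightarrow>
     continuous_on {0..T} y \<and> (\<forall>t\<in>{0..T}. y t \<in> L2_on \<Omega>) \<and> y 0 = y0 \<and>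
     (\<exists>Dy. Dy \<in> borel_measurable lborel \<and>
        set_integrable lborel {0..T} (\<lambda>t. (norm (Dy t))\<^sup>2) \<and>
        (AE t\<in>{0..T} in lborel. (y t, Dy t) \<in> H10_graph \<Omega>) \<and>
        (\<forall>t\<in>{0..T}. \<forall>(v, Dv) \<in> H10_graph \<Omega>.
           inner (y t) v + (LINT s:{0..t}|lborel. inner (Dy s) Dv)
             = inner y0 v + (LINT z:\<Omega> \<times> {0<..<t}|lborel. fun_of f z * fun_of v (fst z))))"

definition localized_control :: "(real^'n) set \<Rightarrow> ((real^'n) \<times> real) L2 \<Rightarrow> ((real^'n) \<times> real) L2" where
  "localized_control \<omega> u = L2_of (\<lambda>(x, t). indicator \<omega> x * fun_of u (x, t))"

definition reachable_set :: "(real^'n) set \<Rightarrow> (real^'n) set \<Rightarrow> real \<Rightarrow> (real^'n) L2 set" where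
  "reachable_set \<Omega> \<omega> T =
     {y T |y u. u \<in> L2_on (\<Omega> \<times> {0<..<T}) \<and> norm u \<le> 1 \<and>
        heat_solution \<Omega> T (localized_control \<omega> u) 0 y}"

lemma reachable_set_subset: "0 \<le> T \<Longrightarrow> reachable_set \<Omega> \<omega> T \<subseteq> L2_on \<Omega>"
  unfolding reachable_set_def heat_solution_def by fastforce

end

theory Submission
  imports Defs
begin

text \<open>
  The idea is that the heat flow smooths: a final state \<open>y(T)\<close> carries little of any fast oscillation,
  uniformly over the controls of norm at most one.  A set with this property cannot be finite
  codimensional.  Suppose the closed convex hull of \<open>M - x\<^sub>0\<close> contained a relative ball of radius
  \<open>\<epsilon>\<close> of a closed subspace \<open>S\<close>.  A functional \<open>\<langle>\<cdot>, w\<rangle>\<close> bounded by \<open>\<delta>\<close> on \<open>M\<close> is then bounded by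
  \<open>\<delta> / \<epsilon>\<close> on the unit ball of \<open>S\<close>, so \<open>w\<close> is almost orthogonal to \<open>S\<close>.  If \<open>S\<close> has codimension at most
  \<open>n\<close>, then \<open>n + 1\<close> orthonormal vectors have a common nonzero combination in \<open>S\<close>, and they cannot all
  be almost orthogonal to \<open>S\<close>.  This is \<open>not_finite_codimensional_in_if_small_directions\<close>; it reduces the
  theorem to producing arbitrarily many orthonormal \<open>w\<close> in \<open>L\<^sup>2(\<Omega>)\<close> with \<open>\<bar>\<langle>y(T), w\<rangle>\<bar> \<le> \<delta>\<close> for all
  reachable states.

  The vectors \<open>w\<close> are normalised oscillations \<open>v = \<phi>(x) cos(k x\<^sub>j + \<theta>)\<close>, where the \<open>\<phi>\<close> are bumps with disjoint
  supports inside \<open>\<Omega>\<close> and \<open>k\<close> is large.  Such a \<open>v\<close> is an approximate eigenfunction,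
  \<open>\<Delta>v = -k\<^sup>2 v + r\<close> with
  \<open>r = 2k \<partial>\<^sub>j\<phi> cos(k x\<^sub>j + \<theta> + \<pi>/2) + \<Delta>\<phi> cos(k x\<^sub>j + \<theta>)\<close>.
  Writing \<open>F(t) = \<integral>\<^sub>0\<^sup>t f\<close> for the primitive of the source, a weak solution starting from zero satisfies
  \<open>\<langle>y(t), v\<rangle> = \<langle>F(t), v\<rangle> + \<integral>\<^sub>0\<^sup>t \<langle>y(s), \<Delta>v\<rangle> ds\<close>, and Duhamel's formula with decay rate \<open>k\<^sup>2\<close> gives
  \<open>\<bar>\<langle>y(t), v\<rangle>\<bar> \<le> \<bar>v\<bar> / k + \<integral>\<^sub>0\<^sup>t exp(-k\<^sup>2(t - s)) \<bar>\<langle>y(s), r\<rangle>\<bar> ds\<close> (\<open>duhamel_bound\<close>).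
  As \<open>\<bar>r\<bar>\<close> is of order \<open>k\<close>, the last term needs two passes.  A bound of \<open>y\<close> in \<open>L\<^sup>2(\<Omega> \<times> (0,T))\<close> shows that
  this term is bounded uniformly in \<open>k\<close>, \<open>t\<close> and the control (\<open>heat_osc_bounded\<close>).  The remainder \<open>r\<close> is itself \<open>2k\<close> times an
  oscillation plus another oscillation, so this bound applies to \<open>\<langle>y(s), r\<rangle>\<close>, which is therefore \<open>O(k)\<close>
  pointwise in time; integrating against \<open>exp(-k\<^sup>2(t - s))\<close> leaves \<open>O(1/k)\<close> (\<open>heat_osc_small\<close>).

  The bound in \<open>L\<^sup>2(\<Omega> \<times> (0,T))\<close> comes from testing the time-integrated equation with \<open>y(t)\<close> itself, which avoids the time
  derivative of \<open>y\<close>: with \<open>G(t) = \<integral>\<^sub>0\<^sup>t \<nabla>y\<close> one has \<open>\<bar>y(t)\<bar>\<^sup>2 + \<langle>G(t), \<nabla>y(t)\<rangle> = \<langle>F(t), y(t)\<rangle>\<close>, and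
  \<open>\<integral>\<^sub>0\<^sup>T \<langle>G, \<nabla>y\<rangle> = \<bar>G(T)\<bar>\<^sup>2 / 2 \<ge> 0\<close>, as \<open>\<nabla>y\<close> is the derivative of \<open>G\<close> (\<open>energy_nonneg\<close>).  Both primitives are
  defined weakly, through the Riesz representation theorem.
\<close>

section \<open>Hilbert space preliminaries\<close>

text \<open>
  Completeness of a finite power of a space is inherited along the class \<open>banach\<close>; it is needed for
  gradients, which lie in \<open>L2 ^ 'n\<close>.
\<close>

instance L2 :: (euclidean_space) banach ..

text \<open>
  The hyperplane \<open>l = 1\<close> has a point \<open>a\<close> of least norm, because minimising sequences are Cauchy by the
  parallelogram law.  Minimality makes \<open>a\<close> orthogonal to the kernel of \<open>l\<close>, so \<open>l\<close> is the inner product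
  with \<open>a / \<bar>a\<bar>\<^sup>2\<close>.
\<close>

lemma riesz_representation:
  fixes l :: "'a::{real_inner, complete_space} \<Rightarrow> real"
  assumes "bounded_linear l"
  shows "\<exists>g. \<forall>x. l x = g \<bullet> x"
proof (cases "\<forall>x. l x = 0")
  case True
  then show ?thesis by (intro exI[of _ 0]) simp
next
  case False
  interpret l: bounded_linear l by fact
  define A where "A = {x. l x = 1}"
  obtain x0 where "l x0 \<noteq> 0" using False by auto
  then have "x0 /\<^sub>R l x0 \<in> A" by (simp add: A_def l.scaleR)
  then have ne: "norm ` A \<noteq> {}" by auto
  define d where "d = Inf (norm ` A)"
  have bdd: "bdd_below (norm ` A)" by (rule bdd_belowI[of _ 0]) auto
  have d_le: "d \<le> norm x" if "x \<in> A" for x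
    unfolding d_def using bdd that by (simp add: cINF_lower)
  have d0: "0 \<le> d" unfolding d_def using ne by (intro cINF_greatest) auto
  have "\<exists>x\<in>A. norm x < d + inverse (Suc n)" for n
    using cInf_lessD[OF ne, of "d + inverse (Suc n)"] unfolding d_def by auto
  then obtain X where X: "\<And>n. X n \<in> A" "\<And>n. norm (X n) < d + inverse (Suc n)" by metis
  have lim: "(\<lambda>n. d + inverse (Suc n)) \<longlonglongrightarrow> d"
    using tendsto_add[OF tendsto_const LIMSEQ_inverse_real_of_nat, of d] by simp
  have par: "(norm (X m - X n))\<^sup>2 \<le> 2 * ((d + inverse (Suc m))\<^sup>2 - d\<^sup>2) + 2 * ((d + inverse (Suc n))\<^sup>2 - d\<^sup>2)"
    for m n
  proof -
    have "(1/2) *\<^sub>R (X m + X n) \<in> A"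
      using X by (simp add: A_def l.scaleR l.add)
    from d_le[OF this] have "2 * d \<le> norm (X m + X n)" by simp
    then have "(2 * d)\<^sup>2 \<le> (norm (X m + X n))\<^sup>2" using d0 by (intro power_mono) auto
    moreover have "(norm (X m - X n))\<^sup>2 + (norm (X m + X n))\<^sup>2 = 2 * (norm (X m))\<^sup>2 + 2 * (norm (X n))\<^sup>2"
      by (simp add: power2_norm_eq_inner algebra_simps inner_commute)
    moreover have "(norm (X k))\<^sup>2 \<le> (d + inverse (Suc k))\<^sup>2" for k
      using X(2)[of k] by (intro power_mono) auto
    from this[of m] this[of n] have "(norm (X m))\<^sup>2 + (norm (X n))\<^sup>2
       \<le> (d + inverse (Suc m))\<^sup>2 + (d + inverse (Suc n))\<^sup>2" by linarith
    ultimately show ?thesis by (simp add: power_mult_distrib)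
  qed
  define E where "E n = (d + inverse (Suc n))\<^sup>2 - d\<^sup>2" for n :: nat
  have "Cauchy X"
  proof (rule metric_CauchyI)
    fix e :: real assume "e > 0"
    have "(\<lambda>n. (d + inverse (Suc n))\<^sup>2 - d\<^sup>2) \<longlonglongrightarrow> 0"
      using tendsto_diff[OF tendsto_power[OF lim, of 2] tendsto_const, of "d\<^sup>2"] by simp
    then have "\<forall>\<^sub>F n in sequentially. (d + inverse (Suc n))\<^sup>2 - d\<^sup>2 < e\<^sup>2 / 4"
      using \<open>e > 0\<close> by (intro order_tendstoD) auto
    then obtain N where N: "\<And>n. n \<ge> N \<Longrightarrow> (d + inverse (Suc n))\<^sup>2 - d\<^sup>2 < e\<^sup>2 / 4"
      by (auto simp: eventually_sequentially)
    have "dist (X m) (X n) < e" if "m \<ge> N" "n \<ge> N" for m n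
    proof -
      have "(norm (X m - X n))\<^sup>2 < e\<^sup>2"
        using par[of m n] N[OF that(1)] N[OF that(2)] unfolding E_def[symmetric] by linarith
      then show ?thesis
        using \<open>e > 0\<close> by (simp add: dist_norm power2_less_imp_less)
    qed
    then show "\<exists>M. \<forall>m\<ge>M. \<forall>n\<ge>M. dist (X m) (X n) < e" by blast
  qed
  then obtain a where a: "X \<longlonglongrightarrow> a" by (auto simp: Cauchy_convergent_iff convergent_def)
  have la: "l a = 1"
    using LIMSEQ_unique[OF l.tendsto[OF a], of 1] X(1) by (simp add: A_def)
  have norm_a: "norm a \<le> d"
    by (rule LIMSEQ_le[OF tendsto_norm[OF a] lim]) (use X(2) less_imp_le in blast)
  have orth: "a \<bullet> h = 0" if "l h = 0" for h
  proof (cases "h = 0")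
    case False
    define t where "t = (a \<bullet> h) / (h \<bullet> h)"
    have "a - t *\<^sub>R h \<in> A" using that la by (simp add: A_def l.diff l.scaleR)
    then have "norm a \<le> norm (a - t *\<^sub>R h)" using d_le norm_a by fastforce
    then have "a \<bullet> a \<le> (a - t *\<^sub>R h) \<bullet> (a - t *\<^sub>R h)" by (simp add: norm_le)
    also have "\<dots> = a \<bullet> a - (a \<bullet> h)\<^sup>2 / (h \<bullet> h)"
      using False by (simp add: t_def inner_diff_left inner_diff_right inner_commute power2_eq_square field_simps)
    finally have "(a \<bullet> h)\<^sup>2 / (h \<bullet> h) \<le> 0" by simp
    then show ?thesis using False
      by (simp add: divide_le_0_iff)
        (metis inner_gt_zero_iff not_less)
  qed simp
  have "a \<noteq> 0" using la by auto
  have "l x = (a /\<^sub>R (a \<bullet> a)) \<bullet> x" for x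
  proof -
    have "a \<bullet> (x - l x *\<^sub>R a) = 0" by (rule orth) (simp add: l.diff l.scaleR la)
    then show ?thesis using \<open>a \<noteq> 0\<close> by (simp add: inner_diff_right field_simps)
  qed
  then show ?thesis by blast
qed

section \<open>A criterion against finite codimension\<close>

lemma subspace_closure:
  fixes S :: "'a::real_normed_vector set"
  assumes "subspace S"
  shows "subspace (closure S)"
proof (rule subspaceI)
  show "0 \<in> closure S" using subspace_0[OF assms] closure_subset by blast
next
  fix x y assume "x \<in> closure S" "y \<in> closure S"
  then obtain f g where "\<forall>n. f n \<in> S" "f \<longlonglongrightarrow> x" "\<forall>n. g n \<in> S" "g \<longlonglongrightarrow> y"
    by (auto simp: closure_sequential)
  then show "x + y \<in> closure S"
    unfolding closure_sequential
    by (intro exI[of _ "\<lambda>n. f n + g n"]) (auto intro: tendsto_add subspace_add[OF assms])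
next
  fix c x assume "x \<in> closure S"
  then obtain f where "\<forall>n. f n \<in> S" "f \<longlonglongrightarrow> x" by (auto simp: closure_sequential)
  then show "c *\<^sub>R x \<in> closure S"
    unfolding closure_sequential
    by (intro exI[of _ "\<lambda>n. c *\<^sub>R f n"]) (auto intro: tendsto_intros subspace_scale[OF assms])
qed

text \<open>
  Orthonormal directions in which \<open>M\<close> is thin.  Thinness passes from \<open>M\<close> to its closed convex hull, and
  from there to the relative ball that the hull would have to contain, hence to the whole of the subspace
  \<open>S\<close>.  One direction more than the codimension of \<open>S\<close> is enough for a contradiction.
\<close>

lemma not_finite_codimensional_in_if_small_directions:
  fixes M Y :: "'a::{real_inner, complete_space} set"
  assumes small: "\<And>n \<delta>. \<delta> > 0 \<Longrightarrow>
      \<exists>W. finite W \<and> card W = n \<and> W \<subseteq> Y \<and> pairwise orthogonal W \<and>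
          (\<forall>w\<in>W. norm w = 1 \<and> (\<forall>m\<in>M. \<bar>m \<bullet> w\<bar> \<le> \<delta>))"
  shows "\<not> finite_codimensional_in M Y"
proof
  assume "finite_codimensional_in M Y"
  then obtain x0 B where B: "finite B" "B \<subseteq> Y"
    and x0: "x0 \<in> closure (convex hull M)"
    and span: "span (closure (span ((\<lambda>x. x - x0) ` M)) \<union> B) = Y"
    and int: "(top_of_set (closure (span ((\<lambda>x. x - x0) ` M)))) interior_of
       (closure (convex hull ((\<lambda>x. x - x0) ` M))) \<noteq> {}"
    unfolding finite_codimensional_in_def Let_def by blast
  define D where "D = (\<lambda>x. x - x0) ` M"
  define S where "S = closure (span D)"
  define C where "C = closure (convex hull D)"
  have S: "subspace S" unfolding S_def by (intro subspace_closure subspace_span)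
  obtain s0 U where "open U" "s0 \<in> U" "s0 \<in> S" "S \<inter> U \<subseteq> C"
    using int unfolding D_def[symmetric] S_def[symmetric] C_def[symmetric]
    by (auto simp: interior_of_def openin_open)
  then obtain \<epsilon> where e: "\<epsilon> > 0" "cball s0 \<epsilon> \<subseteq> U"
    using open_contains_cball by blast
  \<comment> \<open>A slab between two parallel hyperplanes is closed and convex.\<close>
  have C_small: "\<bar>(c + x0) \<bullet> w\<bar> \<le> \<delta>" if "\<forall>m\<in>M. \<bar>m \<bullet> w\<bar> \<le> \<delta>" "c \<in> C" for c w \<delta>
  proof -
    have "convex {c. \<bar>(c + x0) \<bullet> w\<bar> \<le> \<delta>}"
    proof -
      have "{c. \<bar>(c + x0) \<bullet> w\<bar> \<le> \<delta>} = {c. w \<bullet> c \<le> \<delta> - x0 \<bullet> w} \<inter> {c. w \<bullet> c \<ge> - \<delta> - x0 \<bullet> w}"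
        by (auto simp: inner_add_left abs_le_iff inner_commute[of w])
      then show ?thesis by (simp add: convex_Int convex_halfspace_le convex_halfspace_ge)
    qed
    moreover have "closed {c. \<bar>(c + x0) \<bullet> w\<bar> \<le> \<delta>}"
      by (intro closed_Collect_le continuous_intros)
    moreover have "D \<subseteq> {c. \<bar>(c + x0) \<bullet> w\<bar> \<le> \<delta>}" using that(1) by (auto simp: D_def)
    ultimately have "C \<subseteq> {c. \<bar>(c + x0) \<bullet> w\<bar> \<le> \<delta>}"
      unfolding C_def by (intro closure_minimal hull_minimal)
    then show ?thesis using that(2) by auto
  qed
  \<comment> \<open>Both \<open>s0 + z\<close> and \<open>s0 - z\<close> lie in the hull, so the unknown centre \<open>s0 + x0\<close> cancels.\<close>
  have S_small: "\<bar>s \<bullet> w\<bar> \<le> (\<delta> / \<epsilon>) * norm s"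
    if w: "\<forall>m\<in>M. \<bar>m \<bullet> w\<bar> \<le> \<delta>" and s: "s \<in> S" for s w \<delta>
  proof (cases "s = 0")
    case False
    define z where "z = (\<epsilon> / norm s) *\<^sub>R s"
    have z: "norm z = \<epsilon>" "z \<in> S" using False e s S by (auto simp: z_def subspace_scale)
    have "s0 + z \<in> S \<inter> U" "s0 - z \<in> S \<inter> U"
      using z e(2) \<open>s0 \<in> S\<close> S by (auto intro: subspace_add subspace_diff simp: subset_eq dist_norm)
    then have "s0 + z \<in> C" "s0 - z \<in> C" using \<open>S \<inter> U \<subseteq> C\<close> by auto
    then have "\<bar>(s0 + z + x0) \<bullet> w\<bar> \<le> \<delta>" "\<bar>(s0 - z + x0) \<bullet> w\<bar> \<le> \<delta>"
      using C_small[OF w] by blast+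
    then have "\<bar>z \<bullet> w\<bar> \<le> \<delta>" by (simp add: inner_add_left inner_diff_left)
    moreover have "z \<bullet> w = (\<epsilon> / norm s) * (s \<bullet> w)" by (simp add: z_def)
    ultimately show ?thesis using False e by (simp add: abs_mult field_simps)
  qed simp
  \<comment> \<open>The value of \<open>\<delta>\<close> makes the final sum over the \<open>n\<close> directions equal to half of \<open>\<bar>z\<bar>\<^sup>2\<close>.\<close>
  define n where "n = Suc (card B)"
  define \<delta> where "\<delta> = \<epsilon> / (2 * real n)"
  have "\<delta> > 0" using e by (simp add: \<delta>_def n_def)
  from small[OF this] obtain W where W: "finite W" "card W = n" "W \<subseteq> Y" "pairwise orthogonal W"
    "\<And>w. w \<in> W \<Longrightarrow> norm w = 1" "\<And>w. w \<in> W \<Longrightarrow> \<forall>m\<in>M. \<bar>m \<bullet> w\<bar> \<le> \<delta>"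
    by metis
  have "\<exists>s b. w = s + b \<and> s \<in> S \<and> b \<in> span B" if "w \<in> W" for w
  proof -
    have "w \<in> span (S \<union> B)" using that W(3) span by (auto simp: S_def D_def)
    then show ?thesis using S by (auto simp: span_Un span_eq_iff[THEN iffD2])
  qed
  then obtain s b where sb: "\<And>w. w \<in> W \<Longrightarrow> w = s w + b w" "\<And>w. w \<in> W \<Longrightarrow> s w \<in> S"
     "\<And>w. w \<in> W \<Longrightarrow> b w \<in> span B" by metis
  \<comment> \<open>The components outside \<open>S\<close> of the \<open>card B + 1\<close> vectors of \<open>W\<close> are linearly dependent; they may
    also coincide, which is a separate case because dependence is a property of sets.\<close>
  have "\<exists>a. (\<exists>w\<in>W. a w \<noteq> 0) \<and> (\<Sum>w\<in>W. a w *\<^sub>R b w) = 0"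
  proof (cases "inj_on b W")
    case True
    have "card (b ` W) > card B" using True W by (simp add: card_image n_def)
    then have "dependent (b ` W)"
      using independent_span_bound[OF B(1), of "b ` W"] sb(3) by (auto simp: not_le)
    then obtain u where u: "\<exists>v\<in>b ` W. u v \<noteq> 0" "(\<Sum>v\<in>b ` W. u v *\<^sub>R v) = 0"
      using dependent_finite[of "b ` W"] W(1) by auto
    then show ?thesis
      by (intro exI[of _ "u \<circ> b"]) (auto simp: sum.reindex[OF True])
  next
    case False
    then obtain v w where vw: "v \<in> W" "w \<in> W" "v \<noteq> w" "b v = b w" by (auto simp: inj_on_def)
    define a where "a x = (if x = v then 1 else if x = w then -1 else (0::real))" for x
    have "(\<Sum>x\<in>W. a x *\<^sub>R b x) = (\<Sum>x\<in>{v, w}. a x *\<^sub>R b x)"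
      by (rule sum.mono_neutral_right) (use W(1) vw in \<open>auto simp: a_def\<close>)
    also have "\<dots> = 0" using vw by (simp add: a_def)
    finally show ?thesis using vw by (intro exI[of _ a]) (auto simp: a_def)
  qed
  then obtain a w0 where a: "w0 \<in> W" "a w0 \<noteq> 0" "(\<Sum>w\<in>W. a w *\<^sub>R b w) = 0" by blast
  define z where "z = (\<Sum>w\<in>W. a w *\<^sub>R w)"
  have "z = (\<Sum>w\<in>W. a w *\<^sub>R s w) + (\<Sum>w\<in>W. a w *\<^sub>R b w)"
    unfolding z_def sum.distrib[symmetric]
    by (rule sum.cong) (use sb(1) in \<open>auto simp: scaleR_add_right[symmetric]\<close>)
  then have "z \<in> S" using a(3) S sb(2) by (auto intro!: subspace_sum subspace_scale)
  have coeff: "z \<bullet> w = a w" if "w \<in> W" for w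
  proof -
    have "z \<bullet> w = (\<Sum>v\<in>W. if v = w then a w else 0)"
      unfolding z_def inner_sum_left
    proof (rule sum.cong)
      fix v assume "v \<in> W"
      then show "(a v *\<^sub>R v) \<bullet> w = (if v = w then a w else 0)"
        using W(4) W(5)[OF that] that
        by (auto simp: pairwise_def orthogonal_def norm_eq_sqrt_inner)
    qed simp
    then show ?thesis using that W(1) by simp
  qed
  have "norm z \<noteq> 0" using coeff[OF a(1)] a(2) by auto
  have "(norm z)\<^sup>2 = (\<Sum>w\<in>W. a w * (z \<bullet> w))"
    by (subst power2_norm_eq_inner, subst (2) z_def) (simp add: inner_sum_right)
  also have "\<dots> \<le> (\<Sum>w\<in>W. norm z * ((\<delta> / \<epsilon>) * norm z))"
  proof (rule sum_mono)
    fix w assume w: "w \<in> W"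
    have "a w * (z \<bullet> w) \<le> \<bar>z \<bullet> w\<bar> * \<bar>z \<bullet> w\<bar>" by (simp add: coeff[OF w])
    also have "\<dots> \<le> norm z * ((\<delta> / \<epsilon>) * norm z)"
      using Cauchy_Schwarz_ineq2[of z w] W(5)[OF w] S_small[OF W(6)[OF w] \<open>z \<in> S\<close>]
      by (intro mult_mono) auto
    finally show "a w * (z \<bullet> w) \<le> norm z * ((\<delta> / \<epsilon>) * norm z)" .
  qed
  also have "\<dots> = (norm z)\<^sup>2 / 2"
    using e \<open>0 < \<delta>\<close> by (simp add: W(2) \<delta>_def power2_eq_square n_def del: of_nat_Suc)
  finally show False using \<open>norm z \<noteq> 0\<close> by simp
qed

section \<open>Smooth functions\<close>

text \<open>
  \<open>C_k_on\<close> speaks of \<open>frechet_derivative\<close>, a choice; this rule lets an explicit derivative be used instead.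
\<close>

lemma C_k_on_SucI:
  assumes "\<And>x. (f has_derivative D x) (at x)"
    and "\<And>b. b \<in> Basis \<Longrightarrow> C_k_on k (\<lambda>x. D x b) UNIV"
  shows "C_k_on (Suc k) f UNIV"
proof -
  have "frechet_derivative f (at x) = D x" for x
    using frechet_derivative_at[OF assms(1)[of x]] by simp
  then show ?thesis
    using assms by (auto simp: differentiable_on_def differentiable_def)
qed

lemma C_k_on_SucD: "C_k_on (Suc k) f U \<Longrightarrow> C_k_on k f U"
proof (induction k arbitrary: f)
  case 0
  then show ?case by (auto intro: differentiable_imp_continuous_on)
next
  case (Suc k)
  show ?case
    using Suc.prems[unfolded C_k_on.simps(2)[of "Suc k"]] Suc.IH
    unfolding C_k_on.simps(2)[of k f] by blast
qed

lemma C_k_on_has_derivative: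
  assumes "C_k_on (Suc k) f UNIV"
  shows "(f has_derivative frechet_derivative f (at x)) (at x)"
  using assms by (auto simp: differentiable_on_def frechet_derivative_works)

lemma C_k_on_const: "C_k_on k (\<lambda>x. c) UNIV"
proof (induction k arbitrary: c)
  case (Suc k)
  show ?case by (rule C_k_on_SucI[where D="\<lambda>x h. 0"]) (auto intro: Suc)
qed (auto intro: continuous_intros)

lemma C_k_on_inner: "C_k_on k (\<lambda>x. x \<bullet> c) UNIV"
proof (cases k)
  case (Suc m)
  show ?thesis unfolding Suc
    by (rule C_k_on_SucI[where D="\<lambda>x h. h \<bullet> c"])
       (auto intro!: derivative_eq_intros C_k_on_const)
qed (auto intro: continuous_intros)

lemma C_k_on_add:
  "C_k_on k f UNIV \<Longrightarrow> C_k_on k g UNIV \<Longrightarrow> C_k_on k (\<lambda>x. f x + g x) UNIV"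
proof (induction k arbitrary: f g)
  case (Suc k)
  show ?case
  proof (rule C_k_on_SucI)
    show "((\<lambda>x. f x + g x) has_derivative
        (\<lambda>h. frechet_derivative f (at x) h + frechet_derivative g (at x) h)) (at x)" for x
      by (intro has_derivative_add C_k_on_has_derivative[OF Suc.prems(1)]
          C_k_on_has_derivative[OF Suc.prems(2)])
  qed (use Suc in auto)
qed (auto intro: continuous_intros)

lemma C_k_on_mult:
  "C_k_on k f UNIV \<Longrightarrow> C_k_on k g UNIV \<Longrightarrow> C_k_on k (\<lambda>x. f x * g x) UNIV"
proof (induction k arbitrary: f g)
  case (Suc k)
  show ?case
  proof (rule C_k_on_SucI)
    show "((\<lambda>x. f x * g x) has_derivative
        (\<lambda>h. f x * frechet_derivative g (at x) h + frechet_derivative f (at x) h * g x)) (at x)" for x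
      by (intro has_derivative_mult C_k_on_has_derivative[OF Suc.prems(1)]
          C_k_on_has_derivative[OF Suc.prems(2)])
    show "C_k_on k (\<lambda>x. f x * frechet_derivative g (at x) b + frechet_derivative f (at x) b * g x) UNIV"
      if "b \<in> Basis" for b
      using that Suc.prems C_k_on_SucD[OF Suc.prems(1)] C_k_on_SucD[OF Suc.prems(2)]
      by (auto intro!: C_k_on_add Suc.IH)
  qed
qed (auto intro: continuous_intros)

lemma smooth_on_add: "smooth_on f UNIV \<Longrightarrow> smooth_on g UNIV \<Longrightarrow> smooth_on (\<lambda>x. f x + g x) UNIV"
  by (auto simp: smooth_on_def C_k_on_add)

lemma smooth_on_mult: "smooth_on f UNIV \<Longrightarrow> smooth_on g UNIV \<Longrightarrow> smooth_on (\<lambda>x. f x * g x) UNIV"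
  by (auto simp: smooth_on_def C_k_on_mult)

lemma smooth_on_const: "smooth_on (\<lambda>x. c) UNIV"
  by (auto simp: smooth_on_def C_k_on_const)

lemma smooth_on_has_derivative:
  "smooth_on f UNIV \<Longrightarrow> (f has_derivative frechet_derivative f (at x)) (at x)"
  unfolding smooth_on_def using C_k_on_has_derivative by blast

lemma smooth_on_continuous_on: "smooth_on f U \<Longrightarrow> continuous_on U f"
  unfolding smooth_on_def using C_k_on.simps(1) by blast

lemma smooth_on_derivative:
  "smooth_on f U \<Longrightarrow> b \<in> Basis \<Longrightarrow> smooth_on (\<lambda>x. frechet_derivative f (at x) b) U"
  unfolding smooth_on_def by (metis C_k_on.simps(2))

lemma smooth_on_cos: "smooth_on (\<lambda>x. cos (k * (x \<bullet> e) + \<theta>)) UNIV"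
proof -
  have "C_k_on n (\<lambda>x. cos (k * (x \<bullet> e) + \<theta>)) UNIV" for n
  proof (induction n arbitrary: \<theta>)
    case (Suc n)
    show ?case
    proof (rule C_k_on_SucI)
      show "((\<lambda>x. cos (k * (x \<bullet> e) + \<theta>)) has_derivative
        (\<lambda>h. (k * (h \<bullet> e)) * cos (k * (x \<bullet> e) + (\<theta> + pi/2)))) (at x)" for x
      proof -
        have "cos (k * (x \<bullet> e) + (\<theta> + pi/2)) = - sin (k * (x \<bullet> e) + \<theta>)"
          using minus_sin_cos_eq[of "k * (x \<bullet> e) + \<theta>"] by (simp add: add.assoc)
        then show ?thesis by (auto intro!: derivative_eq_intros)
      qed
    qed (auto intro: C_k_on_mult C_k_on_const Suc)
  qed (auto intro!: continuous_intros)
  then show ?thesis by (simp add: smooth_on_def)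
qed

section \<open>Bump functions\<close>

text \<open>
  For \<open>m = 0\<close> this is the classical smooth function \<open>exp(-1/s)\<close> that is flat at \<open>0\<close>.  The powers
  of \<open>1/s\<close> are included because they make the family closed under differentiation.
\<close>

definition flat :: "nat \<Rightarrow> real \<Rightarrow> real" where
  "flat m s = (if s > 0 then inverse s ^ m * exp (- inverse s) else 0)"

text \<open>
  A single term of the exponential series at \<open>1/s\<close>; the square on the right forces the derivative at \<open>0\<close> to vanish.
\<close>

lemma flat_le: "flat m s \<le> fact (m + 2) * s\<^sup>2"
proof (cases "s > 0")
  case True
  define z where "z = inverse s"
  have z: "z > 0" "s = inverse z" using True by (auto simp: z_def)
  have "z ^ (m+2) / fact (m+2) \<le> exp z"
  proof -
    have "(\<Sum>n\<in>{m+2}. z ^ n /\<^sub>R fact n) \<le> (\<Sum>n. z ^ n /\<^sub>R fact n)"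
      by (rule sum_le_suminf) (use z summable_exp_generic[of z] in auto)
    then show ?thesis by (simp add: exp_def divide_inverse mult.commute)
  qed
  then have "z ^ (m+2) \<le> exp z * fact (m+2)"
    by (simp add: pos_divide_le_eq del: fact_Suc)
  then have "z ^ (m+2) * exp (- z) \<le> (exp z * fact (m+2)) * exp (- z)"
    by (rule mult_right_mono) simp
  also have "\<dots> = fact (m+2) * (exp z * exp (- z))"
    by (simp only: ac_simps)
  also have "\<dots> = fact (m+2)"
    by (simp only: exp_minus_inverse mult_1_right)
  finally have le: "z ^ (m+2) * exp (- z) \<le> fact (m+2)" .
  have "z ^ m * exp (- z) = (z ^ (m+2) * exp (- z)) * (inverse z)\<^sup>2"
    using z(1) by (simp add: power_add power2_eq_square field_simps)
  also have "\<dots> \<le> fact (m+2) * (inverse z)\<^sup>2"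
    by (rule mult_right_mono[OF le]) simp
  finally have "z ^ m * exp (- z) \<le> fact (m+2) * (inverse z)\<^sup>2" .
  then show ?thesis using True by (simp add: flat_def z_def)
qed (simp add: flat_def)

lemma flat_nonneg: "0 \<le> flat m s"
  by (simp add: flat_def)

lemma flat_DERIV: "(flat m has_real_derivative flat (m + 2) s - m * flat (m + 1) s) (at s)"
proof -
  consider "s > 0" | "s < 0" | "s = 0" by linarith
  then show ?thesis
  proof cases
    case 1
    have "((\<lambda>s. inverse s ^ m * exp (- inverse s)) has_real_derivative
       (real m * inverse s ^ (m - 1) * (- (inverse s)\<^sup>2)) * exp (- inverse s)
         + inverse s ^ m * (exp (- inverse s) * (inverse s)\<^sup>2)) (at s)"
      using 1 by (auto intro!: derivative_eq_intros simp: power2_eq_square)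
    also have "(real m * inverse s ^ (m - 1) * (- (inverse s)\<^sup>2)) * exp (- inverse s)
         + inverse s ^ m * (exp (- inverse s) * (inverse s)\<^sup>2) = flat (m + 2) s - m * flat (m + 1) s"
      using 1 by (cases m) (simp_all add: flat_def power2_eq_square algebra_simps)
    finally have "((\<lambda>s. inverse s ^ m * exp (- inverse s)) has_real_derivative
       flat (m + 2) s - m * flat (m + 1) s) (at s)" .
    then show ?thesis
    proof (rule DERIV_cong_ev[THEN iffD1, rotated -1, OF _ refl _ refl])
      show "\<forall>\<^sub>F x in nhds s. inverse x ^ m * exp (- inverse x) = flat m x"
        using eventually_nhds_in_open[of "{0<..}" s] 1
        by (auto elim!: eventually_mono simp: flat_def)
    qed
  next
    case 2
    have "((\<lambda>s. 0) has_real_derivative flat (m + 2) s - m * flat (m + 1) s) (at s)"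
      using 2 by (simp add: flat_def)
    then show ?thesis
    proof (rule DERIV_cong_ev[THEN iffD1, rotated -1, OF _ refl _ refl])
      show "\<forall>\<^sub>F x in nhds s. 0 = flat m x"
        using eventually_nhds_in_open[of "{..<0}" s] 2
        by (auto elim!: eventually_mono simp: flat_def)
    qed
  next
    case 3
    have "((\<lambda>h. flat m h / h) \<longlongrightarrow> 0) (at 0)"
    proof (rule Lim_null_comparison)
      show "\<forall>\<^sub>F h in at 0. norm (flat m h / h) \<le> fact (m + 2) * \<bar>h\<bar>"
      proof (intro always_eventually allI)
        fix h :: real
        show "norm (flat m h / h) \<le> fact (m + 2) * \<bar>h\<bar>"
          using flat_le[of m h] flat_nonneg[of m h]
          by (cases "h = 0") (auto simp: abs_div_pos field_simps power2_eq_square divide_simps abs_if)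
      qed
      show "((\<lambda>h. fact (m + 2) * \<bar>h\<bar>) \<longlongrightarrow> (0::real)) (at 0)"
        by (auto intro!: tendsto_eq_intros)
    qed
    then show ?thesis
      using 3 by (simp add: DERIV_def flat_def)
  qed
qed

definition bump :: "'a::euclidean_space \<Rightarrow> real \<Rightarrow> 'a \<Rightarrow> real" where
  "bump c r x = flat 0 (r\<^sup>2 - (x - c) \<bullet> (x - c))"

text \<open>
  Differentiating \<open>flat m \<circ> q\<close>, with \<open>q\<close> the quadratic polynomial in the bump, gives polynomial multiples
  of \<open>flat (m + 2) \<circ> q\<close> and \<open>flat (m + 1) \<circ> q\<close>, so one induction on the order, for all \<open>m\<close> at once,
  suffices.
\<close>

lemma smooth_on_bump: "smooth_on (bump c r) UNIV"
proof -
  define q where "q x = r\<^sup>2 - (x - c) \<bullet> (x - c)" for x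
  have "C_k_on n (\<lambda>x. flat m (q x)) UNIV" for n m
  proof (induction n arbitrary: m)
    case 0
    have "continuous_on UNIV (flat m)"
      by (metis DERIV_isCont continuous_at_imp_continuous_on flat_DERIV)
    then show ?case unfolding q_def
      by (auto intro!: continuous_intros continuous_on_compose2[of UNIV "flat m"])
  next
    case (Suc n)
    show ?case
    proof (rule C_k_on_SucI)
      show "((\<lambda>x. flat m (q x)) has_derivative
        (\<lambda>h. (flat (m+2) (q x) + (- real m) * flat (m+1) (q x)) * (- 2 * (x \<bullet> h + (- (c \<bullet> h)))))) (at x)" for x
      proof -
        have "(q has_derivative (\<lambda>h. - 2 * ((x - c) \<bullet> h))) (at x)"
          unfolding q_def by (auto intro!: derivative_eq_intros simp: inner_commute)
        from has_derivative_compose[OF this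
            flat_DERIV[of m "q x", THEN has_field_derivative_imp_has_derivative]]
        show ?thesis
          by (simp add: inner_diff_left algebra_simps)
      qed
    qed (intro C_k_on_mult C_k_on_add C_k_on_const C_k_on_inner Suc)
  qed
  then show ?thesis by (simp add: smooth_on_def bump_def[abs_def] q_def)
qed

lemma bump_nonzero_iff: "r > 0 \<Longrightarrow> bump c r x \<noteq> 0 \<longleftrightarrow> x \<in> ball c r"
proof -
  assume "r > 0"
  have "(x - c) \<bullet> (x - c) < r\<^sup>2 \<longleftrightarrow> norm (x - c) < r"
    using \<open>r > 0\<close> by (metis abs_of_pos power2_norm_eq_inner norm_lt_square not_less)
  then show ?thesis
    by (auto simp: bump_def flat_def dist_norm norm_minus_commute)
qed

lemma test_function_bump:
  assumes "r > 0" "cball c r \<subseteq> \<Omega>"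
  shows "test_function \<Omega> (bump c r)"
proof -
  have "{x. bump c r x \<noteq> 0} = ball c r"
    using bump_nonzero_iff[OF assms(1)] by blast
  then show ?thesis
    using assms by (simp add: test_function_def smooth_on_bump)
qed

section \<open>Test functions\<close>

lemma test_function_compact: "test_function \<Omega> \<phi> \<Longrightarrow> compact (closure {x. \<phi> x \<noteq> 0})"
  by (simp add: test_function_def)

lemma test_function_support:
  assumes "test_function \<Omega> \<phi>" "smooth_on \<psi> UNIV" "{x. \<psi> x \<noteq> 0} \<subseteq> closure {x. \<phi> x \<noteq> 0}"
  shows "test_function \<Omega> \<psi>"
proof -
  have "closure {x. \<psi> x \<noteq> 0} \<subseteq> closure {x. \<phi> x \<noteq> 0}"
    using assms(3) by (simp add: closure_minimal)
  moreover from this have "compact (closure {x. \<psi> x \<noteq> 0})"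
    using compact_Int_closed[OF test_function_compact[OF assms(1)] closed_closure[of "{x. \<psi> x \<noteq> 0}"]]
    by (simp add: Int_absorb1)
  ultimately show ?thesis
    using assms(1,2) by (auto simp: test_function_def)
qed

lemma test_function_mult:
  assumes "test_function \<Omega> \<phi>" "smooth_on \<psi> UNIV"
  shows "test_function \<Omega> (\<lambda>x. \<phi> x * \<psi> x)"
proof (rule test_function_support[OF assms(1)])
  show "smooth_on (\<lambda>x. \<phi> x * \<psi> x) UNIV"
    using assms by (auto intro: smooth_on_mult simp: test_function_def)
  show "{x. \<phi> x * \<psi> x \<noteq> 0} \<subseteq> closure {x. \<phi> x \<noteq> 0}"
    using closure_subset by force
qed

lemma test_function_derivative:
  assumes "test_function \<Omega> \<phi>" "b \<in> Basis"
  shows "test_function \<Omega> (\<lambda>x. frechet_derivative \<phi> (at x) b)"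
proof (rule test_function_support[OF assms(1)])
  show "smooth_on (\<lambda>x. frechet_derivative \<phi> (at x) b) UNIV"
    using assms by (auto intro: smooth_on_derivative simp: test_function_def)
  show "{x. frechet_derivative \<phi> (at x) b \<noteq> 0} \<subseteq> closure {x. \<phi> x \<noteq> 0}"
  proof (rule ccontr)
    assume "\<not> ?thesis"
    then obtain x where x: "frechet_derivative \<phi> (at x) b \<noteq> 0" "x \<in> - closure {x. \<phi> x \<noteq> 0}"
      by auto
    have "((\<lambda>x. 0) has_derivative (\<lambda>h. 0)) (at x)" by simp
    then have "(\<phi> has_derivative (\<lambda>h. 0)) (at x)"
      by (rule has_derivative_transform_within_open[OF _ _ x(2)]) (use closure_subset[of "{x. \<phi> x \<noteq> 0}"] in auto)
    then have "frechet_derivative \<phi> (at x) = (\<lambda>h. 0)"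
      using frechet_derivative_at by metis
    then show False using x by simp
  qed
qed

lemma test_function_smooth: "test_function \<Omega> \<phi> \<Longrightarrow> smooth_on \<phi> UNIV"
  by (simp add: test_function_def)

lemma test_function_zero_outside: "x \<notin> closure {x. \<phi> x \<noteq> 0} \<Longrightarrow> \<phi> x = 0"
  using closure_subset[of "{x. \<phi> x \<noteq> 0}"] by auto

lemma test_function_add:
  assumes "test_function \<Omega> f" "test_function \<Omega> g"
  shows "test_function \<Omega> (\<lambda>x. f x + g x)"
proof -
  let ?K = "closure {x. f x \<noteq> 0} \<union> closure {x. g x \<noteq> 0}"
  have "compact ?K" using assms by (auto simp: test_function_def)
  moreover have sub: "closure {x. f x + g x \<noteq> 0} \<subseteq> ?K"
  proof (rule closure_minimal)
    show "{x. f x + g x \<noteq> 0} \<subseteq> ?K"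
    proof
      fix x assume "x \<in> {x. f x + g x \<noteq> 0}"
      then have "f x \<noteq> 0 \<or> g x \<noteq> 0" by auto
      then show "x \<in> ?K"
        using test_function_zero_outside[of x f] test_function_zero_outside[of x g] by auto
    qed
  qed auto
  ultimately have "compact (closure {x. f x + g x \<noteq> 0})"
    using compact_Int_closed[of ?K "closure {x. f x + g x \<noteq> 0}"] by (simp add: Int_absorb1)
  then show ?thesis
    using assms sub by (auto simp: test_function_def intro: smooth_on_add)
qed

lemma test_function_zero: "test_function \<Omega> (\<lambda>x. 0)"
  by (simp add: test_function_def smooth_on_const)

lemma test_function_sum:
  assumes "finite I" "\<And>i. i \<in> I \<Longrightarrow> test_function \<Omega> (f i)"
  shows "test_function \<Omega> (\<lambda>x. \<Sum>i\<in>I. f i x)"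
  using assms
proof (induction I)
  case (insert i I)
  then show ?case by (simp add: test_function_add)
qed (simp add: test_function_zero)

lemma test_function_bounded:
  assumes "test_function \<Omega> \<phi>"
  obtains C where "\<And>x. \<bar>\<phi> x\<bar> \<le> C"
proof -
  have "continuous_on (closure {x. \<phi> x \<noteq> 0}) \<phi>"
    using smooth_on_continuous_on[OF test_function_smooth[OF assms]] continuous_on_subset by blast
  then have "bounded (\<phi> ` closure {x. \<phi> x \<noteq> 0})"
    using test_function_compact[OF assms] compact_continuous_image compact_imp_bounded by blast
  then obtain C where C: "C > 0" "\<And>x. x \<in> closure {x. \<phi> x \<noteq> 0} \<Longrightarrow> \<bar>\<phi> x\<bar> \<le> C"
    by (auto simp: bounded_pos)
  have "\<bar>\<phi> x\<bar> \<le> C" for x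
    using C test_function_zero_outside[of x \<phi>] by (cases "x \<in> closure {x. \<phi> x \<noteq> 0}") auto
  then show ?thesis by (rule that)
qed

lemma test_function_integrable:
  assumes "test_function \<Omega> \<phi>"
  shows "integrable lborel \<phi>"
proof -
  have "continuous_on (closure {x. \<phi> x \<noteq> 0}) \<phi>"
    using smooth_on_continuous_on[OF test_function_smooth[OF assms]] continuous_on_subset by blast
  note int = borel_integrable_compact[OF test_function_compact[OF assms] this]
  have "indicator (closure {x. \<phi> x \<noteq> 0}) x *\<^sub>R \<phi> x = \<phi> x" for x
  proof (cases "x \<in> closure {x. \<phi> x \<noteq> 0}")
    case False
    have "\<phi> x = 0" by (rule test_function_zero_outside[OF False])
    then show ?thesis by (metis scaleR_zero_right)
  qed simp
  with int show ?thesis by (simp only:)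
qed

lemma test_function_square_integrable:
  assumes "test_function \<Omega> \<phi>"
  shows "square_integrable \<phi>"
  using test_function_integrable[OF assms]
    test_function_integrable[OF test_function_mult[OF assms test_function_smooth[OF assms]]]
  by (auto simp: square_integrable_def power2_eq_square)

lemma integral_lborel_translate:
  fixes f :: "'a::euclidean_space \<Rightarrow> real"
  assumes [measurable]: "f \<in> borel_measurable borel"
  shows "(LINT x|lborel. f (c + x)) = (LINT x|lborel. f x)"
  by (subst (2) lborel_distr_plus[of c, symmetric]) (simp add: integral_distr)

lemma directional_DERIV:
  assumes "smooth_on u UNIV"
  shows "((\<lambda>t. u (x + t *\<^sub>R b)) has_real_derivative frechet_derivative u (at (x + t *\<^sub>R b)) b) (at t)"
proof -
  let ?D = "frechet_derivative u (at (x + t *\<^sub>R b))"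
  have D: "(u has_derivative ?D) (at (x + t *\<^sub>R b))"
    by (rule smooth_on_has_derivative[OF assms])
  have "((\<lambda>t. x + t *\<^sub>R b) has_derivative (\<lambda>h. h *\<^sub>R b)) (at t)"
    by (auto intro!: derivative_eq_intros)
  from has_derivative_compose[OF this D]
  have "((\<lambda>t. u (x + t *\<^sub>R b)) has_derivative (\<lambda>h. ?D (h *\<^sub>R b))) (at t)" .
  also have "(\<lambda>h. ?D (h *\<^sub>R b)) = (*) (?D b)"
    using linear_scale[OF has_derivative_linear[OF D]] by (auto simp: fun_eq_iff)
  finally show ?thesis by (simp add: has_field_derivative_def)
qed

text \<open>
  The integrals of the difference quotients of \<open>u\<close> vanish by translation invariance of Lebesgue measure,
  and the quotients converge dominatedly to the derivative: they are bounded by the mean value theorem, and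
  supported in a common ball because the steps are at most one.
\<close>

lemma integral_derivative_test_function:
  fixes u :: "'a::euclidean_space \<Rightarrow> real"
  assumes u: "test_function \<Omega> u" and b: "b \<in> Basis"
  shows "(LINT x|lborel. frechet_derivative u (at x) b) = 0"
proof -
  let ?D = "\<lambda>x. frechet_derivative u (at x) b"
  define h where "h n = inverse (real (Suc n))" for n
  have h: "0 < h n" "h n \<le> 1" for n by (auto simp: h_def field_simps)
  define s where "s n x = (u (x + h n *\<^sub>R b) - u x) / h n" for n x
  obtain C where C: "\<And>x. \<bar>?D x\<bar> \<le> C"
    using test_function_bounded[OF test_function_derivative[OF u b]] by blast
  obtain R where R: "closure {x. u x \<noteq> 0} \<subseteq> cball 0 R"
    using compact_imp_bounded[OF test_function_compact[OF u]] by (auto simp: bounded_iff subset_eq)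
  have um[measurable]: "u \<in> borel_measurable borel"
    using test_function_square_integrable[OF u] by (simp add: square_integrable_def)
  have sm: "(\<lambda>x. s n x) \<in> borel_measurable lborel" for n
    unfolding s_def by measurable
  have mvt: "\<bar>s n x\<bar> \<le> C" for n x
  proof -
    obtain z where "u (x + h n *\<^sub>R b) - u (x + 0 *\<^sub>R b) = (h n - 0) * frechet_derivative u (at (x + z *\<^sub>R b)) b"
      using MVT2[of 0 "h n" "\<lambda>t. u (x + t *\<^sub>R b)" "\<lambda>t. frechet_derivative u (at (x + t *\<^sub>R b)) b"]
        h directional_DERIV[OF test_function_smooth[OF u]] by blast
    then show ?thesis using C h(1)[of n] by (simp add: s_def)
  qed
  have lim: "(\<lambda>n. s n x) \<longlonglongrightarrow> ?D x" for x
  proof -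
    have "((\<lambda>t. (u (x + t *\<^sub>R b) - u x) / t) \<longlongrightarrow> ?D x) (at 0)"
      using directional_DERIV[OF test_function_smooth[OF u], of x b 0] by (simp add: DERIV_def)
    moreover have "filterlim h (at 0) sequentially"
      unfolding filterlim_at using h(1) LIMSEQ_inverse_real_of_nat
      by (auto simp: h_def[abs_def] simp del: of_nat_Suc)
    ultimately show ?thesis unfolding s_def by (rule filterlim_compose)
  qed
  have bound: "norm (s n x) \<le> C * indicator (cball 0 (R + 1)) x" for n x
  proof (cases "x \<in> cball 0 (R + 1)")
    case False
    have "x \<notin> cball 0 R" using False by auto
    then have "u x = 0" using R by (intro test_function_zero_outside) blast
    have "norm x \<le> norm (x + h n *\<^sub>R b) + norm (h n *\<^sub>R b)" 
      using norm_triangle_ineq4[of "x + h n *\<^sub>R b" "h n *\<^sub>R b"] by simp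
    then have "norm (x + h n *\<^sub>R b) > R" using False h[of n] b by auto
    then have "x + h n *\<^sub>R b \<notin> cball 0 R" by simp
    then have "u (x + h n *\<^sub>R b) = 0" using R by (intro test_function_zero_outside) blast
    then show ?thesis using \<open>u x = 0\<close> False by (simp add: s_def)
  qed (use mvt in auto)
  have "(\<lambda>n. LINT x|lborel. s n x) \<longlonglongrightarrow> (LINT x|lborel. ?D x)"
  proof (rule integral_dominated_convergence)
    show "?D \<in> borel_measurable lborel"
      using test_function_square_integrable[OF test_function_derivative[OF u b]] by (simp add: square_integrable_def)
    show "integrable lborel (\<lambda>x. C * indicator (cball 0 (R + 1)) x)"
      by (intro integrable_mult_right integrable_real_indicator) (simp, rule emeasure_lborel_cball_finite)
  qed (use sm lim bound in auto)
  moreover have "(LINT x|lborel. s n x) = 0" for n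
  proof -
    have i: "integrable lborel u" by (rule test_function_integrable[OF u])
    then have "integrable (distr lborel borel ((+) (h n *\<^sub>R b))) u" by (simp add: lborel_distr_plus)
    then have "integrable lborel (\<lambda>x. u (x + h n *\<^sub>R b))"
      by (subst (asm) integrable_distr_eq) (auto simp: add.commute)
    then show ?thesis
      using i integral_lborel_translate[OF um, of "h n *\<^sub>R b"] by (simp add: s_def add.commute)
  qed
  ultimately have "(\<lambda>n. 0) \<longlonglongrightarrow> (LINT x|lborel. ?D x)" by simp
  then show ?thesis by (simp add: LIMSEQ_const_iff)
qed

section \<open>Norms and inner products of classes\<close>

lemma inner_L2_of:
  assumes "square_integrable f" "square_integrable g"
  shows "inner (L2_of f) (L2_of g) = (LINT x|lborel. f x * g x)"
  unfolding inner_L2_L2_of[OF assms(1)]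
proof (rule integral_cong_AE)
  have [measurable]: "f \<in> borel_measurable lborel" "g \<in> borel_measurable lborel"
    using assms by (auto simp: square_integrable_def)
  show "(\<lambda>x. f x * fun_of (L2_of g) x) \<in> borel_measurable lborel" 
    "(\<lambda>x. f x * g x) \<in> borel_measurable lborel" by measurable
  show "AE x in lborel. f x * fun_of (L2_of g) x = f x * g x"
    using fun_of_L2_of[OF assms(2)] by eventually_elim simp
qed

lemma norm_L2_of: "square_integrable f \<Longrightarrow> (norm (L2_of f))\<^sup>2 = (LINT x|lborel. (f x)\<^sup>2)"
proof -
  assume f: "square_integrable f"
  then have [measurable]: "f \<in> borel_measurable lborel" by (simp add: square_integrable_def)
  have "(norm (L2_of f))\<^sup>2 = (LINT x|lborel. f x * fun_of (L2_of f) x)"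
    unfolding power2_norm_eq_inner by (rule inner_L2_L2_of[OF f])
  also have "\<dots> = (LINT x|lborel. (f x)\<^sup>2)"
    by (rule integral_cong_AE)
       (use fun_of_L2_of[OF f] in \<open>auto elim!: eventually_mono simp: power2_eq_square\<close>)
  finally show ?thesis .
qed

lemma norm_fun_of: "(norm v)\<^sup>2 = (LINT x|lborel. (fun_of v x)\<^sup>2)"
  using norm_L2_of[OF square_integrable_fun_of[of v]] by simp

lemma L2_of_add:
  assumes "square_integrable f" "square_integrable g"
  shows "L2_of (\<lambda>x. f x + g x) = L2_of f + L2_of g"
  unfolding L2_eq_iff
  using fun_of_L2_of[OF square_integrable_add[OF assms]] fun_of_add[of "L2_of f" "L2_of g"]
    fun_of_L2_of[OF assms(1)] fun_of_L2_of[OF assms(2)]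
  by eventually_elim simp

lemma L2_of_scale:
  assumes "square_integrable f"
  shows "L2_of (\<lambda>x. c * f x) = c *\<^sub>R L2_of f"
  unfolding L2_eq_iff
  using fun_of_L2_of[OF square_integrable_scale[OF assms, of c]] fun_of_scaleR[of c "L2_of f"]
    fun_of_L2_of[OF assms(1)]
  by eventually_elim simp

section \<open>The Dirichlet form and the Laplacian\<close>

definition grad_L2 :: "(real^'n \<Rightarrow> real) \<Rightarrow> (real^'n) L2 ^ 'n" where
  "grad_L2 v = (\<chi> i. L2_of (\<lambda>x. frechet_derivative v (at x) (axis i 1)))"

definition laplacian :: "(real^'n \<Rightarrow> real) \<Rightarrow> real^'n \<Rightarrow> real" where
  "laplacian v x = (\<Sum>i\<in>UNIV. frechet_derivative (\<lambda>x. frechet_derivative v (at x) (axis i 1)) (at x) (axis i 1))"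

lemma test_function_derivative_axis:
  fixes \<phi> :: "real^'n \<Rightarrow> real"
  shows "test_function \<Omega> \<phi> \<Longrightarrow> test_function \<Omega> (\<lambda>x. frechet_derivative \<phi> (at x) (axis i 1))"
  by (rule test_function_derivative) (simp_all add: axis_in_Basis_iff Basis_real_def)

lemma frechet_derivative_mult_smooth:
  assumes "smooth_on f UNIV" "smooth_on g UNIV"
  shows "frechet_derivative (\<lambda>x. f x * g x) (at x) b =
     frechet_derivative f (at x) b * g x + f x * frechet_derivative g (at x) b"
  using frechet_derivative_at[OF has_derivative_mult[OF smooth_on_has_derivative[OF assms(1), of x]
      smooth_on_has_derivative[OF assms(2), of x]], symmetric]
  by simp

lemma frechet_derivative_add_smooth:
  assumes "smooth_on f UNIV" "smooth_on g UNIV"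
  shows "frechet_derivative (\<lambda>x. f x + g x) (at x) b =
     frechet_derivative f (at x) b + frechet_derivative g (at x) b"
  using frechet_derivative_at[OF has_derivative_add[OF smooth_on_has_derivative[OF assms(1), of x]
      smooth_on_has_derivative[OF assms(2), of x]], symmetric]
  by simp

lemma frechet_derivative_scale_smooth:
  fixes f :: "'a::euclidean_space \<Rightarrow> real"
  assumes "smooth_on f UNIV"
  shows "frechet_derivative (\<lambda>x. c * f x) (at x) b = c * frechet_derivative f (at x) b"
  using frechet_derivative_at[OF has_derivative_mult_right[OF smooth_on_has_derivative[OF assms(1), of x]], symmetric]
  by simp

lemma test_function_laplacian:
  assumes "test_function \<Omega> \<phi>"
  shows "test_function \<Omega> (laplacian \<phi>)"
  unfolding laplacian_def[abs_def]
  by (intro test_function_sum finite test_function_derivative_axis assms)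

text \<open>
  Integration by parts: the divergence of \<open>\<phi> \<nabla>v\<close> has integral zero.
\<close>

lemma green:
  assumes \<phi>: "test_function \<Omega> \<phi>" and v: "test_function \<Omega> v"
  shows "inner (grad_L2 \<phi>) (grad_L2 v) = - inner (L2_of \<phi>) (L2_of (laplacian v))"
proof -
  let ?d = "\<lambda>f i x. frechet_derivative f (at x) (axis i 1)"
  have int: "integrable lborel (\<lambda>x. ?d \<phi> i x * ?d v i x)" "integrable lborel (\<lambda>x. \<phi> x * ?d (?d v i) i x)" for i
    by (auto intro!: test_function_integrable[where \<Omega>=\<Omega>] test_function_mult test_function_smooth[where \<Omega>=\<Omega>]
        test_function_derivative_axis \<phi> v)
  have eq: "(LINT x|lborel. ?d \<phi> i x * ?d v i x) = - (LINT x|lborel. \<phi> x * ?d (?d v i) i x)" for i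
  proof -
    have sm: "smooth_on (?d v i) UNIV" "smooth_on \<phi> UNIV"
      using \<phi> v test_function_derivative_axis test_function_smooth by blast+
    have "0 = (LINT x|lborel. ?d (\<lambda>x. \<phi> x * ?d v i x) i x)"
      by (rule integral_derivative_test_function[symmetric, OF test_function_mult[OF \<phi> sm(1)]])
        (simp add: axis_in_Basis_iff Basis_real_def)
    also have "\<dots> = (LINT x|lborel. ?d \<phi> i x * ?d v i x + \<phi> x * ?d (?d v i) i x)"
      by (simp add: frechet_derivative_mult_smooth[OF sm(2,1)])
    also have "\<dots> = (LINT x|lborel. ?d \<phi> i x * ?d v i x) + (LINT x|lborel. \<phi> x * ?d (?d v i) i x)"
      by (rule Bochner_Integration.integral_add[OF int])
    finally show ?thesis by simp
  qed
  have "inner (grad_L2 \<phi>) (grad_L2 v) = (\<Sum>i\<in>UNIV. LINT x|lborel. ?d \<phi> i x * ?d v i x)"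
    unfolding grad_L2_def inner_vec_def
    by (auto intro!: sum.cong inner_L2_of test_function_square_integrable[where \<Omega>=\<Omega>]
        test_function_derivative_axis \<phi> v)
  also have "\<dots> = - (\<Sum>i\<in>UNIV. LINT x|lborel. \<phi> x * ?d (?d v i) i x)"
    by (simp add: eq sum_negf)
  also have "(\<Sum>i\<in>UNIV. LINT x|lborel. \<phi> x * ?d (?d v i) i x) = (LINT x|lborel. \<phi> x * laplacian v x)"
    unfolding laplacian_def sum_distrib_left
    by (rule Bochner_Integration.integral_sum[symmetric]) (rule int)
  also have "\<dots> = inner (L2_of \<phi>) (L2_of (laplacian v))"
    by (rule inner_L2_of[symmetric])
      (rule test_function_square_integrable[OF \<phi>]
        test_function_square_integrable[OF test_function_laplacian[OF v]])+
  finally show ?thesis .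
qed

lemma H10_graph_test_function: "test_function \<Omega> v \<Longrightarrow> (L2_of v, grad_L2 v) \<in> H10_graph \<Omega>"
  unfolding H10_graph_def grad_L2_def using closure_subset by fastforce

text \<open>
  Both sides are continuous in the pair of a function and its gradient, so Green's identity passes from
  test functions to their closure.
\<close>

lemma H10_graph_green:
  assumes "(a, A) \<in> H10_graph \<Omega>" and v: "test_function \<Omega> v"
  shows "inner A (grad_L2 v) = - inner a (L2_of (laplacian v))"
proof -
  have "H10_graph \<Omega> \<subseteq> {p. inner (snd p) (grad_L2 v) = - inner (fst p) (L2_of (laplacian v))}"
    unfolding H10_graph_def
  proof (rule closure_minimal)
    show "closed {p. inner (snd p) (grad_L2 v) = - inner (fst p) (L2_of (laplacian v))}"
      by (intro closed_Collect_eq continuous_intros)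
  qed (use green[OF _ v] in \<open>auto simp: grad_L2_def\<close>)
  then show ?thesis using assms(1) by auto
qed

section \<open>Oscillating test functions\<close>

definition osc :: "'a::euclidean_space \<Rightarrow> real \<Rightarrow> real \<Rightarrow> ('a \<Rightarrow> real) \<Rightarrow> 'a \<Rightarrow> real" where
  "osc e k \<theta> \<phi> x = \<phi> x * cos (k * (x \<bullet> e) + \<theta>)"

lemma smooth_on_osc: "smooth_on \<phi> UNIV \<Longrightarrow> smooth_on (osc e k \<theta> \<phi>) UNIV"
  unfolding osc_def by (intro smooth_on_mult smooth_on_cos)

lemma test_function_osc: "test_function \<Omega> \<phi> \<Longrightarrow> test_function \<Omega> (osc e k \<theta> \<phi>)"
  unfolding osc_def[abs_def] by (intro test_function_mult smooth_on_cos)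

text \<open>
  Each differentiation of the cosine advances its phase by \<open>\<pi>/2\<close>; keeping the phase as a parameter of
  \<open>osc\<close> makes the oscillations closed under differentiation.
\<close>

lemma frechet_derivative_osc:
  assumes "smooth_on \<phi> UNIV"
  shows "frechet_derivative (osc e k \<theta> \<phi>) (at x) b =
     osc e k \<theta> (\<lambda>x. frechet_derivative \<phi> (at x) b) x + k * (b \<bullet> e) * osc e k (\<theta> + pi/2) \<phi> x"
proof -
  have "cos (k * (x \<bullet> e) + (\<theta> + pi/2)) = - sin (k * (x \<bullet> e) + \<theta>)"
    using minus_sin_cos_eq[of "k * (x \<bullet> e) + \<theta>"] by (simp add: add.assoc)
  then have "((\<lambda>x. cos (k * (x \<bullet> e) + \<theta>)) has_derivative
      (\<lambda>h. (k * (h \<bullet> e)) * cos (k * (x \<bullet> e) + (\<theta> + pi/2)))) (at x)"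
    by (auto intro!: derivative_eq_intros)
  then have "frechet_derivative (\<lambda>x. cos (k * (x \<bullet> e) + \<theta>)) (at x) b
     = (k * (b \<bullet> e)) * cos (k * (x \<bullet> e) + (\<theta> + pi/2))"
    using frechet_derivative_at by metis
  then show ?thesis
    unfolding osc_def frechet_derivative_mult_smooth[OF assms smooth_on_cos] by simp
qed

text \<open>
  An oscillation is an eigenfunction up to a remainder that is smaller than the main term by a factor of
  order \<open>k\<close> and consists of oscillations again.
\<close>

lemma laplacian_osc:
  fixes \<phi> :: "real^'n \<Rightarrow> real"
  assumes "smooth_on \<phi> UNIV"
  shows "laplacian (osc (axis j 1) k \<theta> \<phi>) x =
     - k\<^sup>2 * osc (axis j 1) k \<theta> \<phi> x
     + 2 * k * osc (axis j 1) k (\<theta> + pi/2) (\<lambda>x. frechet_derivative \<phi> (at x) (axis j 1)) x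
     + osc (axis j 1) k \<theta> (laplacian \<phi>) x"
proof -
  let ?e = "axis j 1 :: real^'n"
  let ?d = "\<lambda>f i x. frechet_derivative f (at x) (axis i 1)"
  define c where "c i = (axis i 1 :: real^'n) \<bullet> ?e" for i
  have c: "c i = (if i = j then 1 else 0)" for i
    by (simp add: c_def inner_axis_axis)
  have sm: "smooth_on (?d \<phi> i) UNIV" for i
    using assms by (auto intro: smooth_on_derivative simp: axis_in_Basis_iff Basis_real_def)
  have d1: "?d (osc ?e k \<theta> f) i x = osc ?e k \<theta> (?d f i) x + k * c i * osc ?e k (\<theta> + pi/2) f x"
    if "smooth_on f UNIV" for f i x \<theta>
    by (simp add: frechet_derivative_osc[OF that] c_def)
  have neg: "osc ?e k (pi + \<theta>) f x = - osc ?e k \<theta> f x" for f x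
    using cos_periodic_pi[of "k * (x \<bullet> ?e) + \<theta>"] by (simp add: osc_def ac_simps)
  have "?d (?d (osc ?e k \<theta> \<phi>) i) i x = osc ?e k \<theta> (?d (?d \<phi> i) i) x
      + (if i = j then 2 * k * osc ?e k (\<theta> + pi/2) (?d \<phi> i) x - k\<^sup>2 * osc ?e k \<theta> \<phi> x else 0)" for i
  proof -
    have "?d (?d (osc ?e k \<theta> \<phi>) i) i x
       = ?d (\<lambda>x. osc ?e k \<theta> (?d \<phi> i) x + (k * c i) * osc ?e k (\<theta> + pi/2) \<phi> x) i x"
      by (simp add: d1[OF assms])
    also have "\<dots> = ?d (osc ?e k \<theta> (?d \<phi> i)) i x + (k * c i) * ?d (osc ?e k (\<theta> + pi/2) \<phi>) i x"
      by (subst frechet_derivative_add_smooth)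
        (auto intro!: smooth_on_mult smooth_on_const smooth_on_osc sm assms
          simp: frechet_derivative_scale_smooth[OF smooth_on_osc[OF assms]])
    also have "\<dots> = osc ?e k \<theta> (?d (?d \<phi> i) i) x
      + (if i = j then 2 * k * osc ?e k (\<theta> + pi/2) (?d \<phi> i) x - k\<^sup>2 * osc ?e k \<theta> \<phi> x else 0)"
      by (cases "i = j") (simp_all add: d1[OF sm] d1[OF assms] c neg power2_eq_square algebra_simps)
    finally show ?thesis .
  qed
  then have "laplacian (osc ?e k \<theta> \<phi>) x = (\<Sum>i\<in>UNIV. osc ?e k \<theta> (?d (?d \<phi> i) i) x)
      + (2 * k * osc ?e k (\<theta> + pi/2) (?d \<phi> j) x - k\<^sup>2 * osc ?e k \<theta> \<phi> x)"
    unfolding laplacian_def by (simp only: sum.distrib sum.delta' sum.delta finite UNIV_I if_True)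
  also have "(\<Sum>i\<in>UNIV. osc ?e k \<theta> (?d (?d \<phi> i) i) x) = osc ?e k \<theta> (laplacian \<phi>) x"
    by (simp only: osc_def laplacian_def sum_distrib_right)
  finally show ?thesis by simp
qed

lemma norm_osc_le:
  assumes "test_function \<Omega> \<phi>"
  shows "norm (L2_of (osc e k \<theta> \<phi>)) \<le> norm (L2_of \<phi>)"
proof (rule power2_le_imp_le)
  have sq: "square_integrable \<phi>" "square_integrable (osc e k \<theta> \<phi>)"
    using test_function_square_integrable assms test_function_osc by blast+
  show "(norm (L2_of (osc e k \<theta> \<phi>)))\<^sup>2 \<le> (norm (L2_of \<phi>))\<^sup>2"
    unfolding norm_L2_of[OF sq(1)] norm_L2_of[OF sq(2)]
  proof (rule integral_mono)
    show "(osc e k \<theta> \<phi> x)\<^sup>2 \<le> (\<phi> x)\<^sup>2" for x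
    proof -
      have "(osc e k \<theta> \<phi> x)\<^sup>2 = (\<phi> x)\<^sup>2 * (cos (k * (x \<bullet> e) + \<theta>))\<^sup>2"
        by (simp add: osc_def power_mult_distrib)
      also have "\<dots> \<le> (\<phi> x)\<^sup>2 * 1"
        by (rule mult_left_mono) (auto simp: abs_square_le_1 abs_cos_le_one)
      finally show ?thesis by simp
    qed
  qed (use sq in \<open>auto simp: square_integrable_def\<close>)
qed simp

lemma L2_of_laplacian_osc:
  fixes \<phi> :: "real^'n \<Rightarrow> real"
  assumes \<phi>: "test_function \<Omega> \<phi>"
  shows "L2_of (laplacian (osc (axis j 1) k \<theta> \<phi>)) =
     ((2 * k) *\<^sub>R L2_of (osc (axis j 1) k (\<theta> + pi/2) (\<lambda>x. frechet_derivative \<phi> (at x) (axis j 1)))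
       + L2_of (osc (axis j 1) k \<theta> (laplacian \<phi>)))
     - k\<^sup>2 *\<^sub>R L2_of (osc (axis j 1) k \<theta> \<phi>)"
proof -
  have sq: "square_integrable (osc (axis j 1) k \<theta> \<phi>)"
      "square_integrable (osc (axis j 1) k (\<theta> + pi/2) (\<lambda>x. frechet_derivative \<phi> (at x) (axis j 1)))"
      "square_integrable (osc (axis j 1) k \<theta> (laplacian \<phi>))"
    by (rule test_function_square_integrable[OF test_function_osc[OF \<phi>]]
        test_function_square_integrable[OF test_function_osc[OF test_function_derivative_axis[OF \<phi>]]]
        test_function_square_integrable[OF test_function_osc[OF test_function_laplacian[OF \<phi>]]])+
  define A where "A = osc (axis j 1) k \<theta> \<phi>"
  define B where "B = osc (axis j 1) k (\<theta> + pi/2) (\<lambda>x. frechet_derivative \<phi> (at x) (axis j 1))"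
  define C where "C = osc (axis j 1) k \<theta> (laplacian \<phi>)"
  note sq' = sq[folded A_def B_def C_def]
  have eq: "laplacian A = (\<lambda>x. ((- k\<^sup>2) * A x + (2 * k) * B x) + C x)"
    unfolding A_def B_def C_def by (rule ext) (rule laplacian_osc[OF test_function_smooth[OF \<phi>]])
  have "L2_of (laplacian A) = L2_of (\<lambda>x. (- k\<^sup>2) * A x + (2 * k) * B x) + L2_of C"
    unfolding eq by (intro L2_of_add square_integrable_add square_integrable_scale sq')
  also have "L2_of (\<lambda>x. (- k\<^sup>2) * A x + (2 * k) * B x) = L2_of (\<lambda>x. (- k\<^sup>2) * A x) + L2_of (\<lambda>x. (2 * k) * B x)"
    by (intro L2_of_add square_integrable_scale sq')
  also have "L2_of (\<lambda>x. (- k\<^sup>2) * A x) = (- k\<^sup>2) *\<^sub>R L2_of A"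
    by (rule L2_of_scale[OF sq'(1)])
  also have "L2_of (\<lambda>x. (2 * k) * B x) = (2 * k) *\<^sub>R L2_of B"
    by (rule L2_of_scale[OF sq'(2)])
  finally show ?thesis by (simp add: A_def B_def C_def)
qed

section \<open>The primitive of the gradient\<close>

text \<open>
  Along the partition of \<open>[0,T]\<close> into \<open>n\<close> equal parts the errors add up to \<open>(T/n)(K T - K 0)\<close>, which tends
  to zero.
\<close>

lemma increment_bound_imp_le:
  fixes q K :: "real \<Rightarrow> real"
  assumes "0 \<le> T"
    and incr: "\<And>a b. 0 \<le> a \<Longrightarrow> a \<le> b \<Longrightarrow> b \<le> T \<Longrightarrow> q a - (b - a) * (K b - K a) \<le> q b"
  shows "q 0 \<le> q T"
proof -
  have "q 0 - T * (K T - K 0) / n \<le> q T" if n: "n > 0" for n :: nat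
  proof -
    define t where "t i = real i * T / n" for i :: nat
    have "q 0 - (T / n) * (K (t i) - K 0) \<le> q (t i)" if "i \<le> n" for i
      using that
    proof (induction i)
      case (Suc i)
      have "t (Suc i) - t i = T / n" by (simp add: t_def add_divide_distrib distrib_right)
      moreover have "0 \<le> t i" "t i \<le> t (Suc i)" "t (Suc i) \<le> T"
      proof -
        have "real (Suc i) * T \<le> real n * T"
          using Suc.prems assms(1) by (intro mult_right_mono) auto
        then show "t (Suc i) \<le> T" using n by (simp add: t_def field_simps)
      qed (use assms(1) in \<open>auto simp: t_def intro!: divide_right_mono mult_right_mono\<close>)
      ultimately have "q (t i) - (T / n) * (K (t (Suc i)) - K (t i)) \<le> q (t (Suc i))"
        using incr[of "t i" "t (Suc i)"] by simp
      moreover have "q 0 - (T / n) * (K (t i) - K 0) \<le> q (t i)"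
        using Suc by simp
      ultimately show ?case unfolding right_diff_distrib by linarith
    qed (simp add: t_def)
    from this[of n] n show ?thesis by (simp add: t_def)
  qed
  moreover have "(\<lambda>n. q 0 - T * (K T - K 0) / real n) \<longlonglongrightarrow> q 0 - 0"
    by (intro tendsto_diff tendsto_const lim_const_over_n)
  ultimately show ?thesis
    by (intro LIMSEQ_le_const2[of _ "q 0" "q T"]) (auto intro!: exI[of _ 1])

qed

lemma set_integral_lborel_singleton: "(LINT s:{a}|lborel. h s) = 0" for h :: "real \<Rightarrow> real"
  unfolding set_lebesgue_integral_def
  by (rule integral_eq_zero_AE) (use AE_lborel_singleton[of a] in \<open>eventually_elim, auto simp: indicator_def\<close>)

lemma set_integral_Icc_split:
  fixes h :: "real \<Rightarrow> real"
  assumes h: "set_integrable lborel {a..c} h" and "a \<le> b" "b \<le> c"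
  shows "(LINT s:{a..c}|lborel. h s) = (LINT s:{a..b}|lborel. h s) + (LINT s:{b..c}|lborel. h s)"
proof -
  have m: "set_borel_measurable lborel {a..c} h"
    using h by (simp add: set_integrable_def set_borel_measurable_def)
  have "(LINT s:{a..c}|lborel. h s) = (LINT s:{a..<b} \<union> {b..c}|lborel. h s)"
    using assms by (simp add: ivl_disj_un_two)
  also have "\<dots> = (LINT s:{a..<b}|lborel. h s) + (LINT s:{b..c}|lborel. h s)"
    by (rule set_integral_Un) (use assms in \<open>auto intro!: set_integrable_subset[OF h]\<close>)
  also have "(LINT s:{a..<b}|lborel. h s) = (LINT s:{a..b}|lborel. h s)"
    by (rule set_integral_cong_set)
       (use assms AE_lborel_singleton[of b] in \<open>auto intro!: set_borel_measurable_subset[OF m] elim!: eventually_mono\<close>)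
  finally show ?thesis .
qed

text \<open>
  Cauchy--Schwarz against the constant one, as the variance inequality: \<open>m\<close> minus its mean value has a
  nonnegative square integral.
\<close>

lemma set_integral_Cauchy_Schwarz_one:
  fixes m :: "real \<Rightarrow> real"
  assumes int: "set_integrable lborel {a..b} m" and int2: "set_integrable lborel {a..b} (\<lambda>t. (m t)\<^sup>2)"
    and "a \<le> b"
  shows "(LINT s:{a..b}|lborel. m s)\<^sup>2 \<le> (b - a) * (LINT s:{a..b}|lborel. (m s)\<^sup>2)"
proof (cases "a = b")
  case True
  then show ?thesis by (simp add: set_integral_lborel_singleton)
next
  case False
  define I where "I = (LINT s:{a..b}|lborel. m s)"
  define c where "c = I / (b - a)"
  have c: "I = c * (b - a)" using False by (simp add: c_def)
  have "0 \<le> (LINT s:{a..b}|lborel. (m s - c)\<^sup>2)"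
    unfolding set_lebesgue_integral_def by simp
  also have "\<dots> = (LINT s:{a..b}|lborel. ((m s)\<^sup>2 - 2 * c * m s) + c\<^sup>2)"
    by (simp add: power2_diff algebra_simps)
  also have "\<dots> = (LINT s:{a..b}|lborel. (m s)\<^sup>2 - 2 * c * m s) + (LINT s:{a..b}|lborel. c\<^sup>2)"
    by (intro set_integral_add set_integral_diff(1) int2 set_integrable_mult_right int
        borel_integrable_atLeastAtMost' continuous_intros)
  also have "(LINT s:{a..b}|lborel. (m s)\<^sup>2 - 2 * c * m s)
     = (LINT s:{a..b}|lborel. (m s)\<^sup>2) - 2 * c * I"
    unfolding I_def by (subst set_integral_diff(2)) (auto intro!: int2 set_integrable_mult_right int)
  also have "(LINT s:{a..b}|lborel. c\<^sup>2) = c\<^sup>2 * (b - a)"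
    using assms by (simp add: set_lebesgue_integral_def)
  finally have "0 \<le> (b - a) * ((LINT s:{a..b}|lborel. (m s)\<^sup>2) - 2 * c * I + c\<^sup>2 * (b - a))"
    using assms by simp
  also have "\<dots> = (b - a) * (LINT s:{a..b}|lborel. (m s)\<^sup>2) - I\<^sup>2"
    unfolding c by (simp add: power2_eq_square algebra_simps)
  finally show ?thesis by (simp add: I_def)
qed

text \<open>
  The primitive of \<open>D\<close> is characterised by its inner products, which are scalar integrals, so that
  \<open>D\<close> may take its values in a nonseparable space.
\<close>

lemma weak_integral_exists:
  fixes D :: "real \<Rightarrow> 'h::{real_inner, complete_space}"
  assumes [measurable]: "D \<in> borel_measurable lborel"
    and int: "set_integrable lborel {0..T} (\<lambda>t. norm (D t))"
  obtains G where "\<And>t V. t \<in> {0..T} \<Longrightarrow> G t \<bullet> V = (LINT s:{0..t}|lborel. D s \<bullet> V)"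
    and "\<And>a b. 0 \<le> a \<Longrightarrow> a \<le> b \<Longrightarrow> b \<le> T \<Longrightarrow> norm (G b - G a) \<le> (LINT s:{a..b}|lborel. norm (D s))"
    and "\<And>V a b. 0 \<le> a \<Longrightarrow> b \<le> T \<Longrightarrow> set_integrable lborel {a..b} (\<lambda>t. D t \<bullet> V)"
    and "G 0 = 0"
proof -
  have meas[measurable]: "(\<lambda>s. D s \<bullet> V) \<in> borel_measurable lborel" for V
    by (rule measurable_compose[OF assms(1), of "\<lambda>x. x \<bullet> V"])
      (intro borel_measurable_continuous_onI continuous_intros)
  have si: "set_integrable lborel {a..b} (\<lambda>t. D t \<bullet> V)" "set_integrable lborel {a..b} (\<lambda>t. norm (D t))"
    if "0 \<le> a" "b \<le> T" for V a b
  proof -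
    show i: "set_integrable lborel {a..b} (\<lambda>t. norm (D t))"
      by (rule set_integrable_subset[OF int]) (use that in auto)
    then have "set_integrable lborel {a..b} (\<lambda>t. norm (D t) * norm V)"
      by (rule set_integrable_mult_left)
    then show "set_integrable lborel {a..b} (\<lambda>t. D t \<bullet> V)"
      unfolding set_integrable_def
      by (rule Bochner_Integration.integrable_bound)
         (auto simp: indicator_def Cauchy_Schwarz_ineq2)
  qed
  have bound: "\<bar>LINT s:{a..b}|lborel. D s \<bullet> V\<bar> \<le> norm V * (LINT s:{a..b}|lborel. norm (D s))"
    if "0 \<le> a" "b \<le> T" for a b V
  proof -
    have "\<bar>LINT s:{a..b}|lborel. D s \<bullet> V\<bar> \<le> (LINT s:{a..b}|lborel. \<bar>D s \<bullet> V\<bar>)"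
      using set_integral_norm_bound[OF si(1)[OF that, of V]] by simp
    also have "\<dots> \<le> (LINT s:{a..b}|lborel. norm V * norm (D s))"
    proof (rule set_integral_mono)
      show "\<bar>D s \<bullet> V\<bar> \<le> norm V * norm (D s)" for s
        using Cauchy_Schwarz_ineq2[of "D s" V] by (simp add: mult.commute)
    qed (intro set_integrable_abs set_integrable_mult_right si that)+
    finally show ?thesis by simp
  qed
  have "\<exists>g. \<forall>V. (LINT s:{0..t}|lborel. D s \<bullet> V) = g \<bullet> V" if "t \<in> {0..T}" for t
  proof (rule riesz_representation, rule bounded_linear_intro)
    show "(LINT s:{0..t}|lborel. D s \<bullet> (V + W)) = (LINT s:{0..t}|lborel. D s \<bullet> V) + (LINT s:{0..t}|lborel. D s \<bullet> W)" for V W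
      using si(1)[of 0 t] that by (simp add: inner_add_right set_integral_add)
    show "(LINT s:{0..t}|lborel. D s \<bullet> (r *\<^sub>R V)) = r *\<^sub>R (LINT s:{0..t}|lborel. D s \<bullet> V)" for r V
      by simp
    show "norm (LINT s:{0..t}|lborel. D s \<bullet> V) \<le> norm V * (LINT s:{0..t}|lborel. norm (D s))" for V
      using bound[of 0 t V] that by simp
  qed
  then obtain G where G: "\<And>t V. t \<in> {0..T} \<Longrightarrow> (LINT s:{0..t}|lborel. D s \<bullet> V) = G t \<bullet> V"
    by metis
  show ?thesis
  proof (rule that[of "\<lambda>t. if t = 0 then 0 else G t"])
    have G0: "G 0 = 0" if "0 \<le> T"
      using G[of 0 "G 0"] that by (simp add: set_integral_lborel_singleton)
    show "(if t = 0 then 0 else G t) \<bullet> V = (LINT s:{0..t}|lborel. D s \<bullet> V)" if "t \<in> {0..T}" for t V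
      using G[OF that, of V] G0 that by auto
    show "norm ((if b = 0 then 0 else G b) - (if a = 0 then 0 else G a)) \<le> (LINT s:{a..b}|lborel. norm (D s))"
      if "0 \<le> a" "a \<le> b" "b \<le> T" for a b
    proof -
      let ?d = "G b - G a"
      have "norm ?d * norm ?d = ?d \<bullet> ?d" by (simp add: power2_norm_eq_inner flip: power2_eq_square)
      also have "\<dots> = G b \<bullet> ?d - G a \<bullet> ?d" by (rule inner_diff_left)
      also have "\<dots> = (LINT s:{a..b}|lborel. D s \<bullet> ?d)"
        using that G[of a ?d] G[of b ?d] set_integral_Icc_split[OF si(1)[of 0 b ?d], of a] by simp
      also have "\<dots> \<le> norm ?d * (LINT s:{a..b}|lborel. norm (D s))"
        using bound[of a b ?d] that by simp
      finally have "norm ?d \<le> (LINT s:{a..b}|lborel. norm (D s))"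
        by (cases "?d = 0") (auto simp: set_lebesgue_integral_def)
      then show ?thesis using G0 that by (cases "a = 0"; cases "b = 0") auto
    qed
  qed (use si(1) in auto)
qed

text \<open>
  The integral of \<open>\<langle>G, G'\<rangle>\<close> is \<open>\<bar>G(T)\<bar>\<^sup>2 / 2\<close>.  Only the inequality needed later is derived: on an interval
  \<open>[a,b]\<close> one replaces \<open>G(t)\<close> by \<open>G(a)\<close> and compares with the increment of \<open>\<bar>G\<bar>\<^sup>2 / 2\<close>, with an error
  of at most \<open>(b - a) \<integral> \<bar>D\<bar>\<^sup>2\<close> up to a constant.  The function \<open>P\<close> is a continuous version of
  \<open>\<langle>G, D\<rangle>\<close>; it spares a discussion of the measurability of this inner product.
\<close>

lemma energy_nonneg:
  fixes D G :: "real \<Rightarrow> 'h::{real_inner, complete_space}"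
  assumes "0 \<le> T"
    and Dm[measurable]: "D \<in> borel_measurable lborel"
    and int2: "set_integrable lborel {0..T} (\<lambda>t. (norm (D t))\<^sup>2)"
    and int: "set_integrable lborel {0..T} (\<lambda>t. norm (D t))"
    and G: "\<And>t V. t \<in> {0..T} \<Longrightarrow> G t \<bullet> V = (LINT s:{0..t}|lborel. D s \<bullet> V)"
    and Gd: "\<And>a b. 0 \<le> a \<Longrightarrow> a \<le> b \<Longrightarrow> b \<le> T \<Longrightarrow> norm (G b - G a) \<le> (LINT s:{a..b}|lborel. norm (D s))"
    and Di: "\<And>V a b. 0 \<le> a \<Longrightarrow> b \<le> T \<Longrightarrow> set_integrable lborel {a..b} (\<lambda>t. D t \<bullet> V)"
    and G0: "G 0 = 0"
    and P: "continuous_on {0..T} P"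
    and PG: "AE t\<in>{0..T} in lborel. P t = G t \<bullet> D t"
  shows "0 \<le> (LINT t:{0..T}|lborel. P t)"
proof -
  define q where "q t = (LINT s:{0..t}|lborel. P s) - (norm (G t))\<^sup>2 / 2" for t
  \<comment> \<open>Freezing \<open>G\<close> at \<open>a\<close> costs \<open>I\<^sup>2\<close>, and the quadratic term in the increment of \<open>\<bar>G\<bar>\<^sup>2 / 2\<close> costs \<open>I\<^sup>2 / 2\<close>,
    where \<open>I\<close> is the integral of \<open>\<bar>D\<bar>\<close> over \<open>[a,b]\<close>.\<close>
  define K where "K t = 3/2 * (LINT s:{0..t}|lborel. (norm (D s))\<^sup>2)" for t
  have split: "(LINT s:{0..b}|lborel. h s) = (LINT s:{0..a}|lborel. h s) + (LINT s:{a..b}|lborel. h s)"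
    if h: "set_integrable lborel {0..T} h" and "0 \<le> a" "a \<le> b" "b \<le> T" for a b and h :: "real \<Rightarrow> real"
    by (rule set_integral_Icc_split) (use that in \<open>auto intro: set_integrable_subset[OF h]\<close>)
  have Pi: "set_integrable lborel {0..T} P"
    using borel_integrable_atLeastAtMost'[OF P] .
  have "q 0 \<le> q T"
  proof (rule increment_bound_imp_le[of T q K])
    fix a b assume ab: "0 \<le> a" "a \<le> b" "b \<le> T"
    define I where "I = (LINT s:{a..b}|lborel. norm (D s))"
    have sub: "set_integrable lborel {a..b} h" if "set_integrable lborel {0..T} h" for h :: "real \<Rightarrow> real"
      by (rule set_integrable_subset[OF that]) (use ab in auto)
    have I0: "0 \<le> I" unfolding I_def set_lebesgue_integral_def by simp
    have I2: "I\<^sup>2 \<le> (b - a) * (LINT s:{a..b}|lborel. (norm (D s))\<^sup>2)"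
      unfolding I_def by (intro set_integral_Cauchy_Schwarz_one sub int int2 ab)
    have "(LINT t:{a..b}|lborel. G a \<bullet> D t - I * norm (D t)) \<le> (LINT t:{a..b}|lborel. P t)"
    proof (rule set_integral_mono_AE)
      show "set_integrable lborel {a..b} (\<lambda>t. G a \<bullet> D t - I * norm (D t))"
        using Di[of a b "G a"] ab
        by (intro set_integral_diff(1) set_integrable_mult_right sub[OF int]) (auto simp: inner_commute)
      show "set_integrable lborel {a..b} P" by (rule sub[OF Pi])
      show "AE t\<in>{a..b} in lborel. G a \<bullet> D t - I * norm (D t) \<le> P t"
        using PG
      proof eventually_elim
        case (elim t)
        show ?case
        proof
          assume t: "t \<in> {a..b}"
          then have Pt: "P t = G a \<bullet> D t + (G t - G a) \<bullet> D t"
            using elim ab by (simp add: inner_diff_left)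
          have "norm (G t - G a) \<le> (LINT s:{a..t}|lborel. norm (D s))" using Gd t ab by simp
          also have "\<dots> \<le> I"
            using set_integral_Icc_split[OF sub[OF int], of t] t
            by (simp add: I_def set_lebesgue_integral_def)
          finally have "\<bar>(G t - G a) \<bullet> D t\<bar> \<le> I * norm (D t)"
            using Cauchy_Schwarz_ineq2[of "G t - G a" "D t"] mult_right_mono[of _ I "norm (D t)"]
            by (meson norm_ge_zero order_trans)
          then show "G a \<bullet> D t - I * norm (D t) \<le> P t" unfolding Pt by linarith
        qed
      qed
    qed
    also have "(LINT t:{a..b}|lborel. G a \<bullet> D t - I * norm (D t))
        = (LINT t:{a..b}|lborel. G a \<bullet> D t) - I * I"
      unfolding I_def[symmetric] using Di[of a b "G a"] ab
      by (subst set_integral_diff(2)) (auto intro!: set_integrable_mult_right sub int simp: inner_commute I_def)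
    also have "(LINT t:{a..b}|lborel. G a \<bullet> D t) = G b \<bullet> G a - G a \<bullet> G a"
      using split[of "\<lambda>s. D s \<bullet> G a" a b] Di[of 0 T "G a"] G[of a "G a"] G[of b "G a"] ab
      by (simp add: inner_commute)
    finally have 1: "G b \<bullet> G a - G a \<bullet> G a - I\<^sup>2 \<le> (LINT t:{a..b}|lborel. P t)"
      by (simp add: power2_eq_square)
    have "(norm (G b - G a))\<^sup>2 \<le> I\<^sup>2"
      using Gd[OF ab] unfolding I_def by (intro power_mono) auto
    then have "2 * (G b \<bullet> G a) \<ge> (norm (G b))\<^sup>2 + (norm (G a))\<^sup>2 - I\<^sup>2"
      by (simp add: power2_norm_eq_inner inner_diff_left inner_diff_right inner_commute)
    with 1 have 2: "(norm (G b))\<^sup>2 / 2 - (norm (G a))\<^sup>2 / 2 - 3/2 * I\<^sup>2 \<le> (LINT t:{a..b}|lborel. P t)"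
      unfolding power2_norm_eq_inner[symmetric] by linarith
    have "q b - q a = (LINT t:{a..b}|lborel. P t) - ((norm (G b))\<^sup>2 / 2 - (norm (G a))\<^sup>2 / 2)"
      unfolding q_def split[OF Pi ab] by simp
    moreover have "K b - K a = 3/2 * (LINT s:{a..b}|lborel. (norm (D s))\<^sup>2)"
      unfolding K_def split[OF int2 ab] by (simp add: algebra_simps)
    then have "(b - a) * (K b - K a) = 3/2 * ((b - a) * (LINT s:{a..b}|lborel. (norm (D s))\<^sup>2))"
      by simp
    ultimately show "q a - (b - a) * (K b - K a) \<le> q b"
      using 2 I2 by linarith
  qed fact
  moreover have "q 0 = 0"
    by (simp add: q_def G0 set_integral_lborel_singleton)
  ultimately have "(norm (G T))\<^sup>2 / 2 \<le> (LINT t:{0..T}|lborel. P t)" by (simp add: q_def)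
  moreover have "0 \<le> (norm (G T))\<^sup>2 / 2" by simp
  ultimately show ?thesis by linarith
qed

section \<open>The primitive of the source\<close>

text \<open>
  A cylinder over a null set is a null set.
\<close>

lemma AE_lborel_fst:
  fixes P :: "'a::euclidean_space \<Rightarrow> bool"
  assumes "AE x in lborel. P x"
  shows "AE z in (lborel :: ('a \<times> 'b::euclidean_space) measure). P (fst z)"
proof -
  obtain N where N: "{x \<in> space lborel. \<not> P x} \<subseteq> N" "emeasure lborel N = 0" "N \<in> sets lborel"
    using AE_E[OF assms] by blast
  have [measurable]: "N \<in> sets borel" using N(3) by simp
  have "AE z in (lborel :: 'a measure) \<Otimes>\<^sub>M (lborel :: 'b measure). fst z \<notin> N"
  proof (rule lborel_pair.AE_pair_measure)
    show "{z \<in> space (lborel \<Otimes>\<^sub>M lborel). fst z \<notin> N} \<in> sets (lborel \<Otimes>\<^sub>M lborel)"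
      by measurable
    have "AE x in lborel. x \<notin> N" by (rule AE_not_in) (use N in auto)
    then show "AE x in lborel. AE y in lborel. fst (x, y) \<notin> N"
      by eventually_elim simp
  qed
  then show ?thesis
    unfolding lborel_prod by eventually_elim (use N(1) in auto)
qed

lemma cylinder_measurable [measurable]:
  fixes g :: "'a::euclidean_space \<Rightarrow> real"
  assumes [measurable]: "g \<in> borel_measurable lborel"
  shows "(\<lambda>z::'a \<times> 'b::euclidean_space. g (fst z)) \<in> borel_measurable lborel"
  unfolding lborel_prod[symmetric] by measurable

lemma cylinder_square_integral:
  fixes g :: "'a::euclidean_space \<Rightarrow> real" and A :: "real set"
  assumes g: "square_integrable g" and S: "S \<in> sets borel" "A \<in> sets borel"
    and a: "emeasure lborel A \<le> ennreal a" "0 \<le> a"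
  shows "square_integrable (\<lambda>z. indicator (S \<times> A) z * g (fst z))"
    and "(LINT z|lborel. (indicator (S \<times> A) z * g (fst z))\<^sup>2) \<le> a * (LINT x|lborel. (g x)\<^sup>2)"
proof -
  have [measurable]: "g \<in> borel_measurable lborel" and gi: "integrable lborel (\<lambda>x. (g x)\<^sup>2)"
    using g by (auto simp: square_integrable_def)
  have [measurable]: "S \<times> A \<in> sets lborel" "A \<in> sets lborel" using S by (auto intro: borel_Times)
  have "(\<integral>\<^sup>+z. ennreal ((indicator (S \<times> A) z * g (fst z))\<^sup>2) \<partial>lborel)
      \<le> (\<integral>\<^sup>+z. ennreal ((g (fst z))\<^sup>2) * indicator A (snd z) \<partial>(lborel \<Otimes>\<^sub>M lborel))"
    unfolding lborel_prod by (intro nn_integral_mono) (auto simp: indicator_def)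
  also have "\<dots> = (\<integral>\<^sup>+x. \<integral>\<^sup>+t. ennreal ((g x)\<^sup>2) * indicator A t \<partial>lborel \<partial>lborel)"
    by (subst lborel.nn_integral_fst[symmetric]) auto
  also have "\<dots> = (\<integral>\<^sup>+x. ennreal ((g x)\<^sup>2) * emeasure lborel A \<partial>lborel)"
    using S by (simp add: nn_integral_cmult_indicator)
  also have "\<dots> = (\<integral>\<^sup>+x. ennreal ((g x)\<^sup>2) \<partial>lborel) * emeasure lborel A"
    by (rule nn_integral_multc) measurable
  also have "\<dots> \<le> ennreal (LINT x|lborel. (g x)\<^sup>2) * ennreal a"
    using gi a(1) by (intro mult_mono) (auto simp: nn_integral_eq_integral)
  also have "\<dots> = ennreal (a * (LINT x|lborel. (g x)\<^sup>2))"
    using a(2) by (subst ennreal_mult[symmetric]) (auto simp: mult.commute)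
  finally have le: "(\<integral>\<^sup>+z. ennreal ((indicator (S \<times> A) z * g (fst z))\<^sup>2) \<partial>lborel)
     \<le> ennreal (a * (LINT x|lborel. (g x)\<^sup>2))" .
  have m[measurable]: "(\<lambda>z. indicator (S \<times> A) z * g (fst z)) \<in> borel_measurable lborel" by measurable
  have i: "integrable lborel (\<lambda>z. (indicator (S \<times> A) z * g (fst z))\<^sup>2)"
  proof (rule integrableI_nonneg)
    show "(\<integral>\<^sup>+z. ennreal ((indicator (S \<times> A) z * g (fst z))\<^sup>2) \<partial>lborel) < \<infinity>"
      using le by (rule le_less_trans) simp
  qed auto
  then show "square_integrable (\<lambda>z. indicator (S \<times> A) z * g (fst z))"
    by (simp add: square_integrable_def m)
  show "(LINT z|lborel. (indicator (S \<times> A) z * g (fst z))\<^sup>2) \<le> a * (LINT x|lborel. (g x)\<^sup>2)"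
    using le a(2) by (subst (asm) nn_integral_eq_integral[OF i]) (auto simp: ennreal_le_iff)
qed

lemma cylinder_pairing:
  fixes f :: "('a::euclidean_space \<times> real) L2" and v :: "'a L2"
  assumes S: "S \<in> sets borel" "A \<in> sets borel"
    and a: "emeasure lborel A \<le> ennreal a" "0 \<le> a"
  shows "set_integrable lborel (S \<times> A) (\<lambda>z. fun_of f z * fun_of v (fst z))"
    and "\<bar>LINT z:S \<times> A|lborel. fun_of f z * fun_of v (fst z)\<bar> \<le> sqrt a * norm f * norm v"
proof -
  let ?h = "\<lambda>z. indicator (S \<times> A) z * fun_of v (fst z)"
  note h = cylinder_square_integral[OF square_integrable_fun_of S a, of v]
  have eq: "(\<lambda>z. ?h z * fun_of f z) = (\<lambda>z. indicator (S \<times> A) z *\<^sub>R (fun_of f z * fun_of v (fst z)))"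
    by (simp add: fun_eq_iff mult.assoc mult.commute[of "fun_of v _"])
  have "integrable lborel (\<lambda>z. ?h z * fun_of f z)"
    by (rule square_integrable_mult[OF h(1) square_integrable_fun_of])
  then show "set_integrable lborel (S \<times> A) (\<lambda>z. fun_of f z * fun_of v (fst z))"
    unfolding set_integrable_def eq .
  have "(norm (L2_of ?h))\<^sup>2 \<le> a * (norm v)\<^sup>2"
    using h(2) unfolding norm_L2_of[OF h(1)] norm_fun_of[of v] .
  also have "\<dots> = (sqrt a * norm v)\<^sup>2" using a(2) by (simp add: power_mult_distrib)
  finally have n: "norm (L2_of ?h) \<le> sqrt a * norm v"
    by (rule power2_le_imp_le) (use a(2) in simp)
  have "(LINT z:S \<times> A|lborel. fun_of f z * fun_of v (fst z)) = L2_of ?h \<bullet> f"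
    unfolding inner_L2_L2_of[OF h(1)] set_lebesgue_integral_def eq ..
  also have "\<bar>\<dots>\<bar> \<le> norm (L2_of ?h) * norm f" by (rule Cauchy_Schwarz_ineq2)
  also have "\<dots> \<le> (sqrt a * norm v) * norm f" by (rule mult_right_mono[OF n]) simp
  finally show "\<bar>LINT z:S \<times> A|lborel. fun_of f z * fun_of v (fst z)\<bar> \<le> sqrt a * norm f * norm v"
    by (simp add: mult.assoc mult.commute[of "norm v"])
qed

text \<open>
  The function \<open>F\<close> is the time primitive of the source.  As the source is square integrable in time, \<open>F\<close> is
  Hoelder continuous with exponent one half.
\<close>

lemma accumulated_source_exists:
  fixes f :: "('a::euclidean_space \<times> real) L2"
  assumes S: "S \<in> sets borel"
  obtains F where "\<And>t v. 0 \<le> t \<Longrightarrow> F t \<bullet> v = (LINT z:S \<times> {0<..<t}|lborel. fun_of f z * fun_of v (fst z))"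
    and "\<And>s t. 0 \<le> s \<Longrightarrow> s \<le> t \<Longrightarrow> norm (F t - F s) \<le> sqrt (t - s) * norm f"
    and "F 0 = 0"
proof -
  have em: "emeasure lborel {0<..<t} \<le> ennreal t" if "0 \<le> t" for t :: real using that by simp
  have "\<exists>g. \<forall>v. (LINT z:S \<times> {0<..<t}|lborel. fun_of f z * fun_of v (fst z)) = g \<bullet> v" if t: "0 \<le> t" for t
  proof (rule riesz_representation, rule bounded_linear_intro)
    note p = cylinder_pairing[OF S _ em[OF t] t, of f]
    let ?l = "\<lambda>v. LINT z:S \<times> {0<..<t}|lborel. fun_of f z * fun_of v (fst z)"
    have [measurable]: "S \<times> {0<..<t} \<in> sets borel" using S by (auto intro: borel_Times)
    show "?l (v + w) = ?l v + ?l w" for v w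
    proof -
      have "?l v + ?l w = (LINT z:S \<times> {0<..<t}|lborel. fun_of f z * fun_of v (fst z) + fun_of f z * fun_of w (fst z))"
        by (rule set_integral_add(2)[symmetric]) (auto intro: p)
      also have "\<dots> = ?l (v + w)"
      proof (rule set_lebesgue_integral_cong_AE)
        show "AE z\<in>S \<times> {0<..<t} in lborel. fun_of f z * fun_of v (fst z) + fun_of f z * fun_of w (fst z)
            = fun_of f z * fun_of (v + w) (fst z)"
          using AE_lborel_fst[OF fun_of_add[of v w]] by (auto simp: distrib_left)
      qed measurable
      finally show ?thesis by (rule sym)
    qed
    show "?l (c *\<^sub>R v) = c *\<^sub>R ?l v" for c v
    proof -
      have "?l (c *\<^sub>R v) = (LINT z:S \<times> {0<..<t}|lborel. c * (fun_of f z * fun_of v (fst z)))"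
      proof (rule set_lebesgue_integral_cong_AE)
        show "AE z\<in>S \<times> {0<..<t} in lborel. fun_of f z * fun_of (c *\<^sub>R v) (fst z)
            = c * (fun_of f z * fun_of v (fst z))"
          using AE_lborel_fst[OF fun_of_scaleR[of c v]]
        proof eventually_elim
          case (elim z)
          show ?case unfolding elim by (simp only: mult.left_commute simp_thms)
        qed
      qed measurable
      also have "\<dots> = c * ?l v" by (rule set_integral_mult_right)
      finally show ?thesis by (simp only: real_scaleR_def)
    qed
    show "norm (?l v) \<le> norm v * (sqrt t * norm f)" for v
    proof -
      have "norm (?l v) \<le> (sqrt t * norm f) * norm v" using p(2)[of v] by simp
      then show ?thesis by (simp only: mult.commute)
    qed
  qed
  note ex = this
  define F where "F t = (SOME g. \<forall>v. (LINT z:S \<times> {0<..<t}|lborel. fun_of f z * fun_of v (fst z)) = g \<bullet> v)" for t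
  have F: "(LINT z:S \<times> {0<..<t}|lborel. fun_of f z * fun_of v (fst z)) = F t \<bullet> v" if "0 \<le> t" for t v
    using someI_ex[OF ex[OF that]] unfolding F_def by (rule spec)
  have Fd: "norm (F t - F s) \<le> sqrt (t - s) * norm f" if st: "0 \<le> s" "s \<le> t" for s t
  proof -
    \<comment> \<open>The half-open interval from \<open>s\<close> to \<open>t\<close>, in a form that also covers \<open>s = 0\<close>.\<close>
    define A where "A = {0<..<t} - {0<..<s}"
    have A: "A \<in> sets borel" "emeasure lborel A \<le> ennreal (t - s)"
    proof -
      have "emeasure lborel A \<le> emeasure lborel {s..t}"
        by (rule emeasure_mono) (auto simp: A_def)
      then show "emeasure lborel A \<le> ennreal (t - s)" using st by simp
    qed (simp add: A_def)
    have Aeq: "S \<times> {0<..<t} = S \<times> {0<..<s} \<union> S \<times> A" using st by (auto simp: A_def)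
    let ?d = "F t - F s"
    have "F t \<bullet> ?d = F s \<bullet> ?d + (LINT z:S \<times> A|lborel. fun_of f z * fun_of ?d (fst z))"
      unfolding F[symmetric, OF st(1)] F[symmetric, OF order_trans[OF st]] Aeq
    proof (rule set_integral_Un)
      show "S \<times> {0<..<s} \<inter> S \<times> A = {}" by (auto simp: A_def)
      show "set_integrable lborel (S \<times> {0<..<s}) (\<lambda>z. fun_of f z * fun_of ?d (fst z))"
        by (rule cylinder_pairing(1)[OF S _ em[OF st(1)] st(1)]) simp
      show "set_integrable lborel (S \<times> A) (\<lambda>z. fun_of f z * fun_of ?d (fst z))"
        by (rule cylinder_pairing(1)[OF S A]) (use st in simp)
    qed
    then have "?d \<bullet> ?d = (LINT z:S \<times> A|lborel. fun_of f z * fun_of ?d (fst z))"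
      by (simp add: inner_diff_left)
    also have "\<dots> \<le> sqrt (t - s) * norm f * norm ?d"
      using cylinder_pairing(2)[OF S A, of f ?d] st by simp
    finally have "norm ?d * norm ?d \<le> (sqrt (t - s) * norm f) * norm ?d"
      by (simp add: power2_norm_eq_inner flip: power2_eq_square)
    then show ?thesis
      by (cases "?d = 0") (use st in auto)
  qed
  have "F 0 \<bullet> F 0 = 0"
    using F[of 0 "F 0"] by (simp add: set_lebesgue_integral_def)
  then have "F 0 = 0" by simp
  show ?thesis
  proof (rule that)
    show "F t \<bullet> v = (LINT z:S \<times> {0<..<t}|lborel. fun_of f z * fun_of v (fst z))" if "0 \<le> t" for t v
      using F[OF that] by simp
  qed (fact Fd, fact)
qed

section \<open>Weak solutions as integral equations\<close>

text \<open>
  All that is used of the heat equation: a scalar integral equation for each test function, in which the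
  gradient has disappeared, and a bound in \<open>L\<^sup>2(\<Omega> \<times> (0,T))\<close> that depends on \<open>T\<close> only.  The bound results from using \<open>y(t)\<close>
  itself as the test function at almost every time \<open>t\<close>, together with the sign of the gradient term.
\<close>

lemma heat_solution_estimates:
  fixes \<Omega> :: "(real^'n) set"
  assumes heat: "heat_solution \<Omega> T f 0 y" and \<Omega>: "\<Omega> \<in> sets borel" and T: "0 \<le> T" and f: "norm f \<le> 1"
  obtains F where "\<And>s t. 0 \<le> s \<Longrightarrow> s \<le> t \<Longrightarrow> t \<le> T \<Longrightarrow> norm (F t - F s) \<le> sqrt (t - s)" "F 0 = 0"
    "\<And>v t. test_function \<Omega> v \<Longrightarrow> t \<in> {0..T} \<Longrightarrow>
        y t \<bullet> L2_of v = F t \<bullet> L2_of v + integral {0..t} (\<lambda>s. y s \<bullet> L2_of (laplacian v))"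
    "integral {0..T} (\<lambda>s. (norm (y s))\<^sup>2) \<le> T\<^sup>2"
proof -
  have y: "continuous_on {0..T} y" using heat by (simp add: heat_solution_def)
  from heat obtain Dy where Dm[measurable]: "Dy \<in> borel_measurable lborel"
    and D2: "set_integrable lborel {0..T} (\<lambda>t. (norm (Dy t))\<^sup>2)"
    and graph: "AE t\<in>{0..T} in lborel. (y t, Dy t) \<in> H10_graph \<Omega>"
    and weak_all: "\<forall>t\<in>{0..T}. \<forall>(v, Dv) \<in> H10_graph \<Omega>.
       inner (y t) v + (LINT s:{0..t}|lborel. inner (Dy s) Dv)
         = inner 0 v + (LINT z:\<Omega> \<times> {0<..<t}|lborel. fun_of f z * fun_of v (fst z))"
    unfolding heat_solution_def by blast
  have weak: "inner (y t) v + (LINT s:{0..t}|lborel. inner (Dy s) Dv)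
         = (LINT z:\<Omega> \<times> {0<..<t}|lborel. fun_of f z * fun_of v (fst z))"
    if "t \<in> {0..T}" "(v, Dv) \<in> H10_graph \<Omega>" for t v Dv
    using bspec[OF bspec[OF weak_all that(1)] that(2)] by simp
  have D1: "set_integrable lborel {0..T} (\<lambda>t. norm (Dy t))"
  proof -
    have "set_integrable lborel {0..T} (\<lambda>t. 1 + (norm (Dy t))\<^sup>2)"
      by (intro set_integral_add(1) D2 borel_integrable_atLeastAtMost' continuous_intros)
    then show ?thesis
      unfolding set_integrable_def
    proof (rule Bochner_Integration.integrable_bound)
      have "x \<le> 1 + x\<^sup>2" if "0 \<le> x" for x :: real
        using zero_le_power2[of "x - 1"] that by (simp add: power2_diff)
      then show "AE t in lborel. norm (indicator {0..T} t *\<^sub>R norm (Dy t))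
          \<le> norm (indicator {0..T} t *\<^sub>R (1 + (norm (Dy t))\<^sup>2))"
        by (auto simp: indicator_def)
    qed measurable
  qed
  obtain G where G: "\<And>t V. t \<in> {0..T} \<Longrightarrow> G t \<bullet> V = (LINT s:{0..t}|lborel. Dy s \<bullet> V)"
    and Gd: "\<And>a b. 0 \<le> a \<Longrightarrow> a \<le> b \<Longrightarrow> b \<le> T \<Longrightarrow> norm (G b - G a) \<le> (LINT s:{a..b}|lborel. norm (Dy s))"
    and Di: "\<And>V a b. 0 \<le> a \<Longrightarrow> b \<le> T \<Longrightarrow> set_integrable lborel {a..b} (\<lambda>t. Dy t \<bullet> V)"
    and G0: "G 0 = 0"
  proof (rule weak_integral_exists[OF Dm D1], goal_cases)
    case (1 G)
    from 1(2-5) show thesis by (rule 1(1))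
  qed
  obtain F where F: "\<And>t v. 0 \<le> t \<Longrightarrow> F t \<bullet> v = (LINT z:\<Omega> \<times> {0<..<t}|lborel. fun_of f z * fun_of v (fst z))"
    and Fd: "\<And>s t. 0 \<le> s \<Longrightarrow> s \<le> t \<Longrightarrow> norm (F t - F s) \<le> sqrt (t - s) * norm f"
    and F0: "F 0 = 0"
  proof (rule accumulated_source_exists[OF \<Omega>, of f], goal_cases)
    case (1 F)
    from 1(2-4) show thesis by (rule 1(1))
  qed
  have Fd': "norm (F t - F s) \<le> sqrt (t - s)" if "0 \<le> s" "s \<le> t" for s t
    using Fd[OF that] mult_left_mono[OF f, of "sqrt (t - s)"] that by simp
  have Fcont: "continuous_on {0..T} F"
  proof (rule continuous_onI)
    fix s e :: real assume s: "s \<in> {0..T}" and "e > 0"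
    have "dist (F t) (F s) \<le> e" if "t \<in> {0..T}" "dist t s < e\<^sup>2" for t
    proof -
      have "dist (F t) (F s) \<le> sqrt \<bar>t - s\<bar>"
        using Fd'[of s t] Fd'[of t s] s that(1)
        by (cases "s \<le> t") (auto simp: dist_norm norm_minus_commute)
      also have "\<dots> \<le> sqrt (e\<^sup>2)"
        using that(2) by (intro real_sqrt_le_mono) (simp add: dist_real_def)
      finally show ?thesis using \<open>e > 0\<close> by simp
    qed
    then show "\<exists>d>0. \<forall>t\<in>{0..T}. dist t s < d \<longrightarrow> dist (F t) (F s) \<le> e"
      using \<open>e > 0\<close> by (intro exI[of _ "e\<^sup>2"]) auto
  qed
  \<comment> \<open>By the equation tested with \<open>y t\<close>, this is the gradient term \<open>\<langle>G t, Dy t\<rangle>\<close> for almost all \<open>t\<close>.\<close>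
  define P where "P t = (F t - y t) \<bullet> y t" for t
  have Pc: "continuous_on {0..T} P"
    unfolding P_def by (intro continuous_intros Fcont y)
  have "AE t\<in>{0..T} in lborel. P t = G t \<bullet> Dy t"
    using graph
  proof eventually_elim
    case (elim t)
    show ?case
    proof
      assume t: "t \<in> {0..T}"
      then have "(y t, Dy t) \<in> H10_graph \<Omega>" using elim by blast
      from weak[OF t this] show "P t = G t \<bullet> Dy t"
        using G[OF t, of "Dy t"] F[of t "y t"] t by (simp add: P_def inner_diff_left)
    qed
  qed
  from energy_nonneg[OF T Dm D2 D1 G Gd Di G0 Pc this]
  have "0 \<le> (LINT t:{0..T}|lborel. P t)" by simp
  also have "\<dots> = integral {0..T} P"
    by (rule set_borel_integral_eq_integral(2)[OF borel_integrable_atLeastAtMost'[OF Pc]])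
  also have "\<dots> \<le> integral {0..T} (\<lambda>t. T / 2 - (norm (y t))\<^sup>2 / 2)"
  proof (rule integral_le)
    fix t assume t: "t \<in> {0..T}"
    have "norm (F t) \<le> sqrt T"
      using Fd'[of 0 t] t F0 by (auto intro: order_trans real_sqrt_le_mono)
    then have "(norm (F t))\<^sup>2 \<le> (sqrt T)\<^sup>2" by (intro power_mono) auto
    moreover have "0 \<le> (norm (F t - y t))\<^sup>2" by simp
    then have "2 * (F t \<bullet> y t) \<le> (norm (F t))\<^sup>2 + (norm (y t))\<^sup>2"
      by (simp add: power2_norm_eq_inner inner_diff_left inner_diff_right inner_commute)
    ultimately show "P t \<le> T / 2 - (norm (y t))\<^sup>2 / 2"
      using T by (simp add: P_def inner_diff_left power2_norm_eq_inner[symmetric])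
  qed (auto intro!: integrable_continuous_real continuous_intros y Pc)
  also have "\<dots> = T\<^sup>2 / 2 - integral {0..T} (\<lambda>t. (norm (y t))\<^sup>2) / 2"
    using T by (subst integral_diff)
      (auto intro!: integrable_continuous_real continuous_intros y simp: power2_eq_square)
  finally have E: "integral {0..T} (\<lambda>s. (norm (y s))\<^sup>2) \<le> T\<^sup>2" by simp
  have eq: "y t \<bullet> L2_of v = F t \<bullet> L2_of v + integral {0..t} (\<lambda>s. y s \<bullet> L2_of (laplacian v))"
    if v: "test_function \<Omega> v" and t: "t \<in> {0..T}" for v t
  proof -
    have yc: "continuous_on {0..t} (\<lambda>s. y s \<bullet> L2_of (laplacian v))"
      using t by (intro continuous_intros continuous_on_subset[OF y]) auto
    have "(LINT s:{0..t}|lborel. Dy s \<bullet> grad_L2 v) = (LINT s:{0..t}|lborel. - (y s \<bullet> L2_of (laplacian v)))"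
      unfolding set_lebesgue_integral_def
    proof (rule integral_cong_AE)
      show "AE s in lborel. indicator {0..t} s *\<^sub>R (Dy s \<bullet> grad_L2 v)
          = indicator {0..t} s *\<^sub>R (- (y s \<bullet> L2_of (laplacian v)))"
        using graph
      proof eventually_elim
        case (elim s)
        show ?case
        proof (cases "s \<in> {0..t}")
          case True
          then have "(y s, Dy s) \<in> H10_graph \<Omega>" using elim t by auto
          from H10_graph_green[OF this v] show ?thesis by simp
        qed simp
      qed
      show "(\<lambda>s. indicator {0..t} s *\<^sub>R (Dy s \<bullet> grad_L2 v)) \<in> borel_measurable lborel"
        using Di[of 0 t "grad_L2 v"] t unfolding set_integrable_def by auto
      show "(\<lambda>s. indicator {0..t} s *\<^sub>R (- (y s \<bullet> L2_of (laplacian v)))) \<in> borel_measurable lborel"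
        using borel_integrable_atLeastAtMost'[OF continuous_on_minus[OF yc]]
        unfolding set_integrable_def by (rule borel_measurable_integrable)
    qed
    also have "\<dots> = - integral {0..t} (\<lambda>s. y s \<bullet> L2_of (laplacian v))"
      using set_borel_integral_eq_integral(2)[OF borel_integrable_atLeastAtMost'[OF continuous_on_minus[OF yc]]]
      by simp
    finally show ?thesis
      using weak[OF t H10_graph_test_function[OF v]] F[of t "L2_of v"] t by simp
  qed
  show ?thesis by (rule that[of F]) (use Fd' F0 eq E in auto)
qed

section \<open>Decay against high frequencies\<close>

text \<open>
  Duhamel's formula for \<open>g' = -\<mu> g + \<langle>F', v\<rangle> + \<langle>y, r\<rangle>\<close>, where \<open>g = \<langle>y, v\<rangle>\<close>, as an estimate.  The
  derivative of \<open>F\<close> is not available, so the function that is differentiated is \<open>g - \<langle>F, v\<rangle>\<close>, and the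
  source contributes \<open>\<integral> \<mu> exp(-\<mu>(t - s)) \<langle>F(t) - F(s), v\<rangle> ds\<close>.  The Hoelder bound on \<open>F\<close> makes this of
  order \<open>1 / sqrt \<mu>\<close>.
\<close>

lemma duhamel_bound:
  fixes y F :: "real \<Rightarrow> 'h::real_inner"
  assumes y: "continuous_on {0..T} y"
    and F: "\<And>s t. 0 \<le> s \<Longrightarrow> s \<le> t \<Longrightarrow> t \<le> T \<Longrightarrow> norm (F t - F s) \<le> sqrt (t - s)"
    and F0: "F 0 = 0" and \<mu>: "\<mu> > 0"
    and eq: "\<And>t. t \<in> {0..T} \<Longrightarrow> y t \<bullet> v = F t \<bullet> v + integral {0..t} (\<lambda>s. y s \<bullet> (r - \<mu> *\<^sub>R v))"
    and t: "t \<in> {0..T}"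
  shows "\<bar>y t \<bullet> v\<bar> \<le> norm v / sqrt \<mu> + integral {0..t} (\<lambda>s. exp (- \<mu> * (t - s)) * \<bar>y s \<bullet> r\<bar>)"
proof -
  have T: "0 \<le> t" "t \<le> T" using t by auto
  have yt: "continuous_on {0..t} y" using continuous_on_subset[OF y] T by auto
  define W where "W s = integral {0..s} (\<lambda>s. y s \<bullet> (r - \<mu> *\<^sub>R v))" for s
  define H where "H s = integral {0..s} (\<lambda>s. exp (- \<mu> * (t - s)) * \<bar>y s \<bullet> r\<bar>)" for s
  \<comment> \<open>Adding the constant \<open>\<langle>F t, v\<rangle>\<close> makes the increments of \<open>F\<close> towards the final time \<open>t\<close> appear in the
    derivative of \<open>Z\<close>.\<close>
  define Z where "Z s = exp (\<mu> * s) * (W s + F t \<bullet> v)" for s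
  \<comment> \<open>An explicit primitive of \<open>exp(\<mu> s) sqrt \<mu> (1 + \<mu>(t - s)) / 2\<close>, which dominates
    \<open>exp(\<mu> s) \<mu> sqrt(t - s)\<close> by the inequality between the geometric and the arithmetic mean.\<close>
  define A where "A s = exp (\<mu> * s) * (2 + \<mu> * (t - s)) / (2 * sqrt \<mu>)" for s
  define U where "U s = norm v * A s + exp (\<mu> * t) * H s" for s
  have dW: "(W has_real_derivative y s \<bullet> (r - \<mu> *\<^sub>R v)) (at s within {0..t})" if "s \<in> {0..t}" for s
    unfolding W_def has_real_derivative_iff_has_vector_derivative
    by (rule integral_has_vector_derivative) (use that yt in \<open>auto intro!: continuous_intros\<close>)
  have dH: "(H has_real_derivative exp (- \<mu> * (t - s)) * \<bar>y s \<bullet> r\<bar>) (at s within {0..t})" if "s \<in> {0..t}" for s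
    unfolding H_def has_real_derivative_iff_has_vector_derivative
    by (rule integral_has_vector_derivative) (use that yt in \<open>auto intro!: continuous_intros\<close>)
  have dZ: "(Z has_real_derivative exp (\<mu> * s) * (\<mu> * ((F t - F s) \<bullet> v) + y s \<bullet> r)) (at s within {0..t})"
    if s: "s \<in> {0..t}" for s
  proof -
    have "y s \<bullet> v = F s \<bullet> v + W s" using eq[of s] s T by (simp add: W_def)
    then have "exp (\<mu> * s) * (\<mu> * ((F t - F s) \<bullet> v) + y s \<bullet> r)
       = (exp (\<mu> * s) * \<mu>) * (W s + F t \<bullet> v) + exp (\<mu> * s) * (y s \<bullet> (r - \<mu> *\<^sub>R v))"
      by (simp add: inner_diff_left inner_diff_right algebra_simps)
    then show ?thesis unfolding Z_def
      by (auto intro!: derivative_eq_intros dW[OF s])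
  qed
  have dA: "(A has_real_derivative exp (\<mu> * s) * (sqrt \<mu> * (1 + \<mu> * (t - s)) / 2)) (at s within {0..t})" for s
  proof -
    have "(A has_real_derivative (exp (\<mu> * s) * \<mu> * (2 + \<mu> * (t - s)) - exp (\<mu> * s) * \<mu>) / (2 * sqrt \<mu>)) (at s within {0..t})"
      unfolding A_def
    proof (rule DERIV_cdivide)
      show "((\<lambda>s. exp (\<mu> * s) * (2 + \<mu> * (t - s))) has_real_derivative
          exp (\<mu> * s) * \<mu> * (2 + \<mu> * (t - s)) - exp (\<mu> * s) * \<mu>) (at s within {0..t})"
        by (auto intro!: derivative_eq_intros)
    qed
    also have "(exp (\<mu> * s) * \<mu> * (2 + \<mu> * (t - s)) - exp (\<mu> * s) * \<mu>) / (2 * sqrt \<mu>)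
        = exp (\<mu> * s) * ((\<mu> / sqrt \<mu>) * (1 + \<mu> * (t - s)) / 2)"
      by (simp add: algebra_simps diff_divide_distrib add_divide_distrib)
    also have "\<mu> / sqrt \<mu> = sqrt \<mu>" using \<mu> by (simp add: real_div_sqrt)
    finally show ?thesis .
  qed
  have dU: "(U has_real_derivative exp (\<mu> * s) * (norm v * (sqrt \<mu> * (1 + \<mu> * (t - s)) / 2) + \<bar>y s \<bullet> r\<bar>)) (at s within {0..t})"
    if s: "s \<in> {0..t}" for s
  proof -
    have "exp (\<mu> * t) * exp (- \<mu> * (t - s)) = exp (\<mu> * s)"
      by (simp add: exp_add[symmetric] algebra_simps)
    then have "exp (\<mu> * t) * (exp (- \<mu> * (t - s)) * \<bar>y s \<bullet> r\<bar>) = exp (\<mu> * s) * \<bar>y s \<bullet> r\<bar>"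
      by (simp only: mult.assoc[symmetric])
    then have "exp (\<mu> * s) * (norm v * (sqrt \<mu> * (1 + \<mu> * (t - s)) / 2) + \<bar>y s \<bullet> r\<bar>) =
      norm v * (exp (\<mu> * s) * (sqrt \<mu> * (1 + \<mu> * (t - s)) / 2)) + exp (\<mu> * t) * (exp (- \<mu> * (t - s)) * \<bar>y s \<bullet> r\<bar>)"
      by (simp only: distrib_left mult.left_commute)
    then show ?thesis unfolding U_def
      using DERIV_add[OF DERIV_cmult[OF dA[of s], of "norm v"] DERIV_cmult[OF dH[OF s], of "exp (\<mu> * t)"]] by simp
  qed
  have dom: "\<bar>exp (\<mu> * s) * (\<mu> * ((F t - F s) \<bullet> v) + y s \<bullet> r)\<bar>
      \<le> exp (\<mu> * s) * (norm v * (sqrt \<mu> * (1 + \<mu> * (t - s)) / 2) + \<bar>y s \<bullet> r\<bar>)" if s: "s \<in> {0..t}" for s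
  proof -
    have amgm: "\<mu> * sqrt (t - s) \<le> sqrt \<mu> * (1 + \<mu> * (t - s)) / 2"
    proof -
      have "0 \<le> sqrt \<mu> * (1 - sqrt \<mu> * sqrt (t - s))\<^sup>2" using \<mu> by simp
      also have "\<dots> = sqrt \<mu> * (1 + \<mu> * (t - s)) - 2 * (\<mu> * sqrt (t - s))"
      proof -
        define x where "x = sqrt \<mu> * sqrt (t - s)"
        have "x\<^sup>2 = \<mu> * (t - s)" "sqrt \<mu> * x = \<mu> * sqrt (t - s)"
          using \<mu> s by (simp_all add: x_def power_mult_distrib mult.assoc[symmetric])
        moreover have "sqrt \<mu> * (1 - x)\<^sup>2 = sqrt \<mu> * (1 + x\<^sup>2) - 2 * (sqrt \<mu> * x)"
          by (simp add: power2_diff algebra_simps)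
        ultimately show ?thesis by (simp add: x_def)
      qed
      finally show ?thesis by simp
    qed
    have "\<bar>(F t - F s) \<bullet> v\<bar> \<le> sqrt (t - s) * norm v"
      using Cauchy_Schwarz_ineq2[of "F t - F s" v] mult_right_mono[OF F[of s t], of "norm v"] s T by auto
    then have "\<mu> * \<bar>(F t - F s) \<bullet> v\<bar> \<le> norm v * (\<mu> * sqrt (t - s))"
      using \<mu> by (simp add: mult.commute mult.left_commute)
    also have "\<dots> \<le> norm v * (sqrt \<mu> * (1 + \<mu> * (t - s)) / 2)"
      by (rule mult_left_mono[OF amgm]) simp
    finally have "\<bar>\<mu> * ((F t - F s) \<bullet> v) + y s \<bullet> r\<bar> \<le> norm v * (sqrt \<mu> * (1 + \<mu> * (t - s)) / 2) + \<bar>y s \<bullet> r\<bar>"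
      using abs_triangle_ineq[of "\<mu> * ((F t - F s) \<bullet> v)" "y s \<bullet> r"] \<mu> by (simp add: abs_mult)
    then show ?thesis by (simp add: abs_mult)
  qed
  have mono: "U 0 + c * Z 0 \<le> U t + c * Z t" if c: "\<bar>c\<bar> = 1" for c
  proof (rule DERIV_nonneg_imp_increasing_open[of 0 t "\<lambda>s. U s + c * Z s"])
    fix s assume s: "0 < s" "s < t"
    then have at: "at s within {0..t} = at s" by (simp add: at_within_Icc_at)
    have s': "s \<in> {0..t}" using s by auto
    have nonneg: "0 \<le> u + c * z" if "\<bar>z\<bar> \<le> u" for u z :: real
      using that c abs_mult[of c z] abs_le_D2[of "c * z" u] by simp
    show "\<exists>d. ((\<lambda>s. U s + c * Z s) has_real_derivative d) (at s) \<and> 0 \<le> d"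
      using DERIV_add[OF dU[OF s'] DERIV_cmult[OF dZ[OF s'], of c]] nonneg[OF dom[OF s']]
      unfolding at by blast
  next
    show "continuous_on {0..t} (\<lambda>s. U s + c * Z s)"
      using dU dZ by (intro continuous_intros DERIV_continuous_on) auto
  qed fact
  have "\<bar>Z t\<bar> \<le> \<bar>Z 0\<bar> + U t - U 0" using mono[of 1] mono[of "-1"] by auto
  \<comment> \<open>The boundary term at time zero is absorbed by the value of the primitive \<open>A\<close> there.\<close>
  moreover have "\<bar>Z 0\<bar> \<le> norm v * A 0"
  proof -
    have "sqrt \<mu> * sqrt t \<le> (1 + \<mu> * t) / 2"
    proof -
      have "0 \<le> (1 - sqrt \<mu> * sqrt t)\<^sup>2" by simp
      also have "\<dots> = (1 + \<mu> * t) - 2 * (sqrt \<mu> * sqrt t)"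
        using \<mu> T by (simp add: power2_diff power_mult_distrib)
      finally show ?thesis by simp
    qed
    then have "sqrt t \<le> A 0" using \<mu> by (simp add: A_def field_simps)
    moreover have "\<bar>F t \<bullet> v\<bar> \<le> sqrt t * norm v"
      using Cauchy_Schwarz_ineq2[of "F t" v] mult_right_mono[OF F[of 0 t], of "norm v"] T F0 by auto
    ultimately show ?thesis
      using mult_right_mono[of "sqrt t" "A 0" "norm v"] by (simp add: Z_def W_def mult.commute)
  qed
  ultimately have "\<bar>Z t\<bar> \<le> U t - exp (\<mu> * t) * H 0" by (simp add: U_def)
  also have "\<dots> = exp (\<mu> * t) * (norm v / sqrt \<mu> + H t)"
    by (simp add: U_def A_def H_def algebra_simps)
  also have "Z t = exp (\<mu> * t) * (y t \<bullet> v)"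
    using eq[OF t] by (simp add: Z_def W_def)
  finally show ?thesis by (simp add: abs_mult H_def)
qed

lemma duhamel_bound_sup:
  fixes y F :: "real \<Rightarrow> 'h::real_inner"
  assumes y: "continuous_on {0..T} y"
    and F: "\<And>s t. 0 \<le> s \<Longrightarrow> s \<le> t \<Longrightarrow> t \<le> T \<Longrightarrow> norm (F t - F s) \<le> sqrt (t - s)"
    and F0: "F 0 = 0" and \<mu>: "\<mu> > 0"
    and eq: "\<And>t. t \<in> {0..T} \<Longrightarrow> y t \<bullet> v = F t \<bullet> v + integral {0..t} (\<lambda>s. y s \<bullet> (r - \<mu> *\<^sub>R v))"
    and t: "t \<in> {0..T}"
    and R: "\<And>s. s \<in> {0..T} \<Longrightarrow> \<bar>y s \<bullet> r\<bar> \<le> R"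
  shows "\<bar>y t \<bullet> v\<bar> \<le> norm v / sqrt \<mu> + R / \<mu>"
proof -
  have R0: "0 \<le> R" using R[OF t] by linarith
  have yt: "continuous_on {0..t} y" using continuous_on_subset[OF y] t by auto
  have "((\<lambda>s. exp (- \<mu> * (t - s)) * R) has_integral
      exp (- \<mu> * (t - t)) * R / \<mu> - exp (- \<mu> * (t - 0)) * R / \<mu>) {0..t}"
    by (rule fundamental_theorem_of_calculus)
      (use t \<mu> in \<open>auto intro!: derivative_eq_intros simp: has_real_derivative_iff_has_vector_derivative[symmetric]\<close>)
  then have i: "((\<lambda>s. exp (- \<mu> * (t - s)) * R) has_integral R / \<mu> - exp (- \<mu> * t) * R / \<mu>) {0..t}" by simp
  have "integral {0..t} (\<lambda>s. exp (- \<mu> * (t - s)) * \<bar>y s \<bullet> r\<bar>) \<le> integral {0..t} (\<lambda>s. exp (- \<mu> * (t - s)) * R)"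
    by (rule integral_le)
       (use yt t R in \<open>auto intro!: integrable_continuous_real continuous_intros mult_left_mono\<close>)
  also have "\<dots> = R / \<mu> - exp (- \<mu> * t) * R / \<mu>" using i by (rule integral_unique)
  also have "\<dots> \<le> R / \<mu>" using R0 \<mu> by simp
  finally show ?thesis using duhamel_bound[OF y F F0 \<mu> eq t] by auto
qed

lemma duhamel_bound_L2:
  fixes y F :: "real \<Rightarrow> 'h::real_inner"
  assumes y: "continuous_on {0..T} y"
    and F: "\<And>s t. 0 \<le> s \<Longrightarrow> s \<le> t \<Longrightarrow> t \<le> T \<Longrightarrow> norm (F t - F s) \<le> sqrt (t - s)"
    and F0: "F 0 = 0" and \<mu>: "\<mu> > 0"
    and eq: "\<And>t. t \<in> {0..T} \<Longrightarrow> y t \<bullet> v = F t \<bullet> v + integral {0..t} (\<lambda>s. y s \<bullet> (r - \<mu> *\<^sub>R v))"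
    and t: "t \<in> {0..T}"
    and E: "integral {0..T} (\<lambda>s. (norm (y s))\<^sup>2) \<le> E"
  shows "\<bar>y t \<bullet> v\<bar> \<le> (norm v + norm r * (1 + E)) / sqrt \<mu>"
proof -
  have yt: "continuous_on {0..t} y" using continuous_on_subset[OF y] t by auto
  have sq: "sqrt \<mu> > 0" using \<mu> by simp
  have E': "integral {0..t} (\<lambda>s. (norm (y s))\<^sup>2) \<le> E"
  proof -
    have "integral {0..t} (\<lambda>s. (norm (y s))\<^sup>2) \<le> integral {0..T} (\<lambda>s. (norm (y s))\<^sup>2)"
      by (rule integral_subset_le)
         (use t y yt in \<open>auto intro!: integrable_continuous_real continuous_intros\<close>)
    then show ?thesis using E by simp
  qed
  have "((\<lambda>s. exp (- 2 * \<mu> * (t - s))) has_integral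
      exp (- 2 * \<mu> * (t - t)) / (2 * \<mu>) - exp (- 2 * \<mu> * (t - 0)) / (2 * \<mu>)) {0..t}"
    by (rule fundamental_theorem_of_calculus)
      (use t \<mu> in \<open>auto intro!: derivative_eq_intros simp: has_real_derivative_iff_has_vector_derivative[symmetric]\<close>)
  then have "integral {0..t} (\<lambda>s. exp (- 2 * \<mu> * (t - s))) \<le> 1 / (2 * \<mu>)"
    using \<mu> by (auto dest!: integral_unique)
  moreover have "1 / (2 * \<mu>) \<le> 1 / \<mu>" using \<mu> by (simp add: field_simps)
  ultimately have i: "integral {0..t} (\<lambda>s. exp (- 2 * \<mu> * (t - s))) \<le> 1 / \<mu>" by linarith
  \<comment> \<open>Young's inequality, weighted so that both terms are of order \<open>1 / sqrt \<mu>\<close> after integration.\<close>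
  have young: "exp (- \<mu> * (t - s)) * \<bar>y s \<bullet> r\<bar>
      \<le> norm r * (sqrt \<mu> * exp (- 2 * \<mu> * (t - s)) + (norm (y s))\<^sup>2 / sqrt \<mu>)" for s
  proof -
    define e where "e = exp (- \<mu> * (t - s))"
    have e: "e > 0" "exp (- 2 * \<mu> * (t - s)) = e\<^sup>2"
      by (auto simp: e_def power2_eq_square exp_add[symmetric] algebra_simps)
    have "sqrt \<mu> * (e * norm (y s)) \<le> \<mu> * e\<^sup>2 + (norm (y s))\<^sup>2"
    proof -
      have "0 \<le> (sqrt \<mu> * e - norm (y s))\<^sup>2" by simp
      then have "2 * (sqrt \<mu> * (e * norm (y s))) \<le> \<mu> * e\<^sup>2 + (norm (y s))\<^sup>2"
        using \<mu> by (simp add: power2_diff power_mult_distrib mult.assoc)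
      moreover have "0 \<le> sqrt \<mu> * (e * norm (y s))" using \<mu> e by simp
      ultimately show ?thesis by linarith
    qed
    then have "e * norm (y s) \<le> (\<mu> * e\<^sup>2 + (norm (y s))\<^sup>2) / sqrt \<mu>"
      using sq by (simp add: pos_le_divide_eq mult.commute)
    also have "\<dots> = sqrt \<mu> * e\<^sup>2 + (norm (y s))\<^sup>2 / sqrt \<mu>"
      using \<mu> by (simp add: add_divide_distrib real_div_sqrt flip: times_divide_eq_left)
    finally have "norm r * (e * norm (y s)) \<le> norm r * (sqrt \<mu> * e\<^sup>2 + (norm (y s))\<^sup>2 / sqrt \<mu>)"
      by (rule mult_left_mono) simp
    moreover have "e * \<bar>y s \<bullet> r\<bar> \<le> norm r * (e * norm (y s))"
      using mult_left_mono[OF Cauchy_Schwarz_ineq2[of "y s" r], of e] e by (simp add: mult_ac)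
    ultimately show ?thesis unfolding e(2) e_def[symmetric] by linarith
  qed
  have "integral {0..t} (\<lambda>s. exp (- \<mu> * (t - s)) * \<bar>y s \<bullet> r\<bar>)
     \<le> integral {0..t} (\<lambda>s. norm r * (sqrt \<mu> * exp (- 2 * \<mu> * (t - s)) + (norm (y s))\<^sup>2 / sqrt \<mu>))"
    by (rule integral_le[OF _ _ young])
       (use yt sq in \<open>auto intro!: integrable_continuous_real continuous_intros\<close>)
  also have "\<dots> = norm r * (sqrt \<mu> * integral {0..t} (\<lambda>s. exp (- 2 * \<mu> * (t - s)))
        + integral {0..t} (\<lambda>s. (norm (y s))\<^sup>2) / sqrt \<mu>)"
    using yt sq
    by (subst integral_mult_right, subst integral_add)
       (auto intro!: integrable_continuous_real continuous_intros)
  also have "\<dots> \<le> norm r * (sqrt \<mu> * (1 / \<mu>) + E / sqrt \<mu>)"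
    using i E' sq by (intro mult_left_mono add_mono divide_right_mono) auto
  also have "sqrt \<mu> * (1 / \<mu>) = 1 / sqrt \<mu>" using \<mu> by (simp add: field_simps)
  finally have "integral {0..t} (\<lambda>s. exp (- \<mu> * (t - s)) * \<bar>y s \<bullet> r\<bar>) \<le> norm r * (1 + E) / sqrt \<mu>"
    by (simp add: add_divide_distrib[symmetric])
  then show ?thesis using duhamel_bound[OF y F F0 \<mu> eq t] by (simp add: add_divide_distrib)
qed

text \<open>
  The remainder has norm \<open>O(k)\<close>, and the convolution of \<open>exp(-k\<^sup>2 s)\<close> with a square integrable function of time is
  \<open>O(1/k)\<close>.
\<close>

lemma heat_osc_bounded:
  fixes \<Omega> :: "(real^'n) set"
  assumes \<Omega>: "\<Omega> \<in> sets borel" and T: "0 \<le> T" and \<phi>: "test_function \<Omega> \<phi>"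
  obtains C where "\<And>k \<theta> f y t. 1 \<le> k \<Longrightarrow> heat_solution \<Omega> T f 0 y \<Longrightarrow> norm f \<le> 1 \<Longrightarrow> t \<in> {0..T} \<Longrightarrow>
     \<bar>y t \<bullet> L2_of (osc (axis j 1) k \<theta> \<phi>)\<bar> \<le> C"
proof -
  let ?e = "axis j 1 :: real^'n"
  let ?d = "\<lambda>x. frechet_derivative \<phi> (at x) ?e"
  define R where "R = 2 * norm (L2_of ?d) + norm (L2_of (laplacian \<phi>))"
  have "\<bar>y t \<bullet> L2_of (osc ?e k \<theta> \<phi>)\<bar> \<le> norm (L2_of \<phi>) + R * (1 + T\<^sup>2)"
    if k: "1 \<le> k" and heat: "heat_solution \<Omega> T f 0 y" "norm f \<le> 1" and t: "t \<in> {0..T}" for k \<theta> f y t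
  proof -
    define v where "v = L2_of (osc ?e k \<theta> \<phi>)"
    define r where "r = (2 * k) *\<^sub>R L2_of (osc ?e k (\<theta> + pi/2) ?d) + L2_of (osc ?e k \<theta> (laplacian \<phi>))"
    have y: "continuous_on {0..T} y" using heat by (simp add: heat_solution_def)
    obtain F where F: "\<And>s t. 0 \<le> s \<Longrightarrow> s \<le> t \<Longrightarrow> t \<le> T \<Longrightarrow> norm (F t - F s) \<le> sqrt (t - s)"
      and F0: "F 0 = 0"
      and eq: "\<And>v t. test_function \<Omega> v \<Longrightarrow> t \<in> {0..T} \<Longrightarrow>
        y t \<bullet> L2_of v = F t \<bullet> L2_of v + integral {0..t} (\<lambda>s. y s \<bullet> L2_of (laplacian v))"
      and E: "integral {0..T} (\<lambda>s. (norm (y s))\<^sup>2) \<le> T\<^sup>2"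
    proof (rule heat_solution_estimates[OF heat(1) \<Omega> T heat(2)], goal_cases)
      case (1 F)
      from 1(2-5) show thesis by (rule 1(1))
    qed
    have eq': "y t \<bullet> v = F t \<bullet> v + integral {0..t} (\<lambda>s. y s \<bullet> (r - k\<^sup>2 *\<^sub>R v))" if "t \<in> {0..T}" for t
      using eq[OF test_function_osc[OF \<phi>] that, of ?e k \<theta>]
      unfolding L2_of_laplacian_osc[OF \<phi>] v_def r_def .
    have "\<bar>y t \<bullet> v\<bar> \<le> (norm v + norm r * (1 + T\<^sup>2)) / sqrt (k\<^sup>2)"
      by (rule duhamel_bound_L2[OF y F F0 _ eq' t E]) (use k in auto)
    also have "\<dots> = (norm v + norm r * (1 + T\<^sup>2)) / k" using k by simp
    also have "\<dots> \<le> (k * norm (L2_of \<phi>) + (k * R) * (1 + T\<^sup>2)) / k"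
    proof (rule divide_right_mono[OF add_mono[OF _ mult_right_mono]])
      have "norm v \<le> 1 * norm (L2_of \<phi>)" using norm_osc_le[OF \<phi>] by (simp add: v_def)
      also have "\<dots> \<le> k * norm (L2_of \<phi>)" using k by (intro mult_right_mono) auto
      finally show "norm v \<le> k * norm (L2_of \<phi>)" .
      have "norm r \<le> (2 * k) * norm (L2_of ?d) + 1 * norm (L2_of (laplacian \<phi>))"
      proof -
        have "norm r \<le> (2 * k) * norm (L2_of (osc ?e k (\<theta> + pi/2) ?d)) + norm (L2_of (osc ?e k \<theta> (laplacian \<phi>)))"
          using norm_triangle_ineq[of "(2 * k) *\<^sub>R L2_of (osc ?e k (\<theta> + pi/2) ?d)" "L2_of (osc ?e k \<theta> (laplacian \<phi>))"] k
          by (simp add: r_def)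
        also have "\<dots> \<le> (2 * k) * norm (L2_of ?d) + 1 * norm (L2_of (laplacian \<phi>))"
          using norm_osc_le[OF test_function_laplacian[OF \<phi>]] norm_osc_le[OF test_function_derivative_axis[OF \<phi>]] k
          by (intro add_mono mult_left_mono) auto
        finally show ?thesis .
      qed
      also have "\<dots> \<le> (2 * k) * norm (L2_of ?d) + k * norm (L2_of (laplacian \<phi>))"
        using k by (intro add_left_mono mult_right_mono) auto
      finally show "norm r \<le> k * R" by (simp add: R_def algebra_simps)
    qed (use k in auto)
    also have "\<dots> = norm (L2_of \<phi>) + R * (1 + T\<^sup>2)" using k by (simp add: add_divide_distrib)
    finally show ?thesis unfolding v_def .
  qed
  then show ?thesis by (rule that)
qed

text \<open>
  The preceding bound applied to the two oscillations in the remainder turns the estimate of the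
  remainder from one in the mean to one at every time, which gains the missing factor \<open>1/k\<close>.
\<close>

lemma heat_osc_small:
  fixes \<Omega> :: "(real^'n) set"
  assumes \<Omega>: "\<Omega> \<in> sets borel" and T: "0 \<le> T" and \<phi>: "test_function \<Omega> \<phi>"
  obtains C where "\<And>k \<theta> f y t. 1 \<le> k \<Longrightarrow> heat_solution \<Omega> T f 0 y \<Longrightarrow> norm f \<le> 1 \<Longrightarrow> t \<in> {0..T} \<Longrightarrow>
     \<bar>y t \<bullet> L2_of (osc (axis j 1) k \<theta> \<phi>)\<bar> \<le> C / k"
proof -
  let ?e = "axis j 1 :: real^'n"
  let ?d = "\<lambda>x. frechet_derivative \<phi> (at x) ?e"
  obtain C1 where C1: "\<And>k \<theta> f y t. 1 \<le> k \<Longrightarrow> heat_solution \<Omega> T f 0 y \<Longrightarrow> norm f \<le> 1 \<Longrightarrow> t \<in> {0..T} \<Longrightarrow>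
     \<bar>y t \<bullet> L2_of (osc ?e k \<theta> ?d)\<bar> \<le> C1"
  proof (rule heat_osc_bounded[OF \<Omega> T test_function_derivative_axis[OF \<phi>, of j], where j=j], goal_cases)
    case (1 C)
    from 1(2) show thesis by (rule 1(1))
  qed
  obtain C2 where C2: "\<And>k \<theta> f y t. 1 \<le> k \<Longrightarrow> heat_solution \<Omega> T f 0 y \<Longrightarrow> norm f \<le> 1 \<Longrightarrow> t \<in> {0..T} \<Longrightarrow>
     \<bar>y t \<bullet> L2_of (osc ?e k \<theta> (laplacian \<phi>))\<bar> \<le> C2"
  proof (rule heat_osc_bounded[OF \<Omega> T test_function_laplacian[OF \<phi>], where j=j], goal_cases)
    case (1 C)
    from 1(2) show thesis by (rule 1(1))
  qed
  have "\<bar>y t \<bullet> L2_of (osc ?e k \<theta> \<phi>)\<bar> \<le> (norm (L2_of \<phi>) + (2 * C1 + C2)) / k"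
    if k: "1 \<le> k" and heat: "heat_solution \<Omega> T f 0 y" "norm f \<le> 1" and t: "t \<in> {0..T}" for k \<theta> f y t
  proof -
    define v where "v = L2_of (osc ?e k \<theta> \<phi>)"
    define r where "r = (2 * k) *\<^sub>R L2_of (osc ?e k (\<theta> + pi/2) ?d) + L2_of (osc ?e k \<theta> (laplacian \<phi>))"
    have y: "continuous_on {0..T} y" using heat by (simp add: heat_solution_def)
    obtain F where F: "\<And>s t. 0 \<le> s \<Longrightarrow> s \<le> t \<Longrightarrow> t \<le> T \<Longrightarrow> norm (F t - F s) \<le> sqrt (t - s)"
      and F0: "F 0 = 0"
      and eq: "\<And>v t. test_function \<Omega> v \<Longrightarrow> t \<in> {0..T} \<Longrightarrow>
        y t \<bullet> L2_of v = F t \<bullet> L2_of v + integral {0..t} (\<lambda>s. y s \<bullet> L2_of (laplacian v))"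
    proof (rule heat_solution_estimates[OF heat(1) \<Omega> T heat(2)], goal_cases)
      case (1 F)
      from 1(2-4) show thesis by (rule 1(1))
    qed
    have eq': "y t \<bullet> v = F t \<bullet> v + integral {0..t} (\<lambda>s. y s \<bullet> (r - k\<^sup>2 *\<^sub>R v))" if "t \<in> {0..T}" for t
      using eq[OF test_function_osc[OF \<phi>] that, of ?e k \<theta>]
      unfolding L2_of_laplacian_osc[OF \<phi>] v_def r_def .
    have R: "\<bar>y s \<bullet> r\<bar> \<le> k * (2 * C1 + C2)" if s: "s \<in> {0..T}" for s
    proof -
      have "\<bar>y s \<bullet> r\<bar> \<le> (2 * k) * \<bar>y s \<bullet> L2_of (osc ?e k (\<theta> + pi/2) ?d)\<bar> + \<bar>y s \<bullet> L2_of (osc ?e k \<theta> (laplacian \<phi>))\<bar>"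
        using abs_triangle_ineq[of "(2 * k) * (y s \<bullet> L2_of (osc ?e k (\<theta> + pi/2) ?d))" "y s \<bullet> L2_of (osc ?e k \<theta> (laplacian \<phi>))"] k
        by (simp add: r_def inner_add_right abs_mult)
      also have "\<dots> \<le> (2 * k) * C1 + 1 * C2"
        using C1[OF k heat s] C2[OF k heat s] k by (intro add_mono mult_left_mono) auto
      also have "\<dots> \<le> (2 * k) * C1 + k * C2"
        using C2[OF k heat s] k by (intro add_left_mono mult_right_mono) (auto intro: order_trans[OF abs_ge_zero])
      finally show ?thesis by (simp add: algebra_simps)
    qed
    have "\<bar>y t \<bullet> v\<bar> \<le> norm v / sqrt (k\<^sup>2) + k * (2 * C1 + C2) / k\<^sup>2"
      by (rule duhamel_bound_sup[OF y F F0 _ eq' t R]) (use k in auto)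
    also have "\<dots> = (norm v + (2 * C1 + C2)) / k"
      using k by (simp add: power2_eq_square add_divide_distrib)
    also have "\<dots> \<le> (norm (L2_of \<phi>) + (2 * C1 + C2)) / k"
      using norm_osc_le[OF \<phi>] k by (intro divide_right_mono) (auto simp: v_def)
    finally show ?thesis unfolding v_def .
  qed
  then show ?thesis by (rule that)
qed

section \<open>Reachable states\<close>

lemma norm_localized_control_le:
  assumes "open \<omega>"
  shows "norm (localized_control \<omega> u) \<le> norm u"
proof (rule power2_le_imp_le)
  let ?g = "\<lambda>z. indicator \<omega> (fst z) * fun_of u z"
  have [measurable]: "(\<lambda>x. indicator \<omega> x :: real) \<in> borel_measurable lborel"
    using assms by auto
  have [measurable]: "?g \<in> borel_measurable lborel"
    by (intro borel_measurable_times cylinder_measurable) measurable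
  have u: "integrable lborel (\<lambda>z. (fun_of u z)\<^sup>2)"
    using square_integrable_fun_of[of u] by (simp add: square_integrable_def)
  have le: "(?g z)\<^sup>2 \<le> (fun_of u z)\<^sup>2" for z by (simp add: indicator_def)
  have i: "integrable lborel (\<lambda>z. (?g z)\<^sup>2)"
    by (rule Bochner_Integration.integrable_bound[OF u]) (use le in auto)
  then have sq: "square_integrable ?g" by (simp add: square_integrable_def)
  have "localized_control \<omega> u = L2_of ?g"
    by (simp add: localized_control_def case_prod_unfold)
  then show "(norm (localized_control \<omega> u))\<^sup>2 \<le> (norm u)\<^sup>2"
    using integral_mono[OF i u le] by (simp only: norm_L2_of[OF sq] norm_fun_of[of u])
qed simp

text \<open>
  The norm does not see null sets, but the bump is nonzero on a ball.
\<close>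

lemma norm_bump_pos:
  fixes c :: "'a::euclidean_space"
  assumes r: "r > 0"
  shows "0 < norm (L2_of (bump c r))"
proof -
  have sq: "square_integrable (bump c r)"
    by (rule test_function_square_integrable[OF test_function_bump[OF r subset_UNIV]])
  have "L2_of (bump c r) \<noteq> 0"
  proof
    assume "L2_of (bump c r) = 0"
    then have "AE x in lborel. bump c r x = 0"
      using fun_of_L2_of[OF sq] fun_of_zero by (auto elim: eventually_elim2)
    then have "AE x in lborel. x \<notin> ball c r"
      by eventually_elim (use bump_nonzero_iff[OF r] in blast)
    then have "emeasure lborel (ball c r) = 0"
      by (subst (asm) AE_iff_measurable[of "ball c r"]) auto
    then show False using r unit_ball_vol_pos[of "real DIM('a)"] by (simp add: emeasure_ball)
  qed
  then show ?thesis by simp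
qed

text \<open>
  The squares of cosine and sine add up to one, so one of the phases \<open>0\<close> and \<open>\<pi>/2\<close> retains at least half
  of the squared norm, uniformly in the frequency.
\<close>

lemma osc_phase_exists:
  assumes \<phi>: "test_function \<Omega> \<phi>"
  shows "\<exists>\<theta>. norm (L2_of \<phi>) / 2 \<le> norm (L2_of (osc e k \<theta> \<phi>))"
proof (rule ccontr)
  assume "\<not> ?thesis"
  then have lt: "norm (L2_of (osc e k \<theta> \<phi>)) < norm (L2_of \<phi>) / 2" for \<theta> by (simp add: not_le)
  have sq: "square_integrable \<phi>" "square_integrable (osc e k \<theta> \<phi>)" for \<theta>
    using test_function_square_integrable \<phi> test_function_osc by blast+
  have "(osc e k 0 \<phi> x)\<^sup>2 + (osc e k (pi/2) \<phi> x)\<^sup>2 = (\<phi> x)\<^sup>2" for x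
    using sin_cos_squared_add[of "k * (x \<bullet> e)"] minus_sin_cos_eq[of "k * (x \<bullet> e)", symmetric]
    by (simp add: osc_def power_mult_distrib distrib_left[symmetric] add.commute)
  then have "(norm (L2_of \<phi>))\<^sup>2 = (LINT x|lborel. (osc e k 0 \<phi> x)\<^sup>2 + (osc e k (pi/2) \<phi> x)\<^sup>2)"
    by (simp add: norm_L2_of[OF sq(1)])
  also have "\<dots> = (norm (L2_of (osc e k 0 \<phi>)))\<^sup>2 + (norm (L2_of (osc e k (pi/2) \<phi>)))\<^sup>2"
    unfolding norm_L2_of[OF sq(2)] using sq(2)
    by (intro Bochner_Integration.integral_add) (auto simp: square_integrable_def)
  also have "\<dots> \<le> (norm (L2_of \<phi>) / 2)\<^sup>2 + (norm (L2_of \<phi>) / 2)\<^sup>2"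
    by (intro add_mono power_mono less_imp_le[OF lt] norm_ge_zero)
  finally have "(norm (L2_of \<phi>))\<^sup>2 \<le> (norm (L2_of \<phi>))\<^sup>2 / 2" by (simp add: power_divide)
  then have "norm (L2_of \<phi>) = 0" by (simp add: not_less[symmetric])
  then show False using lt[of 0] norm_ge_zero[of "L2_of (osc e k 0 \<phi>)"] by linarith
qed

lemma disjoint_balls_exist:
  fixes \<Omega> :: "'a::euclidean_space set"
  assumes "open \<Omega>" "\<Omega> \<noteq> {}"
  obtains P r where "finite P" "card P = n" "r > 0" "\<And>p. p \<in> P \<Longrightarrow> cball p r \<subseteq> \<Omega>"
    "\<And>p q. p \<in> P \<Longrightarrow> q \<in> P \<Longrightarrow> p \<noteq> q \<Longrightarrow> ball p r \<inter> ball q r = {}"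
proof -
  have "infinite \<Omega>" using finite_imp_not_open[of \<Omega>] assms by auto
  from infinite_arbitrarily_large[OF this, of n]
  obtain P where P: "finite P" "card P = n" "P \<subseteq> \<Omega>"
    by (elim exE conjE)
  have "\<forall>\<^sub>F r in at_right 0. cball p r \<subseteq> \<Omega>" if "p \<in> P" for p
  proof -
    have "p \<in> \<Omega>" using P(3) that by (rule subsetD)
    then obtain e where e: "e > 0" "cball p e \<subseteq> \<Omega>"
      using assms(1)[unfolded open_contains_cball] by auto
    show ?thesis
      unfolding eventually_at_right_field
      by (intro exI[of _ e] conjI e(1) allI impI order_trans[OF _ e(2)]) auto
  qed
  moreover have "\<forall>\<^sub>F r in at_right 0. p \<noteq> q \<longrightarrow> ball p r \<inter> ball q r = {}" for p q :: 'a
  proof (cases "p = q")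
    case False
    then show ?thesis
      unfolding eventually_at_right_field
      by (intro exI[of _ "dist p q / 2"]) (auto intro!: disjoint_ballI)
  qed simp
  ultimately have "\<forall>\<^sub>F r in at_right (0::real). 0 < r \<and> (\<forall>p\<in>P. cball p r \<subseteq> \<Omega>)
      \<and> (\<forall>p\<in>P. \<forall>q\<in>P. p \<noteq> q \<longrightarrow> ball p r \<inter> ball q r = {})"
    using P(1) by (intro eventually_conj eventually_ball_finite ballI)
      (auto intro: eventually_at_right_less)
  from eventually_happens'[OF trivial_limit_at_right_real this]
  obtain r where r: "0 < r" "\<forall>p\<in>P. cball p r \<subseteq> \<Omega>"
      "\<forall>p\<in>P. \<forall>q\<in>P. p \<noteq> q \<longrightarrow> ball p r \<inter> ball q r = {}"
    by (elim exE conjE)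
  show ?thesis
    by (rule that[OF P(1,2) r(1)]) (use r(2,3) in \<open>simp_all only: not_False_eq_True simp_thms\<close>)
qed

text \<open>
  Disjoint supports make the oscillations exactly orthogonal, so a single large frequency can serve all of
  them; the phase, chosen separately for each, keeps the norms away from zero as the frequency grows.
\<close>

lemma reachable_set_small_directions:
  fixes \<Omega> \<omega> :: "(real^'n) set"
  assumes \<Omega>: "open \<Omega>" "\<Omega> \<noteq> {}" and \<omega>: "open \<omega>" and T: "0 \<le> T" and \<delta>: "\<delta> > 0"
  shows "\<exists>W. finite W \<and> card W = n \<and> W \<subseteq> L2_on \<Omega> \<and> pairwise orthogonal W \<and>
          (\<forall>w\<in>W. norm w = 1 \<and> (\<forall>m\<in>reachable_set \<Omega> \<omega> T. \<bar>m \<bullet> w\<bar> \<le> \<delta>))"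
proof -
  obtain P r where P: "finite P" "card P = n" and r: "r > 0"
    and sub: "\<And>p. p \<in> P \<Longrightarrow> cball p r \<subseteq> \<Omega>"
    and disj: "\<And>p q. p \<in> P \<Longrightarrow> q \<in> P \<Longrightarrow> p \<noteq> q \<Longrightarrow> ball p r \<inter> ball q r = {}"
  proof (rule disjoint_balls_exist[OF \<Omega>, of n], goal_cases)
    case (1 P r)
    from 1(2-6) show thesis by (rule 1(1))
  qed
  have tf: "test_function \<Omega> (bump p r)" if "p \<in> P" for p
    by (rule test_function_bump[OF r sub[OF that]])
  define e :: "real^'n" where "e = axis undefined 1"
  have \<Omega>b: "\<Omega> \<in> sets borel" using \<Omega>(1) by simp
  have "\<forall>p\<in>P. \<exists>C. \<forall>k \<theta> f y t. 1 \<le> k \<longrightarrow> heat_solution \<Omega> T f 0 y \<longrightarrow> norm f \<le> 1 \<longrightarrow> t \<in> {0..T} \<longrightarrow>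
     \<bar>y t \<bullet> L2_of (osc e k \<theta> (bump p r))\<bar> \<le> C / k"
  proof
    fix p assume p: "p \<in> P"
    show "\<exists>C. \<forall>k \<theta> f y t. 1 \<le> k \<longrightarrow> heat_solution \<Omega> T f 0 y \<longrightarrow> norm f \<le> 1 \<longrightarrow> t \<in> {0..T} \<longrightarrow>
     \<bar>y t \<bullet> L2_of (osc e k \<theta> (bump p r))\<bar> \<le> C / k"
    proof (rule heat_osc_small[OF \<Omega>b T tf[OF p], where j=undefined], goal_cases)
      case (1 C)
      show ?case unfolding e_def by (intro exI[of _ C] allI impI) (rule 1)
    qed
  qed
  from bchoice[OF this] obtain C where
    C': "\<forall>p\<in>P. \<forall>k \<theta> f y t. 1 \<le> k \<longrightarrow> heat_solution \<Omega> T f 0 y \<longrightarrow> norm f \<le> 1 \<longrightarrow> t \<in> {0..T} \<longrightarrow>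
     \<bar>y t \<bullet> L2_of (osc e k \<theta> (bump p r))\<bar> \<le> C p / k" ..
  note C = bspec[OF C', rule_format]
  have "\<forall>\<^sub>F k in at_top. 1 \<le> k \<and> (\<forall>p\<in>P. C p / k < \<delta> * (norm (L2_of (bump p r)) / 2))"
  proof (intro eventually_conj eventually_ball_finite ballI P eventually_ge_at_top)
    fix p
    have "((\<lambda>k. C p / k) \<longlongrightarrow> 0) at_top"
      by (intro tendsto_divide_0[OF tendsto_const] filterlim_at_top_imp_at_infinity filterlim_ident)
    then show "\<forall>\<^sub>F k in at_top. C p / k < \<delta> * (norm (L2_of (bump p r)) / 2)"
      by (rule order_tendstoD) (use \<delta> norm_bump_pos[OF r, of p] in simp)
  qed
  then obtain k where k: "1 \<le> k" "\<And>p. p \<in> P \<Longrightarrow> C p / k < \<delta> * (norm (L2_of (bump p r)) / 2)"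
    by (auto dest!: eventually_happens'[OF trivial_limit_at_top_linorder])
  have "\<forall>p\<in>P. \<exists>\<theta>. norm (L2_of (bump p r)) / 2 \<le> norm (L2_of (osc e k \<theta> (bump p r)))"
    using osc_phase_exists[OF tf] by (rule ballI)
  from bchoice[OF this] obtain \<theta> where
    \<theta>': "\<forall>p\<in>P. norm (L2_of (bump p r)) / 2 \<le> norm (L2_of (osc e k (\<theta> p) (bump p r)))" ..
  have \<theta>: "norm (L2_of (bump p r)) / 2 \<le> norm (L2_of (osc e k (\<theta> p) (bump p r)))" if "p \<in> P" for p
    using bspec[OF \<theta>' that] .
  define v where "v p = L2_of (osc e k (\<theta> p) (bump p r))" for p
  define w where "w p = v p /\<^sub>R norm (v p)" for p
  have vpos: "0 < norm (v p)" if "p \<in> P" for p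
    unfolding v_def using \<theta>[OF that] norm_bump_pos[OF r, of p] by linarith
  have w1: "norm (w p) = 1" if "p \<in> P" for p using vpos[OF that] by (simp add: w_def)
  have sq: "square_integrable (osc e k (\<theta> p) (bump p r))" if "p \<in> P" for p
    by (rule test_function_square_integrable[OF test_function_osc[OF tf[OF that]]])
  have orth: "w p \<bullet> w q = 0" if "p \<in> P" "q \<in> P" "p \<noteq> q" for p q
  proof -
    have zero: "osc e k (\<theta> p) (bump p r) x * osc e k (\<theta> q) (bump q r) x = 0" for x
      using disj[OF that] bump_nonzero_iff[OF r, of p x] bump_nonzero_iff[OF r, of q x]
      by (auto simp: osc_def)
    have "v p \<bullet> v q = 0"
      unfolding v_def inner_L2_of[OF sq[OF that(1)] sq[OF that(2)]]
      by (simp only: zero Bochner_Integration.integral_zero)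
    then show ?thesis by (simp add: w_def)
  qed
  have inj: "inj_on w P"
  proof (rule inj_onI, rule ccontr)
    fix p q assume "p \<in> P" "q \<in> P" "w p = w q" "p \<noteq> q"
    then show False using orth[of p q] w1[of q] by (simp add: norm_eq_sqrt_inner)
  qed
  have small: "\<bar>m \<bullet> w p\<bar> \<le> \<delta>" if p: "p \<in> P" and m: "m \<in> reachable_set \<Omega> \<omega> T" for m p
  proof -
    obtain y u where m: "m = y T" "norm u \<le> 1" "heat_solution \<Omega> T (localized_control \<omega> u) 0 y"
      using m by (auto simp: reachable_set_def)
    have "norm (localized_control \<omega> u) \<le> 1" using norm_localized_control_le[OF \<omega>, of u] m(2) by linarith
    then have "\<bar>m \<bullet> v p\<bar> \<le> C p / k"
      unfolding m(1) v_def using C[OF p k(1) m(3)] T by simp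
    also have "\<dots> \<le> \<delta> * (norm (L2_of (bump p r)) / 2)" using k(2)[OF p] by (rule less_imp_le)
    also have "\<dots> \<le> \<delta> * norm (v p)"
      unfolding v_def by (rule mult_left_mono[OF \<theta>[OF p]]) (use \<delta> in simp)
    finally show ?thesis using vpos[OF p] by (simp add: w_def abs_mult field_simps)
  qed
  have "v p \<in> L2_on \<Omega>" if p: "p \<in> P" for p
    unfolding L2_on_def mem_Collect_eq v_def using fun_of_L2_of[OF sq[OF p]]
  proof eventually_elim
    case (elim x)
    show ?case
    proof
      assume "x \<notin> \<Omega>"
      then have "x \<notin> ball p r" using sub[OF p] ball_subset_cball by blast
      then show "fun_of (L2_of (osc e k (\<theta> p) (bump p r))) x = 0"
        using bump_nonzero_iff[OF r, of p x] by (simp add: elim osc_def)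
    qed
  qed
  then have "w ` P \<subseteq> L2_on \<Omega>" by (auto simp: w_def intro: subspace_scale[OF subspace_L2_on])
  moreover have "pairwise orthogonal (w ` P)"
    using orth by (force simp: pairwise_def orthogonal_def)
  ultimately show ?thesis
    using P w1 small by (intro exI[of _ "w ` P"]) (auto simp: card_image[OF inj])
qed

theorem proposition3p2:
  fixes \<Omega> \<omega> :: "(real^'n) set" and T :: real
  assumes "open \<Omega>" and "connected \<Omega>" and "\<Omega> \<noteq> {}" and "bounded \<Omega>" and "smooth_boundary \<Omega>"
    and "open \<omega>" and "\<omega> \<noteq> {}" and "\<omega> \<subseteq> \<Omega>"
    and "0 < T"
  shows "\<not> finite_codimensional_in (reachable_set \<Omega> \<omega> T) (L2_on \<Omega>)"
  using assms
  by (intro not_finite_codimensional_in_if_small_directions reachable_set_small_directions) auto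

end
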